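(* Let $G$ be a finite group, let $\chi\in\mathrm{Irr}_K(G)$, and let $\varphi\in\mathrm{IBr}_k(G)$ be such that the decomposition number $d^\chi_\varphi$ is prime to $p$. Then the $\mathcal{O}$-algebra $\mathcal{O}Ge(\chi)$ is symmetric if and only if $\chi$ lifts $\varphi$.
   Context: Let $p$ be a prime and $\mathcal{O}$ a complete discrete valuation ring with residue field $k$ of characteristic $p$ and quotient field $K$ of characteristic zero; $K$ and $k$ are assumed to be splitting fields for all finite groups under consideration. $\mathrm{Irr}_K(G)$ is the set of irreducible $K$-valued characters of $G$, and $\mathrm{IBr}_k(G)$ the set of irreducible Brauer characters of $G$. For $\chi\in\mathrm{Irr}_K(G)$, $e(\chi)=\frac{\chi(1)}{|G|}\sum_{x\in G}\chi(x^{-1})x$ is the primitive idempotent of $Z(KG)$ corresponding to $\chi$, and $\mathcal{O}Ge(\chi)\subseteq KG$ is the image of $\mathcal{O}G$ under multiplication by $e(\chi)$, an $\mathcal{O}$-algebra with unit $e(\chi)$. The decomposition numbers $d^\chi_\varphi$ are the nonnegative integers such that the restriction of $\chi$ to the set of $p'$-elements of $G$ equals $\sum_{\varphi\in\mathrm{IBr}_k(G)}d^\chi_\varphi\,\varphi$. We say that $\chi$ lifts $\varphi\in\mathrm{IBr}_k(G)$ if the restriction of $\chi$ to the $p'$-elements of $G$ equals $\varphi$, equivalently $d^\chi_\varphi=1$ and $d^\chi_{\varphi'}=0$ for all $\varphi'\neq\varphi$. An $\mathcal{O}$-algebra $A$ is symmetric if $A$ is finitely generated projective as an $\mathcal{O}$-module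 and $A\cong\mathrm{Hom}_{\mathcal{O}}(A,\mathcal{O})$ as $A$-$A$-bimodules. *)

theory Defs
  imports
    "Jordan_Normal_Form.VS_Connect"
    "Jordan_Normal_Form.Char_Poly"
    "HOL-Algebra.Ring_Divisibility"
    "HOL-Algebra.Multiplicative_Group"
    "HOL-Computational_Algebra.Computational_Algebra"
begin

hide_const (open) Multiset.mult Polynomial.smult

section \<open>Complete discrete valuation rings\<close>

definition discrete_valuation_ring :: "'o::idom itself \<Rightarrow> bool" where
  "discrete_valuation_ring _ \<longleftrightarrow>
     principal_domain (class_ring :: 'o ring) \<and>
     (\<exists>!M. maximalideal M (class_ring :: 'o ring)) \<and>
     \<not> field (class_ring :: 'o ring)"

text \<open>Completeness is with respect to powers of the maximal ideal. In a discrete valuation ring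
  the prime elements are exactly the generators of that ideal, so membership in its \<open>n\<close>-th power
  is divisibility by \<open>\<pi> ^ n\<close>.\<close>

definition complete_discrete_valuation_ring :: "'o::idom itself \<Rightarrow> bool" where
  "complete_discrete_valuation_ring _ \<longleftrightarrow>
     discrete_valuation_ring TYPE('o) \<and>
     (\<forall>\<pi> (s :: nat \<Rightarrow> 'o).
        prime_elem \<pi> \<longrightarrow>
        (\<forall>n. \<exists>N. \<forall>i\<ge>N. \<forall>j\<ge>N. \<pi> ^ n dvd s i - s j) \<longrightarrow>
        (\<exists>l. \<forall>n. \<exists>N. \<forall>i\<ge>N. \<pi> ^ n dvd s i - l))"

text \<open>\<open>res\<close> exhibits \<open>'k\<close> as the residue field: it is a surjective ring homomorphism whose kernel
  is the maximal ideal, i.e. the set of non-units.\<close>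

definition residue_map :: "('o::idom \<Rightarrow> 'k::field) \<Rightarrow> bool" where
  "residue_map res \<longleftrightarrow> comm_ring_hom res \<and> surj res \<and> (\<forall>x. res x = 0 \<longleftrightarrow> \<not> x dvd 1)"

section \<open>Representations and ordinary characters\<close>

definition matrix_representation ::
    "('g, 'm) monoid_scheme \<Rightarrow> nat \<Rightarrow> ('g \<Rightarrow> 'a::field mat) \<Rightarrow> bool" where
  "matrix_representation G n \<rho> \<longleftrightarrow> \<rho> \<in> hom G (units_of (ring_mat TYPE('a) n ()))"

definition irreducible_representation ::
    "('g, 'm) monoid_scheme \<Rightarrow> nat \<Rightarrow> ('g \<Rightarrow> 'a::field mat) \<Rightarrow> bool" where
  "irreducible_representation G n \<rho> \<longleftrightarrow>
     matrix_representation G n \<rho> \<and> n > 0 \<and>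
     (\<forall>W. VectorSpace.subspace class_ring W (module_vec TYPE('a) n) \<and>
          (\<forall>x\<in>carrier G. \<forall>w\<in>W. \<rho> x *\<^sub>v w \<in> W) \<longrightarrow>
          W = {0\<^sub>v n} \<or> W = carrier_vec n)"

text \<open>A field is a splitting field for a finite group if every simple module has only scalar
  endomorphisms.\<close>

definition splitting_field :: "'a::field itself \<Rightarrow> ('g, 'm) monoid_scheme \<Rightarrow> bool" where
  "splitting_field _ G \<longleftrightarrow>
     (\<forall>n (\<rho> :: 'g \<Rightarrow> 'a mat). irreducible_representation G n \<rho> \<longrightarrow>
        (\<forall>A \<in> carrier_mat n n. (\<forall>x\<in>carrier G. A * \<rho> x = \<rho> x * A) \<longrightarrow>
           (\<exists>c. A = c \<cdot>\<^sub>m 1\<^sub>m n)))"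

definition character ::
    "('g, 'm) monoid_scheme \<Rightarrow> ('g \<Rightarrow> 'a::field mat) \<Rightarrow> 'g \<Rightarrow> 'a" where
  "character G \<rho> = (\<lambda>x\<in>carrier G. sum_list (diag_mat (\<rho> x)))"

definition Irr :: "('g, 'm) monoid_scheme \<Rightarrow> ('g \<Rightarrow> 'a::field) set" where
  "Irr G = {character G \<rho> | n \<rho>. irreducible_representation G n \<rho>}"

section \<open>Brauer characters and decomposition numbers\<close>

definition p_regular :: "nat \<Rightarrow> ('g, 'm) monoid_scheme \<Rightarrow> 'g set" where
  "p_regular p G = {x \<in> carrier G. coprime (group.ord G x) p}"

text \<open>The unique root of unity of order prime to \<open>p\<close> in \<open>'o\<close> with residue \<open>\<mu>\<close>.\<close>

definition root_of_unity_lift :: "nat \<Rightarrow> ('o::idom \<Rightarrow> 'k::field) \<Rightarrow> 'k \<Rightarrow> 'o" where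
  "root_of_unity_lift p res \<mu> =
     (THE \<zeta>. (\<exists>m>0. coprime m p \<and> \<zeta> ^ m = 1) \<and> res \<zeta> = \<mu>)"

text \<open>The sum of the lifted eigenvalues, counted with algebraic multiplicity, viewed in the
  quotient field. All eigenvalues of \<open>\<rho> x\<close> at a \<open>p\<close>-regular \<open>x\<close> lie in \<open>'k\<close> as soon as \<open>'k\<close> is a
  splitting field for the cyclic subgroup generated by \<open>x\<close>.\<close>

definition brauer_character ::
    "nat \<Rightarrow> ('o::idom \<Rightarrow> 'k::field) \<Rightarrow> ('g, 'm) monoid_scheme \<Rightarrow> ('g \<Rightarrow> 'k mat) \<Rightarrow>
     'g \<Rightarrow> 'o fract" where
  "brauer_character p res G \<rho> =
     (\<lambda>x\<in>p_regular p G. \<Sum>\<mu> | eigenvalue (\<rho> x) \<mu>.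
        of_nat (Polynomial.order \<mu> (char_poly (\<rho> x))) * to_fract (root_of_unity_lift p res \<mu>))"

definition IBr ::
    "nat \<Rightarrow> ('o::idom \<Rightarrow> 'k::field) \<Rightarrow> ('g, 'm) monoid_scheme \<Rightarrow> ('g \<Rightarrow> 'o fract) set" where
  "IBr p res G = {brauer_character p res G \<rho> | n \<rho>. irreducible_representation G n \<rho>}"

text \<open>The value is forced to be \<open>0\<close> off \<open>IBr p res G\<close> so that the description determines a unique
  function.\<close>

definition decomposition_number ::
    "nat \<Rightarrow> ('o::idom \<Rightarrow> 'k::field) \<Rightarrow> ('g, 'm) monoid_scheme \<Rightarrow> ('g \<Rightarrow> 'o fract) \<Rightarrow>
     ('g \<Rightarrow> 'o fract) \<Rightarrow> nat" where
  "decomposition_number p res G \<chi> =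
     (THE d. (\<forall>\<phi>. \<phi> \<notin> IBr p res G \<longrightarrow> d \<phi> = 0) \<and>
        (\<forall>x\<in>p_regular p G. \<chi> x = (\<Sum>\<phi>\<in>IBr p res G. of_nat (d \<phi>) * \<phi> x)))"

definition lifts ::
    "nat \<Rightarrow> ('g, 'm) monoid_scheme \<Rightarrow> ('g \<Rightarrow> 'a) \<Rightarrow> ('g \<Rightarrow> 'a) \<Rightarrow> bool" where
  "lifts p G \<chi> \<phi> \<longleftrightarrow> (\<forall>x\<in>p_regular p G. \<chi> x = \<phi> x)"

section \<open>Symmetric algebras\<close>

text \<open>Algebras over the commutative ring \<open>'o\<close>, not necessarily commutative (unlike the locale
  \<open>algebra\<close> of HOL-Algebra).\<close>

definition unital_algebra :: "('o::comm_ring_1, 'a) module \<Rightarrow> bool" where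
  "unital_algebra A \<longleftrightarrow>
     ring A \<and> Module.module class_ring A \<and>
     (\<forall>r. \<forall>x\<in>carrier A. \<forall>y\<in>carrier A.
        (r \<odot>\<^bsub>A\<^esub> x) \<otimes>\<^bsub>A\<^esub> y = r \<odot>\<^bsub>A\<^esub> (x \<otimes>\<^bsub>A\<^esub> y) \<and>
        x \<otimes>\<^bsub>A\<^esub> (r \<odot>\<^bsub>A\<^esub> y) = r \<odot>\<^bsub>A\<^esub> (x \<otimes>\<^bsub>A\<^esub> y))"

text \<open>Finitely generated projective: a direct summand of a free module of finite rank.\<close>

definition finitely_generated_projective :: "('o::comm_ring_1, 'a) module \<Rightarrow> bool" where
  "finitely_generated_projective M \<longleftrightarrow>
     (\<exists>n. \<exists>\<iota> \<in> LinearCombinations.module_hom class_ring M (module_vec TYPE('o) n).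
          \<exists>\<sigma> \<in> LinearCombinations.module_hom class_ring (module_vec TYPE('o) n) M.
            \<forall>x\<in>carrier M. \<sigma> (\<iota> x) = x)"

definition regular_module :: "('o::comm_ring_1, 'o) module" where
  "regular_module =
     \<lparr>carrier = UNIV, mult = (*), one = 1, zero = 0, add = (+), smult = (*)\<rparr>"

text \<open>Elements of the dual are made extensional so that equality is equality on \<open>carrier A\<close>.\<close>

definition dual :: "('o::comm_ring_1, 'a) module \<Rightarrow> ('a \<Rightarrow> 'o) set" where
  "dual A = LinearCombinations.module_hom class_ring A regular_module \<inter> extensional (carrier A)"

definition dual_action :: "('o::comm_ring_1, 'a) module \<Rightarrow> 'a \<Rightarrow> ('a \<Rightarrow> 'o) \<Rightarrow> 'a \<Rightarrow> 'a \<Rightarrow> 'o" where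
  "dual_action A a f b = (\<lambda>x\<in>carrier A. f (b \<otimes>\<^bsub>A\<^esub> x \<otimes>\<^bsub>A\<^esub> a))"

definition symmetric_algebra :: "('o::comm_ring_1, 'a) module \<Rightarrow> bool" where
  "symmetric_algebra A \<longleftrightarrow>
     unital_algebra A \<and> finitely_generated_projective A \<and>
     (\<exists>\<Phi>. bij_betw \<Phi> (carrier A) (dual A) \<and>
        (\<forall>x\<in>carrier A. \<forall>y\<in>carrier A. \<Phi> (x \<oplus>\<^bsub>A\<^esub> y) = (\<lambda>z\<in>carrier A. \<Phi> x z + \<Phi> y z)) \<and>
        (\<forall>a\<in>carrier A. \<forall>b\<in>carrier A. \<forall>x\<in>carrier A.
           \<Phi> (a \<otimes>\<^bsub>A\<^esub> x \<otimes>\<^bsub>A\<^esub> b) = dual_action A a (\<Phi> x) b))"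

section \<open>Group algebras and the algebra attached to a character\<close>

text \<open>Elements of the group algebra are coefficient functions vanishing off \<open>carrier G\<close>.\<close>

definition group_algebra :: "('g, 'm) monoid_scheme \<Rightarrow> ('a::field, 'g \<Rightarrow> 'a) module" where
  "group_algebra G =
     \<lparr>carrier = {a. \<forall>x. x \<notin> carrier G \<longrightarrow> a x = 0},
      mult = (\<lambda>a b z. if z \<in> carrier G
                      then \<Sum>x\<in>carrier G. a x * b (inv\<^bsub>G\<^esub> x \<otimes>\<^bsub>G\<^esub> z) else 0),
      one = (\<lambda>x. if x = \<one>\<^bsub>G\<^esub> then 1 else 0),
      zero = (\<lambda>x. 0),
      add = (\<lambda>a b x. a x + b x),
      smult = (\<lambda>c a x. c * a x)\<rparr>"

definition integral_group_algebra :: "('g, 'm) monoid_scheme \<Rightarrow> ('g \<Rightarrow> 'o::idom fract) set" where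
  "integral_group_algebra G = {a \<in> carrier (group_algebra G). range a \<subseteq> range to_fract}"

definition central_idempotent ::
    "('g, 'm) monoid_scheme \<Rightarrow> ('g \<Rightarrow> 'a::field) \<Rightarrow> 'g \<Rightarrow> 'a" where
  "central_idempotent G \<chi> =
     (\<lambda>x. if x \<in> carrier G
          then \<chi> \<one>\<^bsub>G\<^esub> / of_nat (card (carrier G)) * \<chi> (inv\<^bsub>G\<^esub> x) else 0)"

definition character_algebra ::
    "('g, 'm) monoid_scheme \<Rightarrow> ('g \<Rightarrow> 'o::idom fract) \<Rightarrow> ('o, 'g \<Rightarrow> 'o fract) module" where
  "character_algebra G \<chi> =
     \<lparr>carrier = (\<lambda>a. a \<otimes>\<^bsub>group_algebra G\<^esub> central_idempotent G \<chi>) ` integral_group_algebra G,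
      mult = monoid.mult (group_algebra G),
      one = central_idempotent G \<chi>,
      zero = zero (group_algebra G),
      add = add (group_algebra G),
      smult = (\<lambda>r a. to_fract r \<odot>\<^bsub>group_algebra G\<^esub> a)\<rparr>"

end

theory Submission
  imports Defs "HOL-Number_Theory.Residues"
begin

text \<open>Write \<open>K\<close> for the quotient field of \<open>\<O>\<close> and \<open>n\<close> for the degree of \<open>\<chi>\<close>. A representation affording
\<open>\<chi>\<close> can be written with matrices \<open>R x\<close> over \<open>\<O>\<close>. Because \<open>K\<close> splits \<open>G\<close>, Schur's orthogonality
relations make \<open>X \<mapsto> (z \<mapsto> n / |G| * tr (X R(z\<^sup>-\<^sup>1)))\<close> an isomorphism from the \<open>n \<times> n\<close> matrices onto
\<open>K G e(\<chi>)\<close>, and it carries the \<open>\<O>\<close>-span \<open>\<Lambda>\<close> of the matrices \<open>R x\<close> onto \<open>\<O> G e(\<chi>)\<close>. Everything then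
hinges on whether \<open>\<Lambda>\<close> is the full matrix ring over \<open>\<O>\<close>.

Suppose that \<open>\<O> G e(\<chi>)\<close> is symmetric. The image of \<open>1\<close> under a bimodule isomorphism onto the dual is a
linear form \<open>F\<close> on \<open>\<Lambda>\<close> with \<open>F (X Y) = F (Y X)\<close>, so \<open>F = c * tr\<close> for some \<open>c\<close> in \<open>K\<close>, again because
only scalars commute with all \<open>R x\<close>. Modulo the maximal ideal, \<open>\<chi>\<close> is the sum of the traces of the simple
modules weighted by the decomposition numbers; these traces are linearly independent, and one
weight is prime to \<open>p\<close>, so some \<open>\<chi> g\<close> is a unit. Hence \<open>c\<close> is in \<open>\<O>\<close>. Every matrix \<open>Z\<close> over \<open>\<O>\<close> gives
the form \<open>X \<mapsto> tr (X Z)\<close> on \<open>\<Lambda>\<close>, which must equal \<open>X \<mapsto> F (X Y)\<close> for some \<open>Y\<close> in \<open>\<Lambda>\<close>; so \<open>Z = c Y\<close> lies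
in \<open>\<Lambda>\<close>, and \<open>\<Lambda>\<close> is the full matrix ring (\<open>full_order_if_symmetric\<close>). Then \<open>R\<close> modulo the maximal ideal
is irreducible, \<open>\<chi>\<close> restricts to a single irreducible Brauer character, and this must be the one
whose multiplicity is nonzero, namely \<open>\<phi>\<close>.

Conversely, let \<open>\<chi>\<close> lift \<open>\<phi>\<close>. By uniqueness of decomposition numbers the reduction of \<open>R\<close> has just one
composition factor, so it is irreducible. By Burnside's theorem (\<open>burnside_span\<close>) its matrices span
all matrices over the residue field. Together with \<open>|G| X \<in> \<Lambda>\<close> for every integral \<open>X\<close> this lifts to
\<open>\<Lambda>\<close> being the full matrix ring (\<open>full_order_if_reduction_spans\<close>), which the trace form makes a
symmetric algebra (\<open>symmetric_if_full_order\<close>).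

The modular input, Burnside's theorem and the linear independence of irreducible traces, comes
from one statement about matrix coefficients, \<open>frobenius_schur\<close>. Independence of the Brauer
characters follows by reducing integral relations modulo \<open>p\<close> (\<open>brauer_characters_independent\<close>).\<close>

no_notation fps_nth (infixl \<open>$\<close> 75)

section \<open>Traces, subspaces and block matrices\<close>

definition mat_trace :: "'a::semiring_1 mat \<Rightarrow> 'a" where
  "mat_trace A = (\<Sum>i<dim_row A. A $$ (i, i))"

lemma sum_list_diag_mat: "sum_list (diag_mat A) = mat_trace A"
  by (simp add: diag_mat_def mat_trace_def interv_sum_list_conv_sum_set_nat atLeast0LessThan)

lemma mat_trace_mult:
  assumes "A \<in> carrier_mat n m" "B \<in> carrier_mat m n"
  shows "mat_trace (A * B) = (\<Sum>i<n. \<Sum>j<m. A $$ (i, j) * B $$ (j, i))"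
  using assms by (auto simp: mat_trace_def scalar_prod_def atLeast0LessThan intro!: sum.cong)

lemma mat_trace_mult_commute:
  fixes A B :: "'a::comm_semiring_1 mat"
  assumes "A \<in> carrier_mat n m" "B \<in> carrier_mat m n"
  shows "mat_trace (A * B) = mat_trace (B * A)"
  unfolding mat_trace_mult[OF assms] mat_trace_mult[OF assms(2,1)]
  by (subst sum.swap) (simp add: mult.commute)

lemma mat_trace_add:
  assumes "A \<in> carrier_mat n n" "B \<in> carrier_mat n n"
  shows "mat_trace (A + B) = mat_trace A + mat_trace B"
  using assms by (auto simp: mat_trace_def sum.distrib)

lemma mat_trace_smult:
  assumes "A \<in> carrier_mat n n"
  shows "mat_trace (c \<cdot>\<^sub>m A) = c * mat_trace A"
  using assms by (auto simp: mat_trace_def sum_distrib_left)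

lemma mat_trace_similar:
  fixes A :: "'a::comm_ring_1 mat"
  assumes "A \<in> carrier_mat n n" "P \<in> carrier_mat n n" "Q \<in> carrier_mat n n" "P * Q = 1\<^sub>m n"
  shows "mat_trace (Q * A * P) = mat_trace A"
proof -
  have "mat_trace (Q * A * P) = mat_trace (P * (Q * A))"
    using assms by (intro mat_trace_mult_commute[of _ n n]) auto
  also have "P * (Q * A) = A"
    using assms by (simp flip: assoc_mult_mat[OF assms(2,3,1)])
  finally show ?thesis .
qed

lemma mat_trace_mult_mat_unit:
  fixes X :: "'a::comm_semiring_1 mat"
  assumes "X \<in> carrier_mat n n" "i < n" "j < n"
  shows "mat_trace (X * mat n n (\<lambda>(k, l). if k = i \<and> l = j then 1 else 0)) = X $$ (j, i)"
proof -
  let ?E = "mat n n (\<lambda>(k, l). if k = i \<and> l = j then 1 else 0) :: 'a mat"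
  have "mat_trace (X * ?E) = (\<Sum>k<n. \<Sum>l<n. X $$ (k, l) * ?E $$ (l, k))"
    using assms by (intro mat_trace_mult) auto
  also have "\<dots> = (\<Sum>k<n. \<Sum>l<n. if l = i then (if k = j then X $$ (k, l) else 0) else 0)"
    by (intro sum.cong refl) auto
  also have "\<dots> = (\<Sum>k<n. if k = j then X $$ (k, i) else 0)"
    using assms by simp
  finally show ?thesis using assms by simp
qed

text \<open>The trace form is nondegenerate: pairing with matrix units reads off the entries.\<close>

lemma mat_eq_if_traces_eq:
  fixes X Y :: "'a::comm_semiring_1 mat"
  assumes "X \<in> carrier_mat n n" "Y \<in> carrier_mat n n"
    and "\<And>Z. Z \<in> carrier_mat n n \<Longrightarrow> mat_trace (X * Z) = mat_trace (Y * Z)"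
  shows "X = Y"
proof (rule eq_matI)
  fix i j assume "i < dim_row Y" "j < dim_col Y"
  thus "X $$ (i, j) = Y $$ (i, j)"
    using assms(3)[of "mat n n (\<lambda>(k, l). if k = j \<and> l = i then 1 else 0)"] assms
    by (simp add: mat_trace_mult_mat_unit)
qed (use assms in auto)

lemma subspace_module_vecD:
  assumes "VectorSpace.subspace class_ring W (module_vec TYPE('a::field) n)"
  shows "W \<subseteq> carrier_vec n" "0\<^sub>v n \<in> W"
    "\<And>v w. v \<in> W \<Longrightarrow> w \<in> W \<Longrightarrow> v + w \<in> W" "\<And>c v. v \<in> W \<Longrightarrow> c \<cdot>\<^sub>v v \<in> W"
proof -
  interpret submodule class_ring W "module_vec TYPE('a) n"
    using assms by (auto simp: VectorSpace.subspace_def)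
  show "W \<subseteq> carrier_vec n" "0\<^sub>v n \<in> W"
    "\<And>v w. v \<in> W \<Longrightarrow> w \<in> W \<Longrightarrow> v + w \<in> W" "\<And>c v. v \<in> W \<Longrightarrow> c \<cdot>\<^sub>v v \<in> W"
    using subset zero_closed m_closed smult_closed by (auto simp: module_vec_simps)
qed

lemma subspace_module_vecI:
  fixes W :: "'a::field vec set"
  assumes "W \<subseteq> carrier_vec n" "0\<^sub>v n \<in> W"
    "\<And>v w. v \<in> W \<Longrightarrow> w \<in> W \<Longrightarrow> v + w \<in> W" "\<And>c v. v \<in> W \<Longrightarrow> c \<cdot>\<^sub>v v \<in> W"
  shows "VectorSpace.subspace class_ring W (module_vec TYPE('a) n)"
  using assms vec_vs vec_module
  by (auto simp: VectorSpace.subspace_def LinearCombinations.submodule_def module_vec_simps)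

lemma subspace_lincomb_closed:
  fixes W :: "'a::field vec set"
  assumes W: "VectorSpace.subspace class_ring W (module_vec TYPE('a) n)"
    and "finite X" "\<And>x. x \<in> X \<Longrightarrow> a x \<noteq> 0 \<Longrightarrow> f x \<in> W"
  shows "vec n (\<lambda>i. \<Sum>x\<in>X. a x * f x $ i) \<in> W"
  using assms(2,3)
proof (induction X rule: finite_induct)
  case empty
  have "vec n (\<lambda>i. 0) = (0\<^sub>v n :: 'a vec)" by auto
  thus ?case using subspace_module_vecD[OF W] by simp
next
  case (insert x X)
  note D = subspace_module_vecD[OF W]
  have IH: "vec n (\<lambda>i. \<Sum>x\<in>X. a x * f x $ i) \<in> W" using insert by auto
  show ?case
  proof (cases "a x = 0")
    case True
    thus ?thesis using IH insert by simp
  next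
    case False
    hence "f x \<in> W" using insert by auto
    moreover have "vec n (\<lambda>i. \<Sum>x\<in>insert x X. a x * f x $ i) =
        a x \<cdot>\<^sub>v f x + vec n (\<lambda>i. \<Sum>x\<in>X. a x * f x $ i)"
      using insert \<open>f x \<in> W\<close> D(1) by (intro eq_vecI) auto
    ultimately show ?thesis using IH D by auto
  qed
qed

lemma mult_mat_vec_as_lincomb:
  fixes P :: "'a::comm_semiring_1 mat"
  assumes "P \<in> carrier_mat n m" "w \<in> carrier_vec m"
  shows "P *\<^sub>v w = vec n (\<lambda>i. \<Sum>j<m. w $ j * col P j $ i)"
  using assms
  by (intro eq_vecI) (auto simp: scalar_prod_def atLeast0LessThan mult.commute intro!: sum.cong)

lemma nonzero_det_inverse:
  fixes P :: "'a::field mat"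
  assumes "P \<in> carrier_mat n n" "det P \<noteq> 0"
  obtains Q where "Q \<in> carrier_mat n n" "P * Q = 1\<^sub>m n" "Q * P = 1\<^sub>m n"
  using det_non_zero_imp_unit[OF assms, of "()"] that
  unfolding Units_def by (auto simp: ring_mat_simps)

text \<open>Choose an invertible \<open>P\<close> with as many leading columns in \<open>W\<close> as possible. If a vector of \<open>W\<close> had a
nonzero coordinate beyond these columns, then by Cramer's rule it could replace a later column of
\<open>P\<close> without destroying invertibility, contradicting the choice.\<close>

lemma subspace_adapted_basis:
  fixes W :: "'a::field vec set"
  assumes W: "VectorSpace.subspace class_ring W (module_vec TYPE('a) n)"
  obtains d P Q where "d \<le> n" "P \<in> carrier_mat n n" "Q \<in> carrier_mat n n"
    "P * Q = 1\<^sub>m n" "Q * P = 1\<^sub>m n"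
    "W = {P *\<^sub>v w | w. w \<in> carrier_vec n \<and> (\<forall>i<n. d \<le> i \<longrightarrow> w $ i = 0)}"
proof -
  note D = subspace_module_vecD[OF W]
  define good where "good d \<longleftrightarrow> d \<le> n \<and>
    (\<exists>P. P \<in> carrier_mat n n \<and> det P \<noteq> 0 \<and> (\<forall>j<d. col P j \<in> W))" for d
  have "good 0" unfolding good_def
    by (intro conjI exI[of _ "1\<^sub>m n"]) auto
  have fin: "finite {d. good d}"
    by (rule finite_subset[of _ "{..n}"]) (auto simp: good_def)
  define d where "d = Max {d. good d}"
  have "good d" and max: "\<And>e. good e \<Longrightarrow> e \<le> d"
    using Max_in[OF fin] \<open>good 0\<close> Max_ge[OF fin] by (auto simp: d_def)
  then obtain P where dn: "d \<le> n" and P: "P \<in> carrier_mat n n" "det P \<noteq> 0"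
    and cols: "\<And>j. j < d \<Longrightarrow> col P j \<in> W"
    unfolding good_def by blast
  obtain Q where Q: "Q \<in> carrier_mat n n" "P * Q = 1\<^sub>m n" "Q * P = 1\<^sub>m n"
    using nonzero_det_inverse[OF P] .
  have "P *\<^sub>v w \<in> W" if w: "w \<in> carrier_vec n" "\<forall>i<n. d \<le> i \<longrightarrow> w $ i = 0" for w
    unfolding mult_mat_vec_as_lincomb[OF P(1) w(1)]
    by (rule subspace_lincomb_closed[OF W]) (use w cols not_le in auto)
  moreover have "\<exists>w. v = P *\<^sub>v w \<and> w \<in> carrier_vec n \<and> (\<forall>i<n. d \<le> i \<longrightarrow> w $ i = 0)"
    if v: "v \<in> W" for v
  proof (intro exI[of _ "Q *\<^sub>v v"] conjI allI impI)
    have vn: "v \<in> carrier_vec n" using v D by auto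
    show v_eq: "v = P *\<^sub>v (Q *\<^sub>v v)"
      using P Q vn by (simp flip: assoc_mult_mat_vec)
    show w: "Q *\<^sub>v v \<in> carrier_vec n" using Q vn by auto
    fix i assume i: "i < n" "d \<le> i"
    show "(Q *\<^sub>v v) $ i = 0"
    proof (rule ccontr)
      assume nz: "(Q *\<^sub>v v) $ i \<noteq> 0"
      (* Exchange column i for v, then move it to position d. *)
      define P1 where "P1 = replace_col P v i"
      have P1: "P1 \<in> carrier_mat n n" using P by (auto simp: P1_def replace_col_def)
      have "det P1 \<noteq> 0"
        using cramer_lemma_mat[OF P(1) w i(1)] nz P(2) v_eq by (simp add: P1_def)
      define P2 where "P2 = (if i = d then P1 else swapcols i d P1)"
      have "det P2 \<noteq> 0"
        using \<open>det P1 \<noteq> 0\<close> det_swapcols[of i n d P1] i P1 by (auto simp: P2_def)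
      moreover have "P2 \<in> carrier_mat n n" using P1 by (auto simp: P2_def mat_swapcols_def)
      moreover have "col P2 j \<in> W" if "j < Suc d" for j
      proof (cases "j = d")
        case True
        have "col P2 d = v"
          using P v P1 i vn by (intro eq_vecI) (auto simp: P2_def P1_def replace_col_def)
        thus ?thesis using v True by simp
      next
        case False
        hence "j < d" using that by auto
        moreover from this have "col P2 j = col P j"
          using P v P1 i vn by (intro eq_vecI) (auto simp: P2_def P1_def replace_col_def)
        ultimately show ?thesis using cols by simp
      qed
      ultimately have "good (Suc d)" using i by (auto simp: good_def)
      thus False using max by fastforce
    qed
  qed
  ultimately have "W = {P *\<^sub>v w | w. w \<in> carrier_vec n \<and> (\<forall>i<n. d \<le> i \<longrightarrow> w $ i = 0)}"
    by auto
  thus ?thesis using that dn P Q by blast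
qed

text \<open>In an adapted basis the first coordinate that vanishes on \<open>W\<close> is a row of the inverse matrix.\<close>

lemma annihilator_of_proper_subspace:
  fixes W :: "'a::field vec set"
  assumes W: "VectorSpace.subspace class_ring W (module_vec TYPE('a) n)"
    and "W \<noteq> carrier_vec n"
  obtains c where "c \<in> carrier_vec n" "c \<noteq> 0\<^sub>v n" "\<And>w. w \<in> W \<Longrightarrow> c \<bullet> w = 0"
proof -
  obtain d P Q where d: "d \<le> n" and PQ: "P \<in> carrier_mat n n" "Q \<in> carrier_mat n n"
    "P * Q = 1\<^sub>m n" "Q * P = 1\<^sub>m n"
    and WP: "W = {P *\<^sub>v w | w. w \<in> carrier_vec n \<and> (\<forall>i<n. d \<le> i \<longrightarrow> w $ i = 0)}"
    using subspace_adapted_basis[OF W] .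
  have "d \<noteq> n"
  proof
    assume "d = n"
    have "v \<in> W" if "v \<in> carrier_vec n" for v
    proof -
      have "v = P *\<^sub>v (Q *\<^sub>v v)" using that PQ by (simp flip: assoc_mult_mat_vec)
      moreover have "Q *\<^sub>v v \<in> carrier_vec n" using that PQ by auto
      ultimately show ?thesis unfolding WP using \<open>d = n\<close> by auto
    qed
    thus False using assms(2) subspace_module_vecD(1)[OF W] by blast
  qed
  with d have dn: "d < n" by auto
  have zero: "row Q d \<bullet> (P *\<^sub>v w) = w $ d" if "w \<in> carrier_vec n" for w
  proof -
    have "row Q d \<bullet> (P *\<^sub>v w) = (Q *\<^sub>v (P *\<^sub>v w)) $ d" using PQ dn by auto
    also have "Q *\<^sub>v (P *\<^sub>v w) = w" using that PQ by (simp flip: assoc_mult_mat_vec)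
    finally show ?thesis .
  qed
  show ?thesis
  proof (rule that[of "row Q d"])
    show "row Q d \<in> carrier_vec n" using PQ by auto
    show "row Q d \<noteq> 0\<^sub>v n"
    proof
      assume "row Q d = 0\<^sub>v n"
      hence "0\<^sub>v n \<bullet> (P *\<^sub>v unit_vec n d) = (1::'a)" using zero[of "unit_vec n d"] dn by simp
      thus False using PQ by simp
    qed
    fix w assume "w \<in> W"
    thus "row Q d \<bullet> w = 0" using zero dn unfolding WP by auto
  qed
qed

lemma char_poly_block_upper_triangular:
  fixes A :: "'a::idom mat"
  assumes A: "A \<in> carrier_mat a a" and B: "B \<in> carrier_mat a b" and D: "D \<in> carrier_mat b b"
  shows "char_poly (four_block_mat A B (0\<^sub>m b a) D) = char_poly A * char_poly D"
proof -
  let ?cm = "\<lambda>A. [:0, 1:] \<cdot>\<^sub>m 1\<^sub>m (dim_row A) + map_mat (\<lambda>a. [:- a:]) A"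
  have "char_poly (four_block_mat A B (0\<^sub>m b a) D) = det (?cm (four_block_mat A B (0\<^sub>m b a) D))"
    unfolding char_poly_defs using A D by simp
  also have "?cm (four_block_mat A B (0\<^sub>m b a) D) =
      four_block_mat (?cm A) (map_mat (\<lambda>a. [:- a:]) B) (0\<^sub>m b a) (?cm D)"
    by (rule eq_matI, insert A B D, auto simp: one_poly_def)
  also have "det \<dots> = det (?cm A) * det (?cm D)"
    by (rule det_four_block_mat_lower_left_zero[OF _ _ refl], insert A B D, auto)
  also have "\<dots> = char_poly A * char_poly D" unfolding char_poly_defs ..
  finally show ?thesis .
qed

lemma char_poly_similar_by:
  fixes A :: "'a::comm_ring_1 mat"
  assumes "A \<in> carrier_mat n n" "P \<in> carrier_mat n n" "Q \<in> carrier_mat n n"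
    "P * Q = 1\<^sub>m n" "Q * P = 1\<^sub>m n"
  shows "char_poly (Q * A * P) = char_poly A"
  by (rule char_poly_similar, rule similar_matI[of _ _ Q P n]) (use assms in auto)

section \<open>Matrix representations and composition series\<close>

text \<open>The coefficients may come from any commutative ring, so that an integral representation, its
reduction and its extension to the quotient field are all instances.\<close>

definition matrix_rep :: "('g, 'm) monoid_scheme \<Rightarrow> nat \<Rightarrow> ('g \<Rightarrow> 'a::comm_ring_1 mat) \<Rightarrow> bool" where
  "matrix_rep G n \<rho> \<longleftrightarrow> (\<forall>x\<in>carrier G. \<rho> x \<in> carrier_mat n n) \<and> \<rho> \<one>\<^bsub>G\<^esub> = 1\<^sub>m n \<and>
     (\<forall>x\<in>carrier G. \<forall>y\<in>carrier G. \<rho> (x \<otimes>\<^bsub>G\<^esub> y) = \<rho> x * \<rho> y)"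

lemma matrix_repD:
  assumes "matrix_rep G n \<rho>"
  shows "x \<in> carrier G \<Longrightarrow> \<rho> x \<in> carrier_mat n n" "\<rho> \<one>\<^bsub>G\<^esub> = 1\<^sub>m n"
    "x \<in> carrier G \<Longrightarrow> y \<in> carrier G \<Longrightarrow> \<rho> (x \<otimes>\<^bsub>G\<^esub> y) = \<rho> x * \<rho> y"
  using assms by (auto simp: matrix_rep_def)

context group
begin

lemma matrix_rep_inv:
  assumes "matrix_rep G n \<rho>" "x \<in> carrier G"
  shows "\<rho> (inv x) * \<rho> x = 1\<^sub>m n" "\<rho> x * \<rho> (inv x) = 1\<^sub>m n"
  using matrix_repD[OF assms(1)] assms(2) by (metis l_inv r_inv inv_closed)+

lemma matrix_representation_iff:
  fixes \<rho> :: "'a \<Rightarrow> 'f::field mat"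
  shows "matrix_representation G n \<rho> \<longleftrightarrow> matrix_rep G n \<rho>"
proof
  assume "matrix_representation G n \<rho>"
  hence *: "\<rho> \<in> hom G (units_of (ring_mat TYPE('f) n ()))"
    by (simp add: matrix_representation_def)
  interpret M: ring "ring_mat TYPE('f) n ()" by (rule ring_mat)
  interpret group_hom G "units_of (ring_mat TYPE('f) n ())" \<rho>
    using * M.units_group by (simp add: group_hom_def group_hom_axioms_def is_group)
  have "\<rho> x \<in> Units (ring_mat TYPE('f) n ())" if "x \<in> carrier G" for x
    using hom_closed[OF that] by (simp add: units_of_carrier)
  hence "\<rho> x \<in> carrier_mat n n" if "x \<in> carrier G" for x
    using that M.Units_closed by (fastforce simp: ring_mat_simps)
  moreover have "\<rho> \<one> = 1\<^sub>m n" using hom_one by (simp add: units_of_one ring_mat_simps)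
  moreover have "\<rho> (x \<otimes> y) = \<rho> x * \<rho> y" if "x \<in> carrier G" "y \<in> carrier G" for x y
    using hom_mult[OF that] by (simp add: units_of_mult ring_mat_simps)
  ultimately show "matrix_rep G n \<rho>" by (auto simp: matrix_rep_def)
next
  assume *: "matrix_rep G n \<rho>"
  note D = matrix_repD[OF *]
  have "\<rho> x \<in> Units (ring_mat TYPE('f) n ())" if "x \<in> carrier G" for x
    using matrix_rep_inv[OF * that] D(1)[OF that] D(1)[OF inv_closed[OF that]]
    by (auto simp: Units_def ring_mat_simps)
  thus "matrix_representation G n \<rho>"
    using D(3) by (auto simp: matrix_representation_def hom_def units_of_def ring_mat_simps)
qed

lemma irreducibleD:
  assumes "irreducible_representation G n \<rho>"
  shows "matrix_rep G n \<rho>" "0 < n"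
    "\<And>W. VectorSpace.subspace class_ring W (module_vec TYPE('f::field) n) \<Longrightarrow>
      (\<And>x w. x \<in> carrier G \<Longrightarrow> w \<in> W \<Longrightarrow> (\<rho> x :: 'f mat) *\<^sub>v w \<in> W) \<Longrightarrow>
      W = {0\<^sub>v n} \<or> W = carrier_vec n"
  using assms unfolding irreducible_representation_def matrix_representation_iff by auto

lemma matrix_rep_conjugate:
  assumes "matrix_rep G n \<rho>" "P \<in> carrier_mat n n" "Q \<in> carrier_mat n n"
    "P * Q = 1\<^sub>m n" "Q * P = 1\<^sub>m n"
  shows "matrix_rep G n (\<lambda>x. Q * \<rho> x * P)"
  unfolding matrix_rep_def
proof (intro conjI ballI)
  note D = matrix_repD[OF assms(1)]
  fix x assume x: "x \<in> carrier G"
  show "Q * \<rho> x * P \<in> carrier_mat n n" using D(1)[OF x] assms by auto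
  fix y assume y: "y \<in> carrier G"
  have "Q * \<rho> x * P * (Q * \<rho> y * P) = Q * \<rho> x * (P * (Q * \<rho> y * P))"
    using D(1)[OF x] D(1)[OF y] assms by (intro assoc_mult_mat) auto
  also have "P * (Q * \<rho> y * P) = (P * Q) * (\<rho> y * P)"
    using D(1)[OF y] assms(2,3) by (simp add: assoc_mult_mat[of _ n n _ n _ n])
  also have "\<dots> = \<rho> y * P" using D(1)[OF y] assms by simp
  also have "Q * \<rho> x * (\<rho> y * P) = Q * (\<rho> x * \<rho> y) * P"
    using D(1)[OF x] D(1)[OF y] assms by (simp add: assoc_mult_mat[of _ n n _ n _ n])
  finally show "Q * \<rho> (x \<otimes> y) * P = Q * \<rho> x * P * (Q * \<rho> y * P)"
    using D(3)[OF x y] by simp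
qed (use assms matrix_repD(2)[OF assms(1)] in auto)

text \<open>Conjugating by a basis adapted to the invariant subspace makes all matrices block upper triangular;
\<open>A\<close> and \<open>D\<close> are the subrepresentation and the quotient.\<close>

lemma invariant_subspace_block_form:
  fixes \<rho> :: "'a \<Rightarrow> 'f::field mat"
  assumes \<rho>: "matrix_rep G n \<rho>"
    and W: "VectorSpace.subspace class_ring W (module_vec TYPE('f) n)"
    and inv: "\<And>x w. x \<in> carrier G \<Longrightarrow> w \<in> W \<Longrightarrow> \<rho> x *\<^sub>v w \<in> W"
    and proper: "W \<noteq> {0\<^sub>v n}" "W \<noteq> carrier_vec n"
  obtains d A D where "0 < d" "d < n" "matrix_rep G d A" "matrix_rep G (n - d) D"
    "\<forall>x\<in>carrier G. char_poly (\<rho> x) = char_poly (A x) * char_poly (D x)"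
    "\<forall>x\<in>carrier G. mat_trace (\<rho> x) = mat_trace (A x) + mat_trace (D x)"
proof -
  obtain d P Q where dn: "d \<le> n" and PQ: "P \<in> carrier_mat n n" "Q \<in> carrier_mat n n"
    "P * Q = 1\<^sub>m n" "Q * P = 1\<^sub>m n"
    and WP: "W = {P *\<^sub>v w | w. w \<in> carrier_vec n \<and> (\<forall>i<n. d \<le> i \<longrightarrow> w $ i = 0)}"
    using subspace_adapted_basis[OF W] .
  have inverse: "Q *\<^sub>v (P *\<^sub>v w) = w" "P *\<^sub>v (Q *\<^sub>v w) = w" if "w \<in> carrier_vec n" for w
    using that PQ by (simp_all flip: assoc_mult_mat_vec)
  have "d \<noteq> n"
  proof
    assume "d = n"
    have "v \<in> W" if "v \<in> carrier_vec n" for v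
      unfolding WP using \<open>d = n\<close> inverse(2)[OF that] that PQ
      by (intro CollectI exI[of _ "Q *\<^sub>v v"]) auto
    thus False using proper subspace_module_vecD(1)[OF W] by blast
  qed
  have "d \<noteq> 0"
  proof
    assume "d = 0"
    hence "w = 0\<^sub>v n" if "w \<in> carrier_vec n" "\<forall>i<n. d \<le> i \<longrightarrow> w $ i = 0" for w :: "'f vec"
      using that by (intro eq_vecI) auto
    moreover have "P *\<^sub>v 0\<^sub>v n = 0\<^sub>v n" using PQ by auto
    ultimately have "W \<subseteq> {0\<^sub>v n}" unfolding WP by fastforce
    thus False using proper subspace_module_vecD(2)[OF W] by blast
  qed
  define \<tau> where "\<tau> x = Q * \<rho> x * P" for x
  have \<tau>: "matrix_rep G n \<tau>" unfolding \<tau>_def by (rule matrix_rep_conjugate[OF \<rho> PQ])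
  note T = matrix_repD[OF \<tau>]
  define m where "m = n - d"
  have m: "n = d + m" using dn by (simp add: m_def)
  define A where "A x = mat d d (\<lambda>(i, j). \<tau> x $$ (i, j))" for x
  define B where "B x = mat d m (\<lambda>(i, j). \<tau> x $$ (i, j + d))" for x
  define D where "D x = mat m m (\<lambda>(i, j). \<tau> x $$ (i + d, j + d))" for x
  have carr: "A x \<in> carrier_mat d d" "B x \<in> carrier_mat d m" "D x \<in> carrier_mat m m" for x
    by (auto simp: A_def B_def D_def)
  have zero: "\<tau> x $$ (i, j) = 0" if x: "x \<in> carrier G" and i: "i < n" "d \<le> i" and j: "j < d" for x i j
  proof -
    have "P *\<^sub>v unit_vec n j \<in> W" unfolding WP using i j by auto
    from inv[OF x this] obtain w where w: "w \<in> carrier_vec n" "\<forall>i<n. d \<le> i \<longrightarrow> w $ i = 0"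
      and eq: "\<rho> x *\<^sub>v (P *\<^sub>v unit_vec n j) = P *\<^sub>v w" unfolding WP by auto
    have "\<tau> x *\<^sub>v unit_vec n j = Q *\<^sub>v (\<rho> x *\<^sub>v (P *\<^sub>v unit_vec n j))"
      using PQ matrix_repD(1)[OF \<rho> x] i j by (simp add: \<tau>_def assoc_mult_mat_vec[of _ n n _ n])
    also have "\<dots> = w" using eq inverse w by simp
    finally have "(\<tau> x *\<^sub>v unit_vec n j) $ i = 0" using w i by simp
    thus ?thesis using T(1)[OF x] i j by simp
  qed
  have block: "\<tau> x = four_block_mat (A x) (B x) (0\<^sub>m m d) (D x)" if x: "x \<in> carrier G" for x
    using T(1)[OF x] zero[OF x] m by (intro eq_matI) (auto simp: A_def B_def D_def)
  have prod: "\<tau> (x \<otimes> y) = four_block_mat (A x * A y) (A x * B y + B x * D y) (0\<^sub>m m d) (D x * D y)"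
    if x: "x \<in> carrier G" and y: "y \<in> carrier G" for x y
    unfolding T(3)[OF x y] block[OF x] block[OF y]
    by (subst mult_four_block_mat[OF carr(1,2) _ carr(3) carr(1,2) _ carr(3)])
      (use carr[of x] carr[of y] in auto)
  have "matrix_rep G d A"
    unfolding matrix_rep_def
  proof (intro conjI ballI)
    show "A \<one> = 1\<^sub>m d" using T(2) m by (intro eq_matI) (auto simp: A_def)
    fix x y assume x: "x \<in> carrier G" and y: "y \<in> carrier G"
    show "A (x \<otimes> y) = A x * A y"
      unfolding A_def[of "x \<otimes> y"] prod[OF x y] using carr(1)[of x] carr(1)[of y] 
      by (intro eq_matI) auto
  qed (use carr in auto)
  moreover have "matrix_rep G m D"
    unfolding matrix_rep_def
  proof (intro conjI ballI)
    show "D \<one> = 1\<^sub>m m" using T(2) m by (intro eq_matI) (auto simp: D_def)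
    fix x y assume x: "x \<in> carrier G" and y: "y \<in> carrier G"
    show "D (x \<otimes> y) = D x * D y"
      unfolding D_def[of "x \<otimes> y"] prod[OF x y] using carr(1,3)[of x] carr(1,3)[of y] 
      by (intro eq_matI) auto
  qed (use carr in auto)
  moreover have "char_poly (\<rho> x) = char_poly (A x) * char_poly (D x)" if x: "x \<in> carrier G" for x
  proof -
    have "char_poly (\<rho> x) = char_poly (\<tau> x)"
      unfolding \<tau>_def by (rule char_poly_similar_by[OF matrix_repD(1)[OF \<rho> x] PQ, symmetric])
    thus ?thesis unfolding block[OF x] char_poly_block_upper_triangular[OF carr] .
  qed
  moreover have "mat_trace (\<rho> x) = mat_trace (A x) + mat_trace (D x)" if x: "x \<in> carrier G" for x
  proof -
    have "mat_trace (\<rho> x) = mat_trace (\<tau> x)"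
      unfolding \<tau>_def
      by (rule mat_trace_similar[OF matrix_repD(1)[OF \<rho> x] PQ(1,2,3), symmetric])
    also have "\<dots> = mat_trace (A x) + mat_trace (D x)"
      unfolding block[OF x] sum_list_diag_mat[symmetric]
      by (subst diag_four_block_mat[OF carr(1,3)]) simp
    finally show ?thesis .
  qed
  ultimately show ?thesis using that[of d A D] \<open>d \<noteq> 0\<close> \<open>d \<noteq> n\<close> dn m by auto
qed

text \<open>Brauer characters see a composition series only through the characteristic polynomials and traces
of its factors, so only these are recorded, along with what a length of zero or one says about \<open>\<rho>\<close>.\<close>

definition is_composition_series ::
    "nat \<Rightarrow> ('a \<Rightarrow> 'f::field mat) \<Rightarrow> (nat \<times> ('a \<Rightarrow> 'f mat)) list \<Rightarrow> bool" where
  "is_composition_series n \<rho> L \<longleftrightarrow>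
     (\<forall>(d, \<tau>)\<in>set L. irreducible_representation G d \<tau>) \<and>
     (\<forall>x\<in>carrier G. char_poly (\<rho> x) = (\<Prod>(d, \<tau>)\<leftarrow>L. char_poly (\<tau> x))) \<and>
     (\<forall>x\<in>carrier G. mat_trace (\<rho> x) = (\<Sum>(d, \<tau>)\<leftarrow>L. mat_trace (\<tau> x))) \<and>
     (n > 0 \<longrightarrow> L \<noteq> []) \<and> (length L = 1 \<longrightarrow> irreducible_representation G n \<rho>)"

lemma composition_series_exists:
  fixes \<rho> :: "'a \<Rightarrow> 'f::field mat"
  assumes "matrix_rep G n \<rho>"
  obtains L where "is_composition_series n \<rho> L"
proof -
  have "\<exists>L. is_composition_series n \<rho> L" using assms
  proof (induction n arbitrary: \<rho> rule: less_induct)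
    case (less n)
    show ?case
    proof (cases "n = 0 \<or> irreducible_representation G n \<rho>")
      case True
      thus ?thesis
      proof
        assume n: "n = 0"
        have "char_poly (\<rho> x) = 1" "mat_trace (\<rho> x) = 0" if "x \<in> carrier G" for x
          using matrix_repD(1)[OF less.prems that] n
          by (auto simp: char_poly_def char_poly_matrix_def mat_trace_def)
        thus ?thesis using n by (intro exI[of _ "[]"]) (auto simp: is_composition_series_def)
      next
        assume "irreducible_representation G n \<rho>"
        thus ?thesis by (intro exI[of _ "[(n, \<rho>)]"]) (auto simp: is_composition_series_def)
      qed
    next
      case False
      then obtain W where W: "VectorSpace.subspace class_ring W (module_vec TYPE('f) n)"
        "\<And>x w. x \<in> carrier G \<Longrightarrow> w \<in> W \<Longrightarrow> \<rho> x *\<^sub>v w \<in> W"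
        "W \<noteq> {0\<^sub>v n}" "W \<noteq> carrier_vec n"
        using less.prems unfolding irreducible_representation_def matrix_representation_iff by auto
      obtain d A D where d: "0 < d" "d < n" and reps: "matrix_rep G d A" "matrix_rep G (n - d) D"
        and prod: "\<forall>x\<in>carrier G. char_poly (\<rho> x) = char_poly (A x) * char_poly (D x)"
        and sum: "\<forall>x\<in>carrier G. mat_trace (\<rho> x) = mat_trace (A x) + mat_trace (D x)"
        by (rule invariant_subspace_block_form[OF less.prems W])
      obtain L1 L2 where L: "is_composition_series d A L1" "is_composition_series (n - d) D L2"
        using less.IH[OF _ reps(1)] less.IH[OF _ reps(2)] d by auto
      hence "L1 \<noteq> []" "L2 \<noteq> []" using d by (auto simp: is_composition_series_def)
      hence "length (L1 @ L2) \<noteq> 1" by (cases L1; cases L2) auto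
      hence "is_composition_series n \<rho> (L1 @ L2)"
        using L \<open>L1 \<noteq> []\<close> prod sum by (auto simp: is_composition_series_def)
      thus ?thesis ..
    qed
  qed
  thus ?thesis using that by blast
qed

end

section \<open>Eigenvalues of group elements and Schur's lemma\<close>

lemma mat_eq_if_mult_vec_eq:
  fixes A B :: "'a::comm_semiring_1 mat"
  assumes "A \<in> carrier_mat m n" "B \<in> carrier_mat m n"
    and "\<And>v. v \<in> carrier_vec n \<Longrightarrow> A *\<^sub>v v = B *\<^sub>v v"
  shows "A = B"
proof (rule eq_matI)
  fix i j assume "i < dim_row B" "j < dim_col B"
  thus "A $$ (i, j) = B $$ (i, j)"
    using arg_cong[OF assms(3)[of "unit_vec n j"], of "\<lambda>v. v $ i"] assms(1,2) by simp
qed (use assms in auto)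

text \<open>If \<open>m > n\<close>, padding with zeros gives square matrices with the same product, one of which has a zero
column.\<close>

lemma right_inverse_dim_le:
  fixes A B :: "'a::field mat"
  assumes A: "A \<in> carrier_mat m n" and B: "B \<in> carrier_mat n m" and AB: "A * B = 1\<^sub>m m"
  shows "m \<le> n"
proof (rule ccontr)
  assume "\<not> m \<le> n"
  hence nm: "n < m" by simp
  define A' where "A' = mat m m (\<lambda>(i, j). if j < n then A $$ (i, j) else 0)"
  define B' where "B' = mat m m (\<lambda>(i, j). if i < n then B $$ (i, j) else 0)"
  have carr: "A' \<in> carrier_mat m m" "B' \<in> carrier_mat m m" by (auto simp: A'_def B'_def)
  have "A' * B' = A * B"
  proof (rule eq_matI)
    fix i j assume "i < dim_row (A * B)" "j < dim_col (A * B)"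
    hence ij: "i < m" "j < m" using A B by auto
    have "(A' * B') $$ (i, j) = (\<Sum>k<m. A' $$ (i, k) * B' $$ (k, j))"
      using carr ij by (simp add: scalar_prod_def atLeast0LessThan)
    also have "\<dots> = (\<Sum>k<n. A $$ (i, k) * B $$ (k, j))"
      using nm ij by (intro sum.mono_neutral_cong_right) (auto simp: A'_def B'_def)
    finally show "(A' * B') $$ (i, j) = (A * B) $$ (i, j)"
      using A B ij by (simp add: scalar_prod_def atLeast0LessThan)
  qed (use carr A B in auto)
  moreover have "det A' = 0"
    unfolding det_0_iff_vec_prod_zero_field[OF carr(1)]
  proof (intro exI[of _ "unit_vec m n"] conjI)
    show "A' *\<^sub>v unit_vec m n = 0\<^sub>v m"
      using nm carr by (intro eq_vecI) (auto simp: A'_def)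
  qed (use nm in auto)
  ultimately show False using det_mult[OF carr] AB by simp
qed

context group
begin

text \<open>Restrict \<open>\<rho>\<close> to the cyclic group generated by \<open>x\<close>. On an irreducible factor the matrix of \<open>x\<close> commutes
with the whole group, so by the splitting hypothesis it is a scalar; the list \<open>as\<close> collects these
scalars with multiplicity. No extension field is needed.\<close>

lemma char_poly_splits:
  fixes \<rho> :: "'a \<Rightarrow> 'f::field mat"
  assumes x: "x \<in> carrier G"
    and split: "splitting_field TYPE('f) (G\<lparr>carrier := generate G {x}\<rparr>)"
    and \<rho>: "matrix_rep G n \<rho>"
  obtains as where "char_poly (\<rho> x) = (\<Prod>a\<leftarrow>as. [:- a, 1:])"
    "\<forall>k::nat. mat_trace (\<rho> (x [^] k)) = (\<Sum>a\<leftarrow>as. a ^ k)"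
    "\<forall>a\<in>set as. \<forall>k::nat. x [^] k = \<one> \<longrightarrow> a ^ k = 1"
proof -
  define H where "H = G\<lparr>carrier := generate G {x}\<rparr>"
  have sub: "subgroup (generate G {x}) G" using x by (intro generate_is_subgroup) auto
  interpret H: group H unfolding H_def using subgroup.subgroup_is_group[OF sub is_group] .
  have xH: "x \<in> carrier H" by (auto simp: H_def intro: generate.incl)
  have commute: "x \<otimes> h = h \<otimes> x" if h: "h \<in> carrier H" for h
  proof -
    obtain k :: int where "h = x [^] k" using h generate_pow[OF x] by (auto simp: H_def)
    thus ?thesis using x int_pow_mult[of x 1 k] int_pow_mult[of x k 1]
      by (simp add: int_pow_1 add.commute)
  qed
  have "matrix_rep H n \<rho>"
    using matrix_repD[OF \<rho>] subgroup.mem_carrier[OF sub]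
    by (auto simp: matrix_rep_def H_def)
  then obtain L where L: "H.is_composition_series n \<rho> L"
    using H.composition_series_exists by blast
  have powH: "x [^] (k::nat) \<in> carrier H" for k
    by (induction k) (use H.m_closed[OF _ xH] H.one_closed in \<open>auto simp: H_def\<close>)
  define eigen where "eigen P t as \<longleftrightarrow> P = (\<Prod>a\<leftarrow>as. [:- a, 1:]) \<and>
      (\<forall>k. t k = (\<Sum>a\<leftarrow>as. a ^ k)) \<and> (\<forall>a\<in>set as. \<forall>k::nat. x [^] k = \<one> \<longrightarrow> a ^ k = 1)"
    for P :: "'f poly" and t :: "nat \<Rightarrow> 'f" and as
  have scalar: "\<exists>as. eigen (char_poly (\<tau> x)) (\<lambda>k. mat_trace (\<tau> (x [^] k))) as"
    if \<tau>: "irreducible_representation H d \<tau>" for d and \<tau> :: "'a \<Rightarrow> 'f mat"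
  proof -
    note D = matrix_repD[OF H.irreducibleD(1)[OF \<tau>]]
    have d: "d > 0" using H.irreducibleD(2)[OF \<tau>] .
    have "\<tau> x * \<tau> h = \<tau> h * \<tau> x" if "h \<in> carrier H" for h
      using D(3)[OF xH that] D(3)[OF that xH] commute[OF that] by (simp add: H_def)
    then obtain c where c: "\<tau> x = c \<cdot>\<^sub>m 1\<^sub>m d"
      using split \<tau> D(1)[OF xH] unfolding splitting_field_def H_def[symmetric] by blast
    have pow: "\<tau> (x [^] k) = c ^ k \<cdot>\<^sub>m 1\<^sub>m d" for k :: nat
    proof (induction k)
      case 0
      show ?case using D(2) by (intro eq_matI) (auto simp: H_def)
    next
      case (Suc k)
      have "\<tau> (x [^] Suc k) = \<tau> (x [^] k) * \<tau> x" using D(3)[OF powH xH] by (simp add: H_def)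
      also have "\<dots> = c ^ Suc k \<cdot>\<^sub>m 1\<^sub>m d" unfolding Suc c by (intro eq_matI) auto
      finally show ?case .
    qed
    have "c ^ k = 1" if "x [^] k = \<one>" for k :: nat
    proof -
      have "c ^ k \<cdot>\<^sub>m 1\<^sub>m d = 1\<^sub>m d" using pow[of k] that D(2) by (simp add: H_def)
      from arg_cong[OF this, of "\<lambda>A. A $$ (0, 0)"] show ?thesis using d by simp
    qed
    moreover have "diag_mat (c \<cdot>\<^sub>m 1\<^sub>m d) = replicate d c"
      by (rule nth_equalityI) (auto simp: diag_mat_def)
    moreover have "char_poly (c \<cdot>\<^sub>m 1\<^sub>m d) = (\<Prod>a\<leftarrow>diag_mat (c \<cdot>\<^sub>m 1\<^sub>m d). [:- a, 1:])"
      by (rule char_poly_upper_triangular[of _ d]) auto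
    moreover have "mat_trace (c ^ k \<cdot>\<^sub>m 1\<^sub>m d) = of_nat d * c ^ k" for k
      by (simp add: mat_trace_def)
    ultimately have "eigen (char_poly (\<tau> x)) (\<lambda>k. mat_trace (\<tau> (x [^] k))) (replicate d c)"
      unfolding eigen_def pow c by (auto simp: sum_list_replicate)
    thus ?thesis ..
  qed
  have "\<exists>as. eigen (\<Prod>(d, \<tau>)\<leftarrow>L. char_poly (\<tau> x)) (\<lambda>k. \<Sum>(d, \<tau>)\<leftarrow>L. mat_trace (\<tau> (x [^] k))) as"
    if "\<forall>(d, \<tau>)\<in>set L. irreducible_representation H d \<tau>" for L :: "(nat \<times> ('a \<Rightarrow> 'f mat)) list"
    using that
  proof (induction L)
    case (Cons l L)
    obtain d \<tau> where l: "l = (d, \<tau>)" by (cases l)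
    from Cons obtain bs where
      "eigen (\<Prod>(d, \<tau>)\<leftarrow>L. char_poly (\<tau> x)) (\<lambda>k. \<Sum>(d, \<tau>)\<leftarrow>L. mat_trace (\<tau> (x [^] k))) bs"
      by auto
    moreover obtain as where "eigen (char_poly (\<tau> x)) (\<lambda>k. mat_trace (\<tau> (x [^] k))) as"
      using scalar[of d \<tau>] Cons.prems l by auto
    ultimately show ?case unfolding l by (intro exI[of _ "as @ bs"]) (auto simp: eigen_def)
  qed (auto simp: eigen_def intro: exI[of _ "[]"])
  then obtain as where
    "eigen (\<Prod>(d, \<tau>)\<leftarrow>L. char_poly (\<tau> x)) (\<lambda>k. \<Sum>(d, \<tau>)\<leftarrow>L. mat_trace (\<tau> (x [^] k))) as"
    using L unfolding H.is_composition_series_def by blast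
  moreover have "char_poly (\<rho> x) = (\<Prod>(d, \<tau>)\<leftarrow>L. char_poly (\<tau> x))"
    "mat_trace (\<rho> (x [^] k)) = (\<Sum>(d, \<tau>)\<leftarrow>L. mat_trace (\<tau> (x [^] k)))" for k :: nat
    using L xH powH unfolding H.is_composition_series_def by blast+
  ultimately show ?thesis using that[of as] by (simp add: eigen_def)
qed

text \<open>The kernel and the image of an intertwiner are invariant subspaces.\<close>

lemma schur:
  fixes \<rho> \<sigma> :: "'a \<Rightarrow> 'f::field mat"
  assumes \<rho>: "irreducible_representation G n \<rho>" and \<sigma>: "irreducible_representation G m \<sigma>"
    and T: "T \<in> carrier_mat m n" "\<And>x. x \<in> carrier G \<Longrightarrow> T * \<rho> x = \<sigma> x * T"
    and "T \<noteq> 0\<^sub>m m n"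
  obtains S where "n = m" "S \<in> carrier_mat n n" "T * S = 1\<^sub>m n" "S * T = 1\<^sub>m n"
proof -
  note R = matrix_repD[OF irreducibleD(1)[OF \<rho>]] and S = matrix_repD[OF irreducibleD(1)[OF \<sigma>]]
  have Tvec: "T *\<^sub>v (\<rho> x *\<^sub>v v) = \<sigma> x *\<^sub>v (T *\<^sub>v v)" if "x \<in> carrier G" "v \<in> carrier_vec n" for x v
    using T(2)[OF that(1)] assoc_mult_mat_vec[OF T(1) R(1)[OF that(1)] that(2)]
      assoc_mult_mat_vec[OF S(1)[OF that(1)] T(1) that(2)] by simp
  have "{v \<in> carrier_vec n. T *\<^sub>v v = 0\<^sub>v m} = {0\<^sub>v n} \<or>
    {v \<in> carrier_vec n. T *\<^sub>v v = 0\<^sub>v m} = carrier_vec n"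
  proof (rule irreducibleD(3)[OF \<rho>])
    show "VectorSpace.subspace class_ring {v \<in> carrier_vec n. T *\<^sub>v v = 0\<^sub>v m} (module_vec TYPE('f) n)"
      using T(1) by (intro subspace_module_vecI)
        (auto simp: mult_add_distrib_mat_vec mult_mat_vec)
    fix x v assume x: "x \<in> carrier G" and v: "v \<in> {v \<in> carrier_vec n. T *\<^sub>v v = 0\<^sub>v m}"
    have "\<sigma> x *\<^sub>v 0\<^sub>v m = 0\<^sub>v m" using S(1)[OF x] by auto
    thus "\<rho> x *\<^sub>v v \<in> {v \<in> carrier_vec n. T *\<^sub>v v = 0\<^sub>v m}"
      using Tvec[OF x, of v] R(1)[OF x] v by auto
  qed
  moreover have "{v \<in> carrier_vec n. T *\<^sub>v v = 0\<^sub>v m} \<noteq> carrier_vec n"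
  proof
    assume *: "{v \<in> carrier_vec n. T *\<^sub>v v = 0\<^sub>v m} = carrier_vec n"
    have "T = 0\<^sub>m m n"
    proof (rule mat_eq_if_mult_vec_eq)
      fix v :: "'f vec" assume "v \<in> carrier_vec n"
      moreover from this have "T *\<^sub>v v = 0\<^sub>v m" using * by blast
      ultimately show "T *\<^sub>v v = 0\<^sub>m m n *\<^sub>v v" by (intro eq_vecI) auto
    qed (use T in auto)
    thus False using assms by simp
  qed
  ultimately have inj: "{v \<in> carrier_vec n. T *\<^sub>v v = 0\<^sub>v m} = {0\<^sub>v n}" by blast
  have "(*\<^sub>v) T ` carrier_vec n = {0\<^sub>v m} \<or> (*\<^sub>v) T ` carrier_vec n = carrier_vec m"
  proof (rule irreducibleD(3)[OF \<sigma>])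
    have [simp]: "T *\<^sub>v 0\<^sub>v n = 0\<^sub>v m" using T(1) by auto
    show "VectorSpace.subspace class_ring ((*\<^sub>v) T ` carrier_vec n) (module_vec TYPE('f) m)"
    proof (rule subspace_module_vecI)
      show "0\<^sub>v m \<in> (*\<^sub>v) T ` carrier_vec n" by (rule image_eqI[of _ _ "0\<^sub>v n"]) auto
      fix v w c assume "v \<in> (*\<^sub>v) T ` carrier_vec n"
      then obtain v' where v': "v' \<in> carrier_vec n" "v = T *\<^sub>v v'" by auto
      show "c \<cdot>\<^sub>v v \<in> (*\<^sub>v) T ` carrier_vec n"
        by (rule image_eqI[of _ _ "c \<cdot>\<^sub>v v'"]) (use v' T(1) in \<open>auto simp: mult_mat_vec\<close>)
      assume "w \<in> (*\<^sub>v) T ` carrier_vec n"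
      then obtain w' where w': "w' \<in> carrier_vec n" "w = T *\<^sub>v w'" by auto
      show "v + w \<in> (*\<^sub>v) T ` carrier_vec n"
        by (rule image_eqI[of _ _ "v' + w'"]) (use v' w' T(1) in \<open>auto simp: mult_add_distrib_mat_vec\<close>)
    qed (use T in auto)
    fix x w assume x: "x \<in> carrier G" and "w \<in> (*\<^sub>v) T ` carrier_vec n"
    then obtain v where "v \<in> carrier_vec n" "w = T *\<^sub>v v" by auto
    thus "\<sigma> x *\<^sub>v w \<in> (*\<^sub>v) T ` carrier_vec n"
      using Tvec[OF x] R(1)[OF x] by (intro image_eqI[of _ _ "\<rho> x *\<^sub>v v"]) auto
  qed
  moreover have "(*\<^sub>v) T ` carrier_vec n \<noteq> {0\<^sub>v m}"
  proof
    assume *: "(*\<^sub>v) T ` carrier_vec n = {0\<^sub>v m}"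
    have "T = 0\<^sub>m m n"
    proof (rule mat_eq_if_mult_vec_eq)
      fix v :: "'f vec" assume "v \<in> carrier_vec n"
      moreover from this have "T *\<^sub>v v = 0\<^sub>v m" using * by blast
      ultimately show "T *\<^sub>v v = 0\<^sub>m m n *\<^sub>v v" by (intro eq_vecI) auto
    qed (use T in auto)
    thus False using assms by simp
  qed
  ultimately have "(*\<^sub>v) T ` carrier_vec n = carrier_vec m" by blast
  hence "\<exists>v. v \<in> carrier_vec n \<and> T *\<^sub>v v = w" if "w \<in> carrier_vec m" for w
    using that by (metis (no_types, lifting) imageE)
  then obtain g where g: "\<And>w. w \<in> carrier_vec m \<Longrightarrow> g w \<in> carrier_vec n \<and> T *\<^sub>v g w = w"
    by metis
  define U where "U = mat n m (\<lambda>(i, j). g (unit_vec m j) $ i)"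
  have U: "U \<in> carrier_mat n m" by (simp add: U_def)
  have col_U: "col U j = g (unit_vec m j)" if "j < m" for j
    using that g[of "unit_vec m j"] by (intro eq_vecI) (auto simp: U_def)
  have TU: "T * U = 1\<^sub>m m"
  proof (rule mat_col_eqI)
    fix j assume "j < dim_col (1\<^sub>m m :: 'f mat)"
    hence j: "j < m" by simp
    have "col (T * U) j = T *\<^sub>v g (unit_vec m j)"
      using col_mult2[OF T(1) U j] col_U[OF j] by simp
    also have "\<dots> = col (1\<^sub>m m) j" using g[of "unit_vec m j"] j by simp
    finally show "col (T * U) j = col (1\<^sub>m m) j" .
  qed (use T U in auto)
  have UT: "U * T = 1\<^sub>m n"
  proof (rule mat_eq_if_mult_vec_eq)
    fix v :: "'f vec" assume v: "v \<in> carrier_vec n"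
    have "T *\<^sub>v (U *\<^sub>v (T *\<^sub>v v)) = (T * U) *\<^sub>v (T *\<^sub>v v)" using T U v by (simp add: assoc_mult_mat_vec[of _ m n _ m])
    also have "\<dots> = T *\<^sub>v v" using TU T v by simp
    finally have "T *\<^sub>v (U *\<^sub>v (T *\<^sub>v v) - v) = 0\<^sub>v m"
      using T U v by (subst mult_minus_distrib_mat_vec[of _ m n]) auto
    hence "U *\<^sub>v (T *\<^sub>v v) - v = 0\<^sub>v n" using inj T U v by auto
    hence *: "(U *\<^sub>v (T *\<^sub>v v) - v) $ i = 0" if "i < n" for i using that by simp
    have "U *\<^sub>v (T *\<^sub>v v) = v"
    proof (rule eq_vecI)
      fix i assume "i < dim_vec v"
      thus "(U *\<^sub>v (T *\<^sub>v v)) $ i = v $ i" using *[of i] T U v by auto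
    qed (use U v in auto)
    thus "U * T *\<^sub>v v = 1\<^sub>m n *\<^sub>v v" using T U v by simp
  qed (use T U in auto)
  have "n = m" using right_inverse_dim_le[OF T(1) U TU] right_inverse_dim_le[OF U T(1) UT] by simp
  thus ?thesis using that[of U] U TU UT by simp
qed

end

section \<open>Linear independence of matrix coefficients\<close>

text \<open>The linear extension of \<open>\<rho>\<close> to the group algebra.\<close>

definition lin_ext :: "('g, 'm) monoid_scheme \<Rightarrow> nat \<Rightarrow> ('g \<Rightarrow> 'a::comm_ring_1 mat) \<Rightarrow> ('g \<Rightarrow> 'a) \<Rightarrow> 'a mat" where
  "lin_ext G n \<rho> a = mat n n (\<lambda>(i, j). \<Sum>x\<in>carrier G. a x * \<rho> x $$ (i, j))"

lemma lin_ext_carrier [simp]: "lin_ext G n \<rho> a \<in> carrier_mat n n"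
  "dim_row (lin_ext G n \<rho> a) = n" "dim_col (lin_ext G n \<rho> a) = n"
  by (simp_all add: lin_ext_def)

lemma lin_ext_mult_vec_index:
  assumes "matrix_rep G n \<rho>" "v \<in> carrier_vec n" "i < n"
  shows "(lin_ext G n \<rho> a *\<^sub>v v) $ i = (\<Sum>x\<in>carrier G. a x * (\<rho> x *\<^sub>v v) $ i)"
proof -
  have "(\<rho> x *\<^sub>v v) $ i = (\<Sum>k<n. \<rho> x $$ (i, k) * v $ k)" if "x \<in> carrier G" for x
    using matrix_repD(1)[OF assms(1) that] assms by (simp add: scalar_prod_def atLeast0LessThan)
  moreover have "(lin_ext G n \<rho> a *\<^sub>v v) $ i =
      (\<Sum>k<n. (\<Sum>x\<in>carrier G. a x * \<rho> x $$ (i, k)) * v $ k)"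
    using assms by (simp add: lin_ext_def scalar_prod_def atLeast0LessThan)
  ultimately show ?thesis
    by (simp add: sum_distrib_left sum_distrib_right mult.assoc sum.swap[of _ "{..<n}"])
qed

lemma mat_trace_mult_lin_ext:
  assumes "matrix_rep G n \<rho>" "X \<in> carrier_mat n n"
  shows "mat_trace (X * lin_ext G n \<rho> a) = (\<Sum>x\<in>carrier G. a x * mat_trace (X * \<rho> x))"
proof -
  have "mat_trace (X * \<rho> x) = (\<Sum>i<n. \<Sum>k<n. X $$ (i, k) * \<rho> x $$ (k, i))" if "x \<in> carrier G" for x
    using matrix_repD(1)[OF assms(1) that] assms by (simp add: mat_trace_mult[of _ n n])
  hence "(\<Sum>x\<in>carrier G. a x * mat_trace (X * \<rho> x)) =
    (\<Sum>x\<in>carrier G. \<Sum>i<n. \<Sum>k<n. X $$ (i, k) * (a x * \<rho> x $$ (k, i)))"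
    by (simp add: sum_distrib_left mult.left_commute)
  also have "\<dots> = (\<Sum>i<n. \<Sum>k<n. \<Sum>x\<in>carrier G. X $$ (i, k) * (a x * \<rho> x $$ (k, i)))"
    by (subst sum.swap, intro sum.cong refl, subst sum.swap, rule refl)
  also have "\<dots> = mat_trace (X * lin_ext G n \<rho> a)"
    using assms by (subst mat_trace_mult[of _ n n]) (auto simp: lin_ext_def sum_distrib_left intro!: sum.cong)
  finally show ?thesis ..
qed

lemma lin_ext_linear:
  "lin_ext G n \<rho> (\<lambda>_. 0) = 0\<^sub>m n n"
  "lin_ext G n \<rho> (\<lambda>x. a x + b x) = lin_ext G n \<rho> a + lin_ext G n \<rho> b"
  "lin_ext G n \<rho> (\<lambda>x. c * a x) = c \<cdot>\<^sub>m lin_ext G n \<rho> a"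
  by (intro eq_matI;
      auto simp: lin_ext_def distrib_right sum.distrib sum_distrib_left mult.assoc)+

lemma square_index:
  fixes n :: nat
  shows "k < n * n \<Longrightarrow> k div n < n" "k < n * n \<Longrightarrow> k mod n < n"
    "i < n \<Longrightarrow> j < n \<Longrightarrow> i * n + j < n * n"
proof -
  show "k < n * n \<Longrightarrow> k div n < n" "k < n * n \<Longrightarrow> k mod n < n"
    by (auto simp: less_mult_imp_div_less intro!: mod_less_divisor gr0I)
  assume ij: "i < n" "j < n"
  have "i * n + j < Suc i * n" using ij by simp
  also have "\<dots> \<le> n * n" using ij by (intro mult_right_mono) auto
  finally show "i * n + j < n * n" .
qed

lemma sum_square_index:
  fixes g :: "nat \<Rightarrow> nat \<Rightarrow> 'a::comm_monoid_add"
  shows "(\<Sum>k<n * n. g (k div n) (k mod n)) = (\<Sum>i<n. \<Sum>j<n. g i j)"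
proof -
  have "(\<Sum>i<n. \<Sum>j<n. g i j) = (\<Sum>(i, j)\<in>{..<n} \<times> {..<n}. g i j)"
    by (rule sum.cartesian_product)
  also have "\<dots> = (\<Sum>k<n * n. g (k div n) (k mod n))"
    by (rule sum.reindex_bij_witness[of _ "\<lambda>k. (k div n, k mod n)" "\<lambda>(i, j). i * n + j"])
      (auto simp: square_index)
  finally show ?thesis ..
qed

context group
begin

lemma lin_ext_delta:
  assumes "finite (carrier G)" "matrix_rep G n \<rho>" "x \<in> carrier G"
  shows "lin_ext G n \<rho> (\<lambda>y. if y = x then 1 else 0) = \<rho> x"
proof (rule eq_matI)
  fix i j assume "i < dim_row (\<rho> x)" "j < dim_col (\<rho> x)"
  hence "lin_ext G n \<rho> (\<lambda>y. if y = x then 1 else 0) $$ (i, j) =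
      (\<Sum>y\<in>carrier G. if y = x then \<rho> y $$ (i, j) else 0)"
    using matrix_repD(1)[OF assms(2,3)] by (auto simp: lin_ext_def intro!: sum.cong)
  thus "lin_ext G n \<rho> (\<lambda>y. if y = x then 1 else 0) $$ (i, j) = \<rho> x $$ (i, j)"
    using assms by simp
qed (use matrix_repD(1)[OF assms(2,3)] in auto)

lemma rep_mult_lin_ext:
  assumes \<rho>: "matrix_rep G n \<rho>" and x: "x \<in> carrier G"
  shows "\<rho> x * lin_ext G n \<rho> a = lin_ext G n \<rho> (\<lambda>y. a (inv x \<otimes> y))"
proof (rule eq_matI)
  note D = matrix_repD[OF \<rho>]
  fix i j assume "i < dim_row (lin_ext G n \<rho> (\<lambda>y. a (inv x \<otimes> y)))"
    "j < dim_col (lin_ext G n \<rho> (\<lambda>y. a (inv x \<otimes> y)))"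
  hence ij: "i < n" "j < n" by auto
  have "(\<rho> x * lin_ext G n \<rho> a) $$ (i, j) =
      (\<Sum>k<n. \<rho> x $$ (i, k) * (\<Sum>y\<in>carrier G. a y * \<rho> y $$ (k, j)))"
    using D(1)[OF x] ij by (simp add: scalar_prod_def atLeast0LessThan lin_ext_def)
  also have "\<dots> = (\<Sum>y\<in>carrier G. a y * (\<Sum>k<n. \<rho> x $$ (i, k) * \<rho> y $$ (k, j)))"
    by (simp add: sum_distrib_left mult.left_commute sum.swap[of _ "{..<n}"])
  also have "\<dots> = (\<Sum>y\<in>carrier G. a y * \<rho> (x \<otimes> y) $$ (i, j))"
  proof (intro sum.cong refl)
    fix y assume y: "y \<in> carrier G"
    show "a y * (\<Sum>k<n. \<rho> x $$ (i, k) * \<rho> y $$ (k, j)) = a y * \<rho> (x \<otimes> y) $$ (i, j)"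
      using D(1)[OF x] D(1)[OF y] ij by (simp add: D(3)[OF x y] scalar_prod_def atLeast0LessThan)
  qed
  also have "\<dots> = (\<Sum>y\<in>carrier G. a (inv x \<otimes> y) * \<rho> y $$ (i, j))"
    using x by (intro sum.reindex_bij_witness[of _ "\<lambda>y. inv x \<otimes> y" "\<lambda>y. x \<otimes> y"])
      (auto simp: m_assoc[symmetric])
  finally show "(\<rho> x * lin_ext G n \<rho> a) $$ (i, j) = lin_ext G n \<rho> (\<lambda>y. a (inv x \<otimes> y)) $$ (i, j)"
    using ij by (simp add: lin_ext_def)
qed (use matrix_repD(1)[OF \<rho> x] in auto)

lemma lin_ext_mult_rep:
  assumes \<rho>: "matrix_rep G n \<rho>" and y: "y \<in> carrier G"
  shows "lin_ext G n \<rho> a * \<rho> y = lin_ext G n \<rho> (\<lambda>z. a (z \<otimes> inv y))"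
proof (rule eq_matI)
  note D = matrix_repD[OF \<rho>]
  fix i j assume "i < dim_row (lin_ext G n \<rho> (\<lambda>z. a (z \<otimes> inv y)))"
    "j < dim_col (lin_ext G n \<rho> (\<lambda>z. a (z \<otimes> inv y)))"
  hence ij: "i < n" "j < n" by auto
  have "(lin_ext G n \<rho> a * \<rho> y) $$ (i, j) =
      (\<Sum>k<n. (\<Sum>x\<in>carrier G. a x * \<rho> x $$ (i, k)) * \<rho> y $$ (k, j))"
    using D(1)[OF y] ij by (simp add: scalar_prod_def atLeast0LessThan lin_ext_def)
  also have "\<dots> = (\<Sum>x\<in>carrier G. a x * (\<Sum>k<n. \<rho> x $$ (i, k) * \<rho> y $$ (k, j)))"
    by (simp add: sum_distrib_left sum_distrib_right mult.assoc sum.swap[of _ "{..<n}"])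
  also have "\<dots> = (\<Sum>x\<in>carrier G. a x * \<rho> (x \<otimes> y) $$ (i, j))"
  proof (intro sum.cong refl)
    fix x assume x: "x \<in> carrier G"
    show "a x * (\<Sum>k<n. \<rho> x $$ (i, k) * \<rho> y $$ (k, j)) = a x * \<rho> (x \<otimes> y) $$ (i, j)"
      using D(1)[OF x] D(1)[OF y] ij by (simp add: D(3)[OF x y] scalar_prod_def atLeast0LessThan)
  qed
  also have "\<dots> = (\<Sum>x\<in>carrier G. a (x \<otimes> inv y) * \<rho> x $$ (i, j))"
    using y by (intro sum.reindex_bij_witness[of _ "\<lambda>x. x \<otimes> inv y" "\<lambda>x. x \<otimes> y"])
      (auto simp: m_assoc)
  finally show "(lin_ext G n \<rho> a * \<rho> y) $$ (i, j) = lin_ext G n \<rho> (\<lambda>z. a (z \<otimes> inv y)) $$ (i, j)"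
    using ij by (simp add: lin_ext_def)
qed (use matrix_repD(1)[OF \<rho> y] in auto)

text \<open>The vectors reached from \<open>v\<close> form an invariant subspace containing \<open>v\<close>.\<close>

lemma irreducible_cyclic:
  fixes \<rho> :: "'a \<Rightarrow> 'f::field mat"
  assumes fin: "finite (carrier G)" and \<rho>: "irreducible_representation G n \<rho>"
    and v: "v \<in> carrier_vec n" "v \<noteq> 0\<^sub>v n" and w: "w \<in> carrier_vec n"
  obtains a where "lin_ext G n \<rho> a *\<^sub>v v = w"
proof -
  note I = irreducibleD[OF \<rho>]
  define W where "W = range (\<lambda>a. lin_ext G n \<rho> a *\<^sub>v v)"
  note idx = lin_ext_mult_vec_index[OF I(1) v(1)]
  have "W = {0\<^sub>v n} \<or> W = carrier_vec n"
  proof (rule I(3))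
    show "VectorSpace.subspace class_ring W (module_vec TYPE('f) n)"
    proof (rule subspace_module_vecI)
      have "0\<^sub>m n n *\<^sub>v v = 0\<^sub>v n" using v by (intro eq_vecI) auto
      thus "0\<^sub>v n \<in> W" unfolding W_def using lin_ext_linear(1)[of G n \<rho>] by (metis rangeI)
      fix u u' c assume "u \<in> W"
      then obtain a where a: "u = lin_ext G n \<rho> a *\<^sub>v v" by (auto simp: W_def)
      have "c \<cdot>\<^sub>v u = (c \<cdot>\<^sub>m lin_ext G n \<rho> a) *\<^sub>v v"
        using v a by (intro eq_vecI) auto
      thus "c \<cdot>\<^sub>v u \<in> W" unfolding W_def lin_ext_linear(3)[symmetric] by simp
      assume "u' \<in> W"
      then obtain b where b: "u' = lin_ext G n \<rho> b *\<^sub>v v" by (auto simp: W_def)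
      have "u + u' = (lin_ext G n \<rho> a + lin_ext G n \<rho> b) *\<^sub>v v"
        using v a b by (simp add: add_mult_distrib_mat_vec[of _ n n])
      thus "u + u' \<in> W" unfolding W_def lin_ext_linear(2)[symmetric] by simp
    qed (use mult_mat_vec_carrier[OF lin_ext_carrier(1) v(1)] in \<open>auto simp: W_def\<close>)
    fix x u assume x: "x \<in> carrier G" and "u \<in> W"
    then obtain a where "u = lin_ext G n \<rho> a *\<^sub>v v" by (auto simp: W_def)
    hence "\<rho> x *\<^sub>v u = lin_ext G n \<rho> (\<lambda>y. a (inv x \<otimes> y)) *\<^sub>v v"
      using assoc_mult_mat_vec[OF matrix_repD(1)[OF I(1) x] lin_ext_carrier(1)[of G n \<rho> a] v(1)]
      by (simp add: rep_mult_lin_ext[OF I(1) x, of a, symmetric])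
    thus "\<rho> x *\<^sub>v u \<in> W" by (auto simp: W_def)
  qed
  moreover have "v \<in> W" unfolding W_def
    by (rule image_eqI[of _ _ "\<lambda>y. if y = \<one> then 1 else 0"])
      (use lin_ext_delta[OF fin I(1) one_closed] matrix_repD(2)[OF I(1)] v in auto)
  ultimately have "w \<in> W" using v w by auto
  thus ?thesis using that by (auto simp: W_def)
qed

text \<open>The shortest-relation argument. Split the matrices \<open>C i\<close> into columns: a relation becomes a family of
vectors, one in the module \<open>i\<close> for each pair \<open>(i, b)\<close> of a representation and a column index. Relations
form a module under the group algebra. Take a nonzero relation with minimal support. In the
submodule that it generates, an element that vanishes in one component of the support vanishes
altogether, so any two components of the support are matched by an intertwiner. Thus all
components belong to one representation \<open>i0\<close> and are scalar multiples of each other. As every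
vector is reached in component \<open>(i0, b0)\<close>, one may put the unit vector \<open>b0\<close> there; evaluating the relation
at the identity then yields \<open>1 = 0\<close>.\<close>

theorem frobenius_schur:
  fixes \<tau> :: "'i \<Rightarrow> 'a \<Rightarrow> 'f::field mat"
  assumes finG: "finite (carrier G)" and finI: "finite I"
    and irr: "\<And>i. i \<in> I \<Longrightarrow> irreducible_representation G (n i) (\<tau> i)"
    and scalar: "\<And>i T. i \<in> I \<Longrightarrow> T \<in> carrier_mat (n i) (n i) \<Longrightarrow>
      (\<And>x. x \<in> carrier G \<Longrightarrow> T * \<tau> i x = \<tau> i x * T) \<Longrightarrow> \<exists>c. T = c \<cdot>\<^sub>m 1\<^sub>m (n i)"
    and noniso: "\<And>i j T. i \<in> I \<Longrightarrow> j \<in> I \<Longrightarrow> i \<noteq> j \<Longrightarrow> T \<in> carrier_mat (n j) (n i) \<Longrightarrow>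
      (\<And>x. x \<in> carrier G \<Longrightarrow> T * \<tau> i x = \<tau> j x * T) \<Longrightarrow> T = 0\<^sub>m (n j) (n i)"
    and C: "\<And>i. i \<in> I \<Longrightarrow> C i \<in> carrier_mat (n i) (n i)"
    and rel: "\<And>x. x \<in> carrier G \<Longrightarrow> (\<Sum>i\<in>I. mat_trace (\<tau> i x * C i)) = 0"
    and i: "i \<in> I"
  shows "C i = 0\<^sub>m (n i) (n i)"
proof -
  note rep = irreducibleD(1)[OF irr]
  define J where "J = (SIGMA i:I. {..<n i})"
  define family where "family v \<longleftrightarrow> (\<forall>(i, b)\<in>J. v (i, b) \<in> carrier_vec (n i)) \<and>
    (\<forall>x\<in>carrier G. (\<Sum>(i, b)\<in>J. (\<tau> i x *\<^sub>v v (i, b)) $ b) = 0)" for v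
  define act where "act a v = (\<lambda>(i, b). lin_ext G (n i) (\<tau> i) a *\<^sub>v v (i, b))"
    for a and v :: "'i \<times> nat \<Rightarrow> 'f vec"
  define supp where "supp v = {(i, b)\<in>J. v (i, b) \<noteq> 0\<^sub>v (n i)}" for v :: "'i \<times> nat \<Rightarrow> 'f vec"
  have finJ: "finite J" using finI by (auto simp: J_def)
  have JI: "i \<in> I" "b < n i" if "(i, b) \<in> J" for i b using that by (auto simp: J_def)
  have act_carrier: "act a v (i, b) \<in> carrier_vec (n i)" if "v (i, b) \<in> carrier_vec (n i)" for a v i b
    using mult_mat_vec_carrier[OF lin_ext_carrier(1) that] by (simp add: act_def)
  have act_translate: "act (\<lambda>y. a (inv x \<otimes> y)) v (i, b) = \<tau> i x *\<^sub>v act a v (i, b)"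
    if "i \<in> I" "x \<in> carrier G" "v (i, b) \<in> carrier_vec (n i)" for a v i b x
    using assoc_mult_mat_vec[OF matrix_repD(1)[OF rep[OF that(1)] that(2)] lin_ext_carrier(1) that(3)]
    by (simp add: act_def rep_mult_lin_ext[OF rep[OF that(1)] that(2), of a, symmetric])
  have family_act: "family (act a v)" if v: "family v" for a v
    unfolding family_def
  proof (intro conjI ballI)
    show "case j of (i, b) \<Rightarrow> act a v (i, b) \<in> carrier_vec (n i)" if "j \<in> J" for j
      using v that act_carrier by (auto simp: family_def)
    fix x assume x: "x \<in> carrier G"
    have "(\<Sum>(i, b)\<in>J. (\<tau> i x *\<^sub>v act a v (i, b)) $ b) =
        (\<Sum>(i, b)\<in>J. \<Sum>y\<in>carrier G. a (inv x \<otimes> y) * (\<tau> i y *\<^sub>v v (i, b)) $ b)"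
    proof (intro sum.cong refl, clarify)
      fix i b assume j: "(i, b) \<in> J"
      have vj: "v (i, b) \<in> carrier_vec (n i)" using v j by (auto simp: family_def)
      show "(\<tau> i x *\<^sub>v act a v (i, b)) $ b =
          (\<Sum>y\<in>carrier G. a (inv x \<otimes> y) * (\<tau> i y *\<^sub>v v (i, b)) $ b)"
        using act_translate[of _ _ v _ a, OF JI(1)[OF j] x vj] 
          lin_ext_mult_vec_index[OF rep[OF JI(1)[OF j]] vj JI(2)[OF j], of "\<lambda>y. a (inv x \<otimes> y)"]
        by (simp add: act_def)
    qed
    also have "\<dots> = (\<Sum>y\<in>carrier G. a (inv x \<otimes> y) * (\<Sum>(i, b)\<in>J. (\<tau> i y *\<^sub>v v (i, b)) $ b))"
      by (simp add: sum_distrib_left sum.swap[of _ "carrier G"] case_prod_unfold)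
    also have "\<dots> = 0" using v by (simp add: family_def)
    finally show "(\<Sum>(i, b)\<in>J. (\<tau> i x *\<^sub>v act a v (i, b)) $ b) = 0" .
  qed
  have supp_act: "supp (act a v) \<subseteq> supp v" if "family v" for a v
  proof -
    have "lin_ext G (n i) (\<tau> i) a *\<^sub>v 0\<^sub>v (n i) = 0\<^sub>v (n i)" for i
      by (intro eq_vecI) auto
    thus ?thesis by (auto simp: supp_def act_def)
  qed
  have no_family: "supp v = {}" if "family v" for v
  proof (rule ccontr)
    assume "supp v \<noteq> {}"
    with that obtain v where v: "family v" "supp v \<noteq> {}"
      and min: "\<And>w. family w \<Longrightarrow> supp w \<noteq> {} \<Longrightarrow> card (supp v) \<le> card (supp w)"
      using ex_has_least_nat[of "\<lambda>v. family v \<and> supp v \<noteq> {}" v "\<lambda>v. card (supp v)"] by blast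
    have fin_supp: "finite (supp v)" by (rule finite_subset[OF _ finJ]) (auto simp: supp_def)
    have vcarr: "v (i, b) \<in> carrier_vec (n i)" if "(i, b) \<in> J" for i b
      using v(1) that by (auto simp: family_def)
    obtain i0 b0 where j0: "(i0, b0) \<in> supp v" using v(2) by auto
    have j0J: "(i0, b0) \<in> J" and v0: "v (i0, b0) \<noteq> 0\<^sub>v (n i0)" using j0 by (auto simp: supp_def)
    note i0 = JI(1)[OF j0J] and b0 = JI(2)[OF j0J]
    have kill: "act a v (i, b) = 0\<^sub>v (n i)"
      if "act a v (i0, b0) = 0\<^sub>v (n i0)" "(i, b) \<in> J" for a i b
    proof -
      have "(i0, b0) \<notin> supp (act a v)" using that by (auto simp: supp_def)
      hence "card (supp (act a v)) < card (supp v)"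
        using supp_act[OF v(1), of a] j0 by (intro psubset_card_mono fin_supp) auto
      hence "supp (act a v) = {}" using min[OF family_act[OF v(1), of a]] by fastforce
      thus ?thesis using that(2) by (auto simp: supp_def)
    qed
    have reach: "\<exists>a. act a v (i0, b0) = w" if "w \<in> carrier_vec (n i0)" for w
      using irreducible_cyclic[OF finG irr[OF i0] vcarr[OF j0J] v0 that] by (auto simp: act_def)
    then obtain aa where aa: "\<And>w. w \<in> carrier_vec (n i0) \<Longrightarrow> act (aa w) v (i0, b0) = w" by metis
    have act_idx: "act a v (i, b) $ r = (\<Sum>x\<in>carrier G. a x * (\<tau> i x *\<^sub>v v (i, b)) $ r)"
      if "(i, b) \<in> J" "r < n i" for a i b r
      unfolding act_def using lin_ext_mult_vec_index[OF rep vcarr] JI that by simp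
    define T where "T j = mat (n (fst j)) (n i0) (\<lambda>(r, b). act (aa (unit_vec (n i0) b)) v j $ r)" for j
    have Tcarr: "T (i, b) \<in> carrier_mat (n i) (n i0)" for i b by (simp add: T_def)
    have T_act: "T (i, b) *\<^sub>v act a v (i0, b0) = act a v (i, b)" if j: "(i, b) \<in> J" for a i b
    proof -
      (* T maps component (i0, b0) to component (i, b), although it is defined by its values on a basis only. *)
      define u where "u = act a v (i0, b0)"
      have u: "u \<in> carrier_vec (n i0)" unfolding u_def using act_carrier vcarr[OF j0J] by blast
      (* The coefficients a' are chosen to annihilate component (i0, b0); minimality of the
         support then makes them annihilate component (i, b) as well. *)
      define a' where "a' x = a x - (\<Sum>c<n i0. u $ c * aa (unit_vec (n i0) c) x)" for x
      have a': "act a' v (i, b) $ r =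
          act a v (i, b) $ r - (\<Sum>c<n i0. u $ c * act (aa (unit_vec (n i0) c)) v (i, b) $ r)"
        if j: "(i, b) \<in> J" and r: "r < n i" for i b r
        unfolding act_idx[OF j r] a'_def left_diff_distrib sum_subtractf sum_distrib_right
          sum_distrib_left mult.assoc by (subst sum.swap) simp
      have "act a' v (i0, b0) = 0\<^sub>v (n i0)"
      proof (rule eq_vecI)
        fix r assume "r < dim_vec (0\<^sub>v (n i0) :: 'f vec)"
        hence r: "r < n i0" by simp
        have "(\<Sum>c<n i0. u $ c * act (aa (unit_vec (n i0) c)) v (i0, b0) $ r) =
            (\<Sum>c<n i0. if c = r then u $ c else 0)"
          using r by (intro sum.cong refl) (auto simp: aa)
        thus "act a' v (i0, b0) $ r = 0\<^sub>v (n i0) $ r"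
          using a'[OF j0J r] r by (simp add: u_def)
      qed (use act_carrier[of v, OF vcarr[OF j0J]] in auto)
      hence zero: "act a' v (i, b) = 0\<^sub>v (n i)" using kill j by simp
      show ?thesis
      proof (rule eq_vecI)
        fix r assume "r < dim_vec (act a v (i, b))"
        hence r: "r < n i" using act_carrier[of v, OF vcarr[OF j], of a] by auto
        have "(T (i, b) *\<^sub>v u) $ r =
            (\<Sum>c<n i0. u $ c * act (aa (unit_vec (n i0) c)) v (i, b) $ r)"
          using r u by (simp add: T_def scalar_prod_def atLeast0LessThan mult.commute)
        thus "(T (i, b) *\<^sub>v act a v (i0, b0)) $ r = act a v (i, b) $ r"
          using a'[OF j r] r by (simp add: zero u_def)
      qed (use act_carrier[of v, OF vcarr[OF j], of a] Tcarr[of i b] in auto)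
    qed
    have intertwine: "T (i, b) * \<tau> i0 x = \<tau> i x * T (i, b)"
      if j: "(i, b) \<in> J" and x: "x \<in> carrier G" for i b x
    proof (rule mat_eq_if_mult_vec_eq)
      note t0 = matrix_repD(1)[OF rep[OF i0] x] and t = matrix_repD(1)[OF rep[OF JI(1)[OF j]] x]
      show "T (i, b) * \<tau> i0 x \<in> carrier_mat (n i) (n i0)"
        "\<tau> i x * T (i, b) \<in> carrier_mat (n i) (n i0)" using t0 t Tcarr[of i b] by auto
      fix w :: "'f vec" assume w: "w \<in> carrier_vec (n i0)"
      let ?a = "\<lambda>y. aa w (inv x \<otimes> y)"
      have "T (i, b) * \<tau> i0 x *\<^sub>v w = T (i, b) *\<^sub>v act ?a v (i0, b0)"
        using act_translate[of _ _ v _ "aa w", OF i0 x vcarr[OF j0J]] aa[OF w]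
          assoc_mult_mat_vec[OF Tcarr t0 w] by simp
      also have "\<dots> = \<tau> i x *\<^sub>v act (aa w) v (i, b)"
        using T_act[OF j] act_translate[of _ _ v _ "aa w", OF JI(1)[OF j] x vcarr[OF j]] by simp
      also have "\<dots> = \<tau> i x * T (i, b) *\<^sub>v w"
        using T_act[OF j, of "aa w"] aa[OF w] assoc_mult_mat_vec[OF t Tcarr w] by simp
      finally show "T (i, b) * \<tau> i0 x *\<^sub>v w = \<tau> i x * T (i, b) *\<^sub>v w" .
    qed
    have act_one: "act (\<lambda>y. if y = \<one> then 1 else 0) v (i, b) = v (i, b)" if "(i, b) \<in> J" for i b
      using lin_ext_delta[OF finG rep[OF JI(1)[OF that]] one_closed]
        matrix_repD(2)[OF rep[OF JI(1)[OF that]]] vcarr[OF that] by (simp add: act_def)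
    have same: "i = i0" if "(i, b) \<in> supp v" for i b
    proof (rule ccontr)
      assume ne: "i \<noteq> i0"
      have j: "(i, b) \<in> J" using that by (auto simp: supp_def)
      have "T (i, b) = 0\<^sub>m (n i) (n i0)"
        using noniso[OF i0 JI(1)[OF j]] ne Tcarr intertwine[OF j] by metis
      hence "v (i, b) = 0\<^sub>v (n i)"
        using T_act[OF j, of "\<lambda>y. if y = \<one> then 1 else 0"] act_one[OF j] act_one[OF j0J] vcarr[OF j0J]
        by (metis eq_vecI index_mult_mat_vec index_row(1) dim_mult_mat_vec index_zero_mat(2) index_zero_vec
            row_zero scalar_prod_left_zero)
      thus False using that by (auto simp: supp_def)
    qed
    obtain a where a: "act a v (i0, b0) = unit_vec (n i0) b0" using reach by fastforce
    have "(\<Sum>(i, b)\<in>J. (\<tau> i \<one> *\<^sub>v act a v (i, b)) $ b) = 0"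
      using family_act[OF v(1), of a] by (auto simp: family_def)
    also have "(\<Sum>(i, b)\<in>J. (\<tau> i \<one> *\<^sub>v act a v (i, b)) $ b) = (\<Sum>j\<in>J. if j = (i0, b0) then 1 else 0)"
    proof (rule sum.cong, rule refl, clarify)
      fix i b assume j: "(i, b) \<in> J"
      have one: "\<tau> i \<one> *\<^sub>v act a v (i, b) = act a v (i, b)"
        using matrix_repD(2)[OF rep[OF JI(1)[OF j]]] act_carrier[of v, OF vcarr[OF j]] by simp
      show "(\<tau> i \<one> *\<^sub>v act a v (i, b)) $ b = (if (i, b) = (i0, b0) then 1 else 0)"
      proof (cases "(i, b) \<in> supp v")
        case False
        hence "(i, b) \<notin> supp (act a v)" using supp_act[OF v(1)] by blast
        thus ?thesis using False j j0 JI[OF j] by (auto simp: one) (auto simp: supp_def)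
      next
        case True
        from same[OF this] have [simp]: "i = i0" .
        obtain c where c: "T (i, b) = c \<cdot>\<^sub>m 1\<^sub>m (n i0)"
          using scalar[OF i0] Tcarr[of i b] intertwine[OF j] by (auto simp del: T_def)
        have "act a v (i, b) = T (i, b) *\<^sub>v unit_vec (n i0) b0" using T_act[OF j, of a] a by simp
        also have "\<dots> = c \<cdot>\<^sub>v unit_vec (n i0) b0" unfolding c using b0 by (intro eq_vecI) auto
        finally have "act a v (i, b) = c \<cdot>\<^sub>v unit_vec (n i0) b0" .
        thus ?thesis unfolding one using a b0 JI[OF j] by (cases "b = b0") simp_all
      qed
    qed
    also have "\<dots> = 1" using finJ j0J by simp
    finally show False by simp
  qed
  define v where "v = (\<lambda>(i, b). col (C i) b)"
  have "family v"
    unfolding family_def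
  proof (intro conjI ballI)
    show "case j of (i, b) \<Rightarrow> v (i, b) \<in> carrier_vec (n i)" if "j \<in> J" for j
      using C that by (auto simp: v_def J_def)
    fix x assume x: "x \<in> carrier G"
    have "(\<Sum>(i, b)\<in>J. (\<tau> i x *\<^sub>v v (i, b)) $ b) = (\<Sum>i\<in>I. \<Sum>b<n i. (\<tau> i x *\<^sub>v v (i, b)) $ b)"
      unfolding J_def using finI by (subst sum.Sigma) auto
    also have "\<dots> = (\<Sum>i\<in>I. mat_trace (\<tau> i x * C i))"
    proof (rule sum.cong, rule refl)
      fix i assume i: "i \<in> I"
      show "(\<Sum>b<n i. (\<tau> i x *\<^sub>v v (i, b)) $ b) = mat_trace (\<tau> i x * C i)"
        using C[OF i] matrix_repD(1)[OF rep[OF i] x]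
        unfolding mat_trace_def v_def by (intro sum.cong) auto
    qed
    finally show "(\<Sum>(i, b)\<in>J. (\<tau> i x *\<^sub>v v (i, b)) $ b) = 0" using rel[OF x] by simp
  qed
  hence supp: "supp v = {}" by (rule no_family)
  have "col (C i) b = 0\<^sub>v (n i)" if "b < n i" for b
    using supp that i by (auto simp: supp_def v_def J_def)
  thus ?thesis
    using C[OF i] by (intro eq_matI) (auto, metis carrier_matD index_col index_zero_vec(1))
qed

lemma splitting_field_scalar:
  fixes \<tau> :: "'a \<Rightarrow> 'f::field mat"
  assumes "splitting_field TYPE('f) G" "irreducible_representation G n \<tau>"
    "T \<in> carrier_mat n n" "\<And>x. x \<in> carrier G \<Longrightarrow> T * \<tau> x = \<tau> x * T"
  shows "\<exists>c. T = c \<cdot>\<^sub>m 1\<^sub>m n"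
  using assms unfolding splitting_field_def by blast

text \<open>A linear form vanishing on all \<open>\<tau> x\<close> is \<open>X \<mapsto> tr (X C)\<close> for some \<open>C\<close>, and is therefore zero by
\<open>frobenius_schur\<close> applied to a single representation.\<close>

lemma burnside_span:
  fixes \<tau> :: "'a \<Rightarrow> 'f::field mat"
  assumes fin: "finite (carrier G)" and split: "splitting_field TYPE('f) G"
    and irr: "irreducible_representation G n \<tau>" and X: "X \<in> carrier_mat n n"
  obtains a where "lin_ext G n \<tau> a = X"
proof -
  note rep = irreducibleD(1)[OF irr]
  define flat where "flat Y = vec (n * n) (\<lambda>k. Y $$ (k div n, k mod n))" for Y :: "'f mat"
  define W where "W = range (\<lambda>a. flat (lin_ext G n \<tau> a))"
  have W: "VectorSpace.subspace class_ring W (module_vec TYPE('f) (n * n))"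
  proof (rule subspace_module_vecI)
    have "0\<^sub>v (n * n) = flat (0\<^sub>m n n)" by (auto simp: flat_def square_index intro!: eq_vecI)
    thus "0\<^sub>v (n * n) \<in> W" unfolding W_def lin_ext_linear(1)[of G n \<tau>, symmetric] by simp
    fix u u' c assume "u \<in> W"
    then obtain a where a: "u = flat (lin_ext G n \<tau> a)" by (auto simp: W_def)
    have "c \<cdot>\<^sub>v u = flat (c \<cdot>\<^sub>m lin_ext G n \<tau> a)"
      by (auto simp: a flat_def square_index intro!: eq_vecI)
    thus "c \<cdot>\<^sub>v u \<in> W" unfolding W_def lin_ext_linear(3)[symmetric] by simp
    assume "u' \<in> W"
    then obtain b where b: "u' = flat (lin_ext G n \<tau> b)" by (auto simp: W_def)
    have "u + u' = flat (lin_ext G n \<tau> a + lin_ext G n \<tau> b)"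
      by (auto simp: a b flat_def square_index intro!: eq_vecI)
    thus "u + u' \<in> W" unfolding W_def lin_ext_linear(2)[symmetric] by simp
  qed (auto simp: W_def flat_def)
  have "W = carrier_vec (n * n)"
  proof (rule ccontr)
    assume "W \<noteq> carrier_vec (n * n)"
    then obtain c where c: "c \<in> carrier_vec (n * n)" "c \<noteq> 0\<^sub>v (n * n)"
      and ann: "\<And>w. w \<in> W \<Longrightarrow> c \<bullet> w = 0"
      using annihilator_of_proper_subspace[OF W] by blast
    define C where "C = mat n n (\<lambda>(i, j). c $ (j * n + i))"
    have C: "C \<in> carrier_mat n n" by (simp add: C_def)
    have "mat_trace (\<tau> x * C) = 0" if x: "x \<in> carrier G" for x
    proof -
      have "flat (\<tau> x) \<in> W"
        unfolding W_def by (rule image_eqI[of _ _ "\<lambda>y. if y = x then 1 else 0"])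
          (use lin_ext_delta[OF fin rep x] in auto)
      hence "0 = c \<bullet> flat (\<tau> x)" using ann by simp
      also have "\<dots> = (\<Sum>k<n * n. c $ (k div n * n + k mod n) * \<tau> x $$ (k div n, k mod n))"
        by (simp add: scalar_prod_def flat_def atLeast0LessThan)
      also have "\<dots> = (\<Sum>i<n. \<Sum>j<n. c $ (i * n + j) * \<tau> x $$ (i, j))"
        by (rule sum_square_index[of "\<lambda>i j. c $ (i * n + j) * \<tau> x $$ (i, j)"])
      also have "\<dots> = mat_trace (\<tau> x * C)"
        using matrix_repD(1)[OF rep x] C
        by (auto simp: mat_trace_mult[of _ n n] C_def mult.commute intro!: sum.cong)
      finally show ?thesis ..
    qed
    hence C0: "C = 0\<^sub>m n n"
      using frobenius_schur[OF fin, of "{()}" "\<lambda>_. n" "\<lambda>_. \<tau>" "\<lambda>_. C" "()"] irr C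
        splitting_field_scalar[OF split irr] by simp
    have "c $ k = 0" if "k < n * n" for k
      using arg_cong[OF C0, of "\<lambda>Y. Y $$ (k mod n, k div n)"] square_index(1,2)[OF that] by (simp add: C_def)
    thus False using c by (auto intro: eq_vecI)
  qed
  hence "flat X \<in> W" by (simp add: flat_def)
  then obtain a where a: "flat X = flat (lin_ext G n \<tau> a)" by (auto simp: W_def)
  have "lin_ext G n \<tau> a = X"
  proof (rule eq_matI)
    fix i j assume "i < dim_row X" "j < dim_col X"
    hence ij: "i < n" "j < n" using X by auto
    show "lin_ext G n \<tau> a $$ (i, j) = X $$ (i, j)"
      using square_index(3)[OF ij] arg_cong[OF a, of "\<lambda>v. v $ (i * n + j)"] ij by (simp add: flat_def)
  qed (use X in auto)
  thus ?thesis using that by blast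
qed

text \<open>This is \<open>frobenius_schur\<close> for scalar matrices \<open>C i\<close>.\<close>

lemma traces_linearly_independent:
  fixes \<tau> :: "'i \<Rightarrow> 'a \<Rightarrow> 'f::field mat"
  assumes fin: "finite (carrier G)" and split: "splitting_field TYPE('f) G" and I: "finite I"
    and irr: "\<And>i. i \<in> I \<Longrightarrow> irreducible_representation G (n i) (\<tau> i)"
    and noniso: "\<And>i j T. i \<in> I \<Longrightarrow> j \<in> I \<Longrightarrow> i \<noteq> j \<Longrightarrow> T \<in> carrier_mat (n j) (n i) \<Longrightarrow>
      (\<And>x. x \<in> carrier G \<Longrightarrow> T * \<tau> i x = \<tau> j x * T) \<Longrightarrow> T = 0\<^sub>m (n j) (n i)"
    and rel: "\<And>x. x \<in> carrier G \<Longrightarrow> (\<Sum>i\<in>I. c i * mat_trace (\<tau> i x)) = 0"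
    and i: "i \<in> I"
  shows "c i = 0"
proof -
  have "c i \<cdot>\<^sub>m 1\<^sub>m (n i) = 0\<^sub>m (n i) (n i)"
  proof (rule frobenius_schur[OF fin I irr _ noniso, where C = "\<lambda>i. c i \<cdot>\<^sub>m 1\<^sub>m (n i)"])
    show "\<exists>c. T = c \<cdot>\<^sub>m 1\<^sub>m (n i)" if "i \<in> I" "T \<in> carrier_mat (n i) (n i)"
      "\<And>x. x \<in> carrier G \<Longrightarrow> T * \<tau> i x = \<tau> i x * T" for i T
      using splitting_field_scalar[OF split irr] that by blast
    fix x assume x: "x \<in> carrier G"
    have "mat_trace (\<tau> i x * (c i \<cdot>\<^sub>m 1\<^sub>m (n i))) = c i * mat_trace (\<tau> i x)" if "i \<in> I" for i
    proof -
      note t = matrix_repD(1)[OF irreducibleD(1)[OF irr[OF that]] x]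
      have "\<tau> i x * (c i \<cdot>\<^sub>m 1\<^sub>m (n i)) = c i \<cdot>\<^sub>m \<tau> i x"
        using t by (simp add: mult_smult_distrib[OF t, of _ "n i"])
      thus ?thesis using mat_trace_smult[OF t] by simp
    qed
    thus "(\<Sum>i\<in>I. mat_trace (\<tau> i x * (c i \<cdot>\<^sub>m 1\<^sub>m (n i)))) = 0" using rel[OF x] by simp
  qed (use i in auto)
  from arg_cong[OF this, of "\<lambda>A. A $$ (0, 0)"] show ?thesis
    using irreducibleD(2)[OF irr[OF i]] by simp
qed

end

section \<open>Complete discrete valuation rings of mixed characteristic\<close>

locale p_modular_ring =
  fixes p :: nat and res :: "'o::idom \<Rightarrow> 'k::field"
  assumes p_prime: "normalization_semidom_class.prime p"
    and complete_dvr: "complete_discrete_valuation_ring TYPE('o)"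
    and residue: "residue_map res"
    and char_k: "CHAR('k) = p"
    and char_K: "CHAR('o fract) = 0"
begin

sublocale res: comm_ring_hom res
  using residue by (simp add: residue_map_def)

lemma unit_iff: "x dvd 1 \<longleftrightarrow> res x \<noteq> 0"
  using residue by (auto simp: residue_map_def)

lemma res_surj: "\<exists>x. res x = y"
  using residue by (auto simp: residue_map_def surj_def) metis

lemma of_nat_ring_eq_0_iff: "(of_nat n :: 'o) = 0 \<longleftrightarrow> n = 0"
proof -
  have "to_fract (of_nat n :: 'o) = (of_nat n :: 'o fract)" by (induction n) auto
  hence "(of_nat n :: 'o) = 0 \<longleftrightarrow> (of_nat n :: 'o fract) = 0" using to_fract_eq_0_iff[of "of_nat n :: 'o"] by simp
  thus ?thesis by (simp add: of_nat_eq_0_iff_char_dvd char_K)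
qed

lemma principal_ideal:
  fixes I :: "'o set"
  assumes "0 \<in> I" "\<And>x y. x \<in> I \<Longrightarrow> y \<in> I \<Longrightarrow> x + y \<in> I" "\<And>x y. x \<in> I \<Longrightarrow> y * x \<in> I"
  obtains d where "I = {x. d dvd x}"
proof -
  interpret principal_domain "class_ring :: 'o ring"
    using complete_dvr
    by (simp add: complete_discrete_valuation_ring_def discrete_valuation_ring_def)
  have minus: "- x \<in> I" if "x \<in> I" for x using assms(3)[OF that, of "-1"] by simp
  have "ideal I (class_ring :: 'o ring)"
  proof (rule idealI)
    show "subgroup I (add_monoid (class_ring :: 'o ring))"
    proof (rule add.subgroupI)
      fix a assume "a \<in> I"
      thus "\<ominus>\<^bsub>class_ring\<^esub> a \<in> I"
        using minus by (simp add: class_ring.ring_simprules(3) class_ring_simps)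
    qed (use assms in auto)
  qed (use assms class_ring.ring_axioms in \<open>auto simp: mult.commute\<close>)
  from exists_gen[OF this] obtain d where "I = {x * d | x. True}"
    by (auto simp: cgenideal_def)
  hence "I = {x. d dvd x}" by (auto simp: dvd_def mult.commute)
  thus ?thesis using that by blast
qed

text \<open>Write \<open>a = d a'\<close> and \<open>b = d b'\<close> with \<open>d\<close> a combination of \<open>a\<close> and \<open>b\<close>. Then \<open>1\<close> is a combination of \<open>a'\<close> and
\<open>b'\<close>, so one of the two is a unit because the nonunits are the kernel of \<open>res\<close>.\<close>

lemma dvd_total: "a dvd b \<or> b dvd (a :: 'o)"
proof -
  define I where "I = {u * a + v * b | u v. True}"
  obtain d where d: "I = {x. d dvd x}"
  proof (rule principal_ideal[of I])
    show "0 \<in> I" unfolding I_def by (intro CollectI exI[of _ 0]) simp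
    fix x y assume "x \<in> I"
    then obtain u v where x: "x = u * a + v * b" by (auto simp: I_def)
    show "y * x \<in> I" unfolding I_def x
      by (intro CollectI exI[of _ "y * u"] exI[of _ "y * v"]) (simp add: algebra_simps)
    assume "y \<in> I"
    then obtain u' v' where y: "y = u' * a + v' * b" by (auto simp: I_def)
    show "x + y \<in> I" unfolding I_def x y
      by (intro CollectI exI[of _ "u + u'"] exI[of _ "v + v'"]) (simp add: algebra_simps)
  qed
  have "a = 1 * a + 0 * b" "b = 0 * a + 1 * b" by simp_all
  hence "a \<in> I" "b \<in> I" unfolding I_def by blast+
  then obtain a' b' where ab: "a = d * a'" "b = d * b'" unfolding d by (auto simp: dvd_def)
  have "d \<in> I" unfolding d by simp
  then obtain u v where "d = u * a + v * b" by (auto simp: I_def)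
  hence uv: "d = d * (u * a' + v * b')" using ab by (simp add: algebra_simps)
  show ?thesis
  proof (cases "d = 0")
    case False
    hence "res (u * a' + v * b') = 1" using uv by simp
    hence "res a' \<noteq> 0 \<or> res b' \<noteq> 0" by (auto simp: res.hom_add res.hom_mult)
    hence "a' dvd 1 \<or> b' dvd 1" by (simp add: unit_iff)
    thus ?thesis
      unfolding ab using mult_dvd_mono[OF dvd_refl[of d]] by (meson dvd_trans one_dvd)
  qed (use ab in simp)
qed

lemma fract_or_inverse_integral: "(x :: 'o fract) \<in> range to_fract \<or> inverse x \<in> range to_fract"
proof -
  obtain a b where x: "x = Fraction_Field.Fract a b" "b \<noteq> 0" by (cases x)
  hence x': "x = to_fract a / to_fract b" by (simp add: Fract_conv_to_fract)
  from dvd_total[of a b] show ?thesis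
  proof
    assume "a dvd b"
    then obtain c where "b = a * c" by (auto simp: dvd_def)
    hence "inverse x = to_fract c" using x' x(2) by simp
    thus ?thesis by blast
  next
    assume "b dvd a"
    then obtain c where "a = b * c" by (auto simp: dvd_def)
    hence "x = to_fract c" using x' x(2) by simp
    thus ?thesis by blast
  qed
qed

text \<open>A generator of the kernel of \<open>res\<close>. It is nonzero as the ring is not a field. The elements divisible by
all its powers form a principal ideal \<open>(j)\<close> with \<open>j \<in> \<pi> (j)\<close>, which forces \<open>j = 0\<close>.\<close>

lemma uniformizer:
  obtains \<pi> :: 'o where "prime_elem \<pi>" "\<And>x. res x = 0 \<longleftrightarrow> \<pi> dvd x"
    "\<And>x. (\<And>n. \<pi> ^ n dvd x) \<Longrightarrow> x = 0"
proof -
  obtain \<pi> where "{x. res x = 0} = {x. \<pi> dvd x}"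
    by (rule principal_ideal[of "{x. res x = 0}"]) (auto simp: res.hom_add res.hom_mult)
  hence \<pi>: "res x = 0 \<longleftrightarrow> \<pi> dvd x" for x by blast
  have "\<pi> \<noteq> 0"
  proof
    assume "\<pi> = 0"
    hence unit: "x dvd 1" if "x \<noteq> 0" for x :: 'o using \<pi>[of x] that by (simp add: unit_iff)
    interpret principal_domain "class_ring :: 'o ring"
      using complete_dvr
      by (simp add: complete_discrete_valuation_ring_def discrete_valuation_ring_def)
    have "field (class_ring :: 'o ring)"
    proof (rule cring.cring_fieldI2)
      show "cring (class_ring :: 'o ring)" by unfold_locales
      show "\<exists>b\<in>carrier class_ring. a \<otimes>\<^bsub>class_ring\<^esub> b = \<one>\<^bsub>class_ring\<^esub>"
        if "a \<noteq> \<zero>\<^bsub>class_ring\<^esub>" for a :: 'o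
        using unit[of a] that by (auto elim!: dvdE intro: sym)
    qed simp_all
    thus False
      using complete_dvr
      by (simp add: complete_discrete_valuation_ring_def discrete_valuation_ring_def)
  qed
  have "prime_elem \<pi>"
  proof (rule prime_elemI)
    show "\<not> \<pi> dvd 1" using \<pi>[of \<pi>] by (simp add: unit_iff)
    show "\<pi> dvd a \<or> \<pi> dvd b" if "\<pi> dvd a * b" for a b
      using that by (simp add: \<pi>[symmetric] res.hom_mult)
  qed fact
  moreover have "x = 0" if "\<And>n. \<pi> ^ n dvd x" for x
  proof -
    obtain j where j: "{x. \<forall>n. \<pi> ^ n dvd x} = {x. j dvd x}"
      by (rule principal_ideal[of "{x. \<forall>n. \<pi> ^ n dvd x}"]) auto
    hence *: "(\<forall>n. \<pi> ^ n dvd y) \<longleftrightarrow> j dvd y" for y by blast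
    have j_dvd: "\<pi> ^ n dvd j" for n using *[of j] dvd_refl[of j] by blast
    from this[of 1] obtain i where i: "j = \<pi> * i" by (auto simp: dvd_def)
    have "\<pi> ^ n dvd i" for n
      using j_dvd[of "Suc n"] \<open>\<pi> \<noteq> 0\<close> by (simp add: i)
    hence "j dvd i" using *[of i] by blast
    then obtain r where "i = j * r" by (auto simp: dvd_def)
    hence "j * (1 - \<pi> * r) = 0" using i by (simp add: algebra_simps)
    moreover have "1 - \<pi> * r \<noteq> 0"
    proof
      assume "1 - \<pi> * r = 0"
      hence "\<pi> dvd 1" by (metis dvd_triv_left eq_iff_diff_eq_0)
      thus False using \<pi>[of 1] by simp
    qed
    ultimately have "j = 0" by simp
    moreover have "j dvd x" using *[of x] that by blast
    ultimately show "x = 0" by simp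
  qed
  ultimately show ?thesis using that[of \<pi>] \<pi> by blast
qed

text \<open>Factor \<open>x ^ q - y ^ q\<close> as \<open>x - y\<close> times a sum of \<open>q\<close> terms that are all congruent modulo \<open>\<pi>\<close>; the sum is
then divisible by \<open>\<pi>\<close>.\<close>

lemma power_congruence_improves:
  fixes x y \<pi> :: 'o
  assumes \<pi>: "\<And>x. res x = 0 \<longleftrightarrow> \<pi> dvd x" and q: "p dvd q" and k: "0 < k" and dvd: "\<pi> ^ k dvd x - y"
  shows "\<pi> ^ Suc k dvd x ^ q - y ^ q"
proof -
  have "\<pi> dvd x - y" using dvd k by (meson dvd_power dvd_trans)
  hence "res x = res y" by (simp add: \<pi>[symmetric] res.hom_minus)
  have "res (\<Sum>i<q. y ^ (q - Suc i) * x ^ i) = (\<Sum>i<q. res y ^ (q - Suc i) * res x ^ i)"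
    by (simp add: res.hom_sum res.hom_mult res.hom_power)
  also have "\<dots> = (\<Sum>i<q. res y ^ (q - 1))"
    unfolding \<open>res x = res y\<close> by (intro sum.cong refl) (simp flip: power_add)
  also have "\<dots> = 0" using q by (simp add: of_nat_eq_0_iff_char_dvd char_k)
  finally have "\<pi> dvd (\<Sum>i<q. y ^ (q - Suc i) * x ^ i)" by (simp add: \<pi>)
  hence "\<pi> ^ k * \<pi> dvd (x - y) * (\<Sum>i<q. y ^ (q - Suc i) * x ^ i)"
    using dvd by (intro mult_dvd_mono)
  thus ?thesis by (simp add: power_diff_sumr2 mult.commute)
qed

text \<open>With \<open>q\<close> a power of \<open>p\<close> that is \<open>1\<close> modulo \<open>m\<close>, one has \<open>\<mu> ^ q = \<mu>\<close>. For any preimage \<open>a\<close> of \<open>\<mu>\<close> the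
sequence \<open>a ^ (q ^ i)\<close> is Cauchy, and its limit is fixed by \<open>q\<close>-th powers and reduces to \<open>\<mu>\<close>. The order
of the lift is only controlled to divide \<open>q - 1\<close>.\<close>

lemma teichmueller_lift:
  assumes m: "m > 0" "coprime m p" and \<mu>: "\<mu> ^ m = 1"
  obtains \<zeta> :: 'o and m' where "m' > 0" "coprime m' p" "\<zeta> ^ m' = 1" "res \<zeta> = \<mu>"
proof -
  obtain \<pi> :: 'o where \<pi>: "prime_elem \<pi>" "\<And>x. res x = 0 \<longleftrightarrow> \<pi> dvd x"
    "\<And>x. (\<And>n. \<pi> ^ n dvd x) \<Longrightarrow> x = 0" by (rule uniformizer) blast
  have p2: "p \<ge> 2" using p_prime by (simp add: prime_ge_2_nat)
  define q where "q = p ^ totient m"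
  have tot: "totient m > 0" using m by simp
  have pq: "p dvd q" using tot by (simp add: q_def)
  have "q \<ge> p ^ 1" unfolding q_def by (intro power_increasing) (use tot p2 in linarith)+
  hence q2: "q \<ge> 2" using p2 by simp
  have "[q = 1] (mod m)" unfolding q_def using m by (intro euler_theorem) (simp add: coprime_commute)
  hence "m dvd q - 1" using q2 by (simp add: cong_altdef_nat)
  then obtain r where r: "q - 1 = m * r" by (auto simp: dvd_def)
  obtain q' where q': "q = Suc q'" using q2 by (cases q) auto
  have "\<mu> ^ q = \<mu> * \<mu> ^ (q - 1)" by (simp add: q')
  hence \<mu>q: "\<mu> ^ q = \<mu>" by (simp add: r power_mult \<mu> del: One_nat_def)
  obtain a where a: "res a = \<mu>" using res_surj by blast
  define s where "s n = a ^ (q ^ n)" for n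
  have s_Suc: "s (Suc n) = s n ^ q" for n by (simp add: s_def mult.commute flip: power_mult)
  have res_s: "res (s n) = \<mu>" for n by (induction n) (auto simp: s_Suc res.hom_power \<mu>q, simp add: s_def a)
  have step: "\<pi> ^ Suc n dvd s (Suc n) - s n" for n
  proof (induction n)
    case 0
    have "res (s (Suc 0) - s 0) = 0" by (simp add: res.hom_minus res_s)
    thus ?case by (simp add: \<pi>)
  next
    case (Suc n)
    have "\<pi> ^ Suc (Suc n) dvd s (Suc n) ^ q - s n ^ q"
      by (rule power_congruence_improves[OF \<pi>(2) pq _ Suc]) simp
    thus ?case by (simp only: s_Suc[symmetric])
  qed
  have cauchy: "\<pi> ^ n dvd s (n + i) - s n" for n i
  proof (induction i)
    case (Suc i)
    have "\<pi> ^ n dvd \<pi> ^ Suc (n + i)" by (rule le_imp_power_dvd) simp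
    hence "\<pi> ^ n dvd (s (Suc (n + i)) - s (n + i)) + (s (n + i) - s n)"
      using step[of "n + i"] Suc by (intro dvd_add) (auto intro: dvd_trans)
    thus ?case by simp
  qed simp
  have "\<exists>l. \<forall>n. \<exists>N. \<forall>i\<ge>N. \<pi> ^ n dvd s i - l"
  proof -
    have "\<forall>n. \<exists>N. \<forall>i\<ge>N. \<forall>j\<ge>N. \<pi> ^ n dvd s i - s j"
    proof (intro allI exI[of _ n for n] impI)
      fix n i j :: nat assume "n \<le> i" "n \<le> j"
      hence "\<pi> ^ n dvd s i - s n" "\<pi> ^ n dvd s j - s n"
        using cauchy[of n "i - n"] cauchy[of n "j - n"] by auto
      hence "\<pi> ^ n dvd (s i - s n) - (s j - s n)" by (rule dvd_diff)
      thus "\<pi> ^ n dvd s i - s j" by simp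
    qed
    thus ?thesis using complete_dvr \<pi>(1) unfolding complete_discrete_valuation_ring_def by blast
  qed
  then obtain l where l: "\<And>n. \<exists>N. \<forall>i\<ge>N. \<pi> ^ n dvd s i - l" by blast
  have "\<pi> ^ n dvd l ^ q - l" for n
  proof -
    obtain N where N: "\<And>i. i \<ge> N \<Longrightarrow> \<pi> ^ n dvd s i - l" using l by blast
    have "s N - l dvd s N ^ q - l ^ q" by (simp add: power_diff_sumr2)
    hence "\<pi> ^ n dvd s (Suc N) - l ^ q" using N[of N] dvd_trans by (simp add: s_Suc) blast
    moreover have "\<pi> ^ n dvd s (Suc N) - l" using N[of "Suc N"] by simp
    ultimately have "\<pi> ^ n dvd (s (Suc N) - l) - (s (Suc N) - l ^ q)"
      by (metis dvd_diff)
    thus ?thesis by simp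
  qed
  hence "l ^ q = l" using \<pi>(3)[of "l ^ q - l"] by simp
  have res_l: "res l = \<mu>"
  proof -
    obtain N where "\<pi> ^ 1 dvd s N - l" using l[of 1] by blast
    hence "res (s N - l) = 0" by (simp add: \<pi>(2))
    thus ?thesis by (simp add: res.hom_minus res_s)
  qed
  have "\<mu> \<noteq> 0" using \<mu> m by (auto simp: power_0_left)
  hence "l \<noteq> 0" using res_l by auto
  moreover have "l * l ^ (q - 1) = l * 1"
    using \<open>l ^ q = l\<close> by (simp add: q')
  ultimately have "l ^ (q - 1) = 1" by simp
  moreover have "coprime (q - 1) p"
  proof -
    have "coprime (q - 1) q" by (simp add: q')
    thus ?thesis by (rule coprime_divisors[OF dvd_refl pq])
  qed
  ultimately show ?thesis using that[of "q - 1" l] res_l q2 by simp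
qed

text \<open>With \<open>M\<close> a common exponent, \<open>\<zeta> ^ M - \<xi> ^ M = 0\<close> factors as \<open>\<zeta> - \<xi>\<close> times a sum whose residue is
\<open>M\<close> times a unit, hence nonzero.\<close>

lemma root_of_unity_eqI:
  fixes \<zeta> \<xi> :: 'o
  assumes m: "m > 0" "coprime m p" "\<zeta> ^ m = 1" and m': "m' > 0" "coprime m' p" "\<xi> ^ m' = 1"
    and res: "res \<zeta> = res \<xi>"
  shows "\<zeta> = \<xi>"
proof -
  let ?M = "m * m'"
  have pow: "\<zeta> ^ ?M = 1" "\<xi> ^ ?M = 1"
    using m m' by (simp_all add: power_mult) (metis mult.commute power_mult power_one)
  have "res \<xi> ^ ?M = 1" using pow(2) by (metis res.hom_power res.hom_one)
  hence nz: "res \<xi> \<noteq> 0" using m m' by (auto simp: power_0_left)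
  have "res (\<Sum>i<?M. \<xi> ^ (?M - Suc i) * \<zeta> ^ i) = (\<Sum>i<?M. res \<xi> ^ (?M - 1))"
    unfolding res.hom_sum res.hom_mult res.hom_power res by (intro sum.cong refl) (simp flip: power_add)
  moreover have "\<not> p dvd ?M"
  proof
    assume "p dvd ?M"
    moreover have "coprime ?M p" using m(2) m'(2) by simp
    ultimately have "is_unit p" by (meson coprime_common_divisor dvd_refl)
    thus False using p_prime not_prime_unit by blast
  qed
  ultimately have "res (\<Sum>i<?M. \<xi> ^ (?M - Suc i) * \<zeta> ^ i) \<noteq> 0"
    using nz of_nat_eq_0_iff_char_dvd[where 'a = 'k, of ?M] by (simp add: char_k)
  hence "(\<Sum>i<?M. \<xi> ^ (?M - Suc i) * \<zeta> ^ i) \<noteq> 0" by auto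
  moreover have "(\<zeta> - \<xi>) * (\<Sum>i<?M. \<xi> ^ (?M - Suc i) * \<zeta> ^ i) = 0"
    using pow power_diff_sumr2[of \<zeta> ?M \<xi>] by simp
  ultimately show ?thesis by simp
qed

lemma root_of_unity_lift_res:
  assumes "m > 0" "coprime m p" "\<zeta> ^ m = 1"
  shows "root_of_unity_lift p res (res \<zeta>) = \<zeta>"
  unfolding root_of_unity_lift_def
proof (rule the_equality)
  show "(\<exists>m>0. coprime m p \<and> \<zeta> ^ m = 1) \<and> res \<zeta> = res \<zeta>" using assms by blast
next
  fix \<xi> assume "(\<exists>m>0. coprime m p \<and> \<xi> ^ m = 1) \<and> res \<xi> = res \<zeta>"
  thus "\<xi> = \<zeta>" using root_of_unity_eqI[of _ \<xi> _ \<zeta>] assms by blast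
qed

lemma res_root_of_unity_lift:
  assumes "m > 0" "coprime m p" "\<mu> ^ m = 1"
  shows "res (root_of_unity_lift p res \<mu>) = \<mu>"
proof -
  obtain \<zeta> :: 'o and m' where "m' > 0" "coprime m' p" "\<zeta> ^ m' = 1" "res \<zeta> = \<mu>"
    using teichmueller_lift[OF assms] .
  thus ?thesis using root_of_unity_lift_res[of m' \<zeta>] by simp
qed

end

section \<open>Brauer characters and decomposition numbers\<close>

text \<open>The values, padded by zero rows, form a square matrix of determinant zero.\<close>

lemma dependent_if_more_functions_than_points:
  fixes f :: "'i \<Rightarrow> 'x \<Rightarrow> 'f::field"
  assumes "finite X" "finite I" "card X < card I"
  obtains c i where "i \<in> I" "c i \<noteq> 0" "\<forall>x\<in>X. (\<Sum>i\<in>I. c i * f i x) = 0"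
proof -
  define N where "N = card I"
  obtain g where g: "bij_betw g {..<N} I"
    using ex_bij_betw_nat_finite[OF assms(2)] by (auto simp: N_def atLeast0LessThan)
  obtain h where h: "bij_betw h {..<card X} X"
    using ex_bij_betw_nat_finite[OF assms(1)] by (auto simp: atLeast0LessThan)
  define A where "A = mat N N (\<lambda>(r, j). if r < card X then f (g j) (h r) else 0)"
  have A: "A \<in> carrier_mat N N" by (simp add: A_def)
  have "det (transpose_mat A) = 0"
    unfolding det_0_iff_vec_prod_zero_field[OF transpose_carrier_mat[THEN iffD2, OF A]]
  proof (intro exI[of _ "unit_vec N (card X)"] conjI)
    show "transpose_mat A *\<^sub>v unit_vec N (card X) = 0\<^sub>v N"
      using assms by (intro eq_vecI) (auto simp: A_def N_def)
  qed (use assms in \<open>auto simp: N_def\<close>)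
  hence "det A = 0" using det_transpose[OF A] by simp
  then obtain v where v: "v \<in> carrier_vec N" "v \<noteq> 0\<^sub>v N" "A *\<^sub>v v = 0\<^sub>v N"
    using det_0_iff_vec_prod_zero_field[OF A] by blast
  then obtain j where j: "j < N" "v $ j \<noteq> 0" by (metis carrier_vecD eq_vecI index_zero_vec)
  define c where "c i = v $ inv_into {..<N} g i" for i
  have c: "c (g j) = v $ j" if "j < N" for j
    using that g by (simp add: c_def bij_betw_def)
  have "(\<Sum>i\<in>I. c i * f i x) = 0" if x: "x \<in> X" for x
  proof -
    obtain r where r: "r < card X" "x = h r" using h x by (auto simp: bij_betw_def)
    have "(\<Sum>i\<in>I. c i * f i x) = (\<Sum>j<N. c (g j) * f (g j) x)"
      by (rule sum.reindex_bij_betw[OF g, symmetric])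
    also have "\<dots> = (A *\<^sub>v v) $ r"
      using r v(1) assms(3)
      by (auto simp: c A_def N_def scalar_prod_def atLeast0LessThan mult.commute intro!: sum.cong)
    finally show ?thesis using v r assms(3) by (simp add: N_def)
  qed
  moreover have "g j \<in> I" using g j by (auto simp: bij_betw_def)
  ultimately show ?thesis using that[of "g j" c] c[OF j(1)] j(2) by auto
qed

text \<open>The prime field is fixed by the Frobenius map.\<close>

lemma frobenius_of_int:
  assumes "normalization_semidom_class.prime CHAR('f::field)" and "q = CHAR('f) ^ e"
  shows "of_int c ^ q = (of_int c :: 'f)"
proof -
  have q: "q > 0" using assms by (simp add: prime_gt_0_nat)
  have nat: "of_nat n ^ q = (of_nat n :: 'f)" for n
    by (induction n) (use q freshmans_dream'[OF assms] in \<open>auto simp: power_0_left\<close>)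
  obtain a b where c: "c = int a - int b" by (metis int_diff_cases)
  have "(of_int c + of_nat b :: 'f) ^ q = of_int c ^ q + of_nat b ^ q"
    by (rule freshmans_dream'[OF assms])
  moreover have "of_int c + of_nat b = (of_nat a :: 'f)" by (simp add: c)
  ultimately show ?thesis by (simp add: nat c algebra_simps)
qed

lemma frobenius_sum_list:
  fixes as :: "'f::field list"
  assumes "normalization_semidom_class.prime CHAR('f)" and "q = CHAR('f) ^ e"
  shows "sum_list as ^ q = (\<Sum>a\<leftarrow>as. a ^ q)"
proof -
  have "q > 0" using assms by (simp add: prime_gt_0_nat)
  thus ?thesis
    by (induction as) (auto simp: freshmans_dream'[OF assms] power_0_left)
qed

lemma order_linear_factor:
  "Polynomial.order \<mu> [:- a, 1:] = (if \<mu> = (a::'f::field) then 1 else 0)"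
proof (cases "\<mu> = a")
  case True
  have "Polynomial.order a ([:- a, 1:] ^ 1) = 1" by (rule order_power_n_n)
  thus ?thesis using True by simp
qed (auto intro: order_0I)

lemma sum_over_roots_of_linear_factors:
  fixes as :: "'f::field list" and f :: "'f \<Rightarrow> 'r::comm_semiring_1"
  assumes "finite S" "set as \<subseteq> S"
  shows "(\<Sum>\<mu>\<in>S. of_nat (Polynomial.order \<mu> (\<Prod>a\<leftarrow>as. [:- a, 1:])) * f \<mu>) = (\<Sum>a\<leftarrow>as. f a)"
  using assms(2)
proof (induction as)
  case (Cons a as)
  have nz: "[:- a, 1:] * (\<Prod>a\<leftarrow>as. [:- a, 1:]) \<noteq> 0"
    by (intro no_zero_divisors) (auto simp: prod_list_zero_iff)
  have "(\<Sum>\<mu>\<in>S. of_nat (Polynomial.order \<mu> (\<Prod>a\<leftarrow>a # as. [:- a, 1:])) * f \<mu>) =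
      (\<Sum>\<mu>\<in>S. (if \<mu> = a then f \<mu> else 0)) +
      (\<Sum>\<mu>\<in>S. of_nat (Polynomial.order \<mu> (\<Prod>a\<leftarrow>as. [:- a, 1:])) * f \<mu>)"
    unfolding sum.distrib[symmetric] list.map prod_list.Cons order_mult[OF nz] order_linear_factor
    by (intro sum.cong) (auto simp: algebra_simps)
  thus ?case using Cons assms(1) by simp
qed simp

lemma sum_list_as_counted_sum:
  fixes f :: "'b \<Rightarrow> 'r::comm_semiring_1"
  assumes "finite S" "set xs \<subseteq> S"
  shows "(\<Sum>x\<leftarrow>xs. f x) = (\<Sum>x\<in>S. of_nat (count_list xs x) * f x)"
  using assms(2)
proof (induction xs)
  case (Cons y xs)
  have "(\<Sum>x\<in>S. of_nat (count_list (y # xs) x) * f x) =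
      (\<Sum>x\<in>S. (if x = y then f x else 0) + of_nat (count_list xs x) * f x)"
    by (intro sum.cong) (auto simp: algebra_simps)
  thus ?case using Cons assms(1) by (simp add: sum.distrib)
qed simp

lemma (in comm_ring_hom) matrix_rep_map:
  assumes "matrix_rep G n R" "group G"
  shows "matrix_rep G n (\<lambda>x. map_mat hom (R x))"
  unfolding matrix_rep_def
proof (intro conjI ballI)
  note D = matrix_repD[OF assms(1)]
  show "map_mat hom (R \<one>\<^bsub>G\<^esub>) = 1\<^sub>m n" using D(2) by (simp add: mat_hom_one)
  fix x y assume x: "x \<in> carrier G" and y: "y \<in> carrier G"
  show "map_mat hom (R (x \<otimes>\<^bsub>G\<^esub> y)) = map_mat hom (R x) * map_mat hom (R y)"
    using D(3)[OF x y] mat_hom_mult[OF D(1)[OF x] D(1)[OF y]] by simp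
qed (use matrix_repD(1)[OF assms(1)] in auto)

lemma (in comm_ring_hom) mat_trace_map:
  "A \<in> carrier_mat n n \<Longrightarrow> mat_trace (map_mat hom A) = hom (mat_trace A)"
  by (simp add: mat_trace_def hom_sum)

interpretation to_fract_hom: inj_comm_ring_hom "to_fract :: 'o::idom \<Rightarrow> 'o fract"
  by unfold_locales auto

locale p_modular_system = group G + p_modular_ring p res
  for G (structure) and p :: nat and res :: "'o::idom \<Rightarrow> 'k::field" +
  assumes fin: "finite (carrier G)"
    and splitK: "\<And>H. subgroup H G \<Longrightarrow> splitting_field TYPE('o fract) (G\<lparr>carrier := H\<rparr>)"
    and splitk: "\<And>H. subgroup H G \<Longrightarrow> splitting_field TYPE('k) (G\<lparr>carrier := H\<rparr>)"
begin

lemma split_G: "splitting_field TYPE('o fract) G" "splitting_field TYPE('k) G"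
  using splitK[OF subgroup_self] splitk[OF subgroup_self] by simp_all

lemma split_cyclic:
  assumes "x \<in> carrier G"
  shows "splitting_field TYPE('o fract) (G\<lparr>carrier := generate G {x}\<rparr>)"
    "splitting_field TYPE('k) (G\<lparr>carrier := generate G {x}\<rparr>)"
  using assms by (auto intro!: splitK splitk generate_is_subgroup)

lemma p_regularD:
  assumes "x \<in> p_regular p G"
  shows "x \<in> carrier G" "ord x > 0" "coprime (ord x) p" "x [^] ord x = \<one>"
  using assms ord_ge_1[OF fin] pow_ord_eq_1 by (auto simp: p_regular_def Suc_le_eq)

text \<open>Expressing Brauer characters by the list of roots of the characteristic polynomial makes them
visibly additive along block decompositions.\<close>

lemma brauer_character_of_roots:
  assumes x: "x \<in> p_regular p G" and \<rho>: "\<rho> x \<in> carrier_mat n n"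
    and cp: "char_poly (\<rho> x) = (\<Prod>a\<leftarrow>as. [:- a, 1:])"
  shows "brauer_character p res G \<rho> x = to_fract (\<Sum>a\<leftarrow>as. root_of_unity_lift p res a)"
proof -
  have "eigenvalue (\<rho> x) \<mu> \<longleftrightarrow> \<mu> \<in> set as" for \<mu>
    unfolding eigenvalue_root_char_poly[OF \<rho>] cp by (auto simp: poly_prod_list prod_list_zero_iff o_def)
  hence "{\<mu>. eigenvalue (\<rho> x) \<mu>} = set as" by auto
  hence "brauer_character p res G \<rho> x =
      (\<Sum>\<mu>\<in>set as. of_nat (Polynomial.order \<mu> (\<Prod>a\<leftarrow>as. [:- a, 1:])) * to_fract (root_of_unity_lift p res \<mu>))"
    using x by (simp add: brauer_character_def cp)
  also have "\<dots> = (\<Sum>a\<leftarrow>as. to_fract (root_of_unity_lift p res a))"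
    by (rule sum_over_roots_of_linear_factors) auto
  finally show ?thesis by (simp add: to_fract_hom.hom_sum_list o_def)
qed

lemma brauer_character_residue:
  assumes x: "x \<in> p_regular p G" and \<rho>: "matrix_rep G n \<rho>"
  obtains b where "brauer_character p res G \<rho> x = to_fract b" "res b = mat_trace (\<rho> x)"
proof -
  note X = p_regularD[OF x]
  obtain as where as: "char_poly (\<rho> x) = (\<Prod>a\<leftarrow>as. [:- a, 1:])"
    "\<forall>k::nat. mat_trace (\<rho> (x [^] k)) = (\<Sum>a\<leftarrow>as. a ^ k)"
    "\<forall>a\<in>set as. \<forall>k::nat. x [^] k = \<one> \<longrightarrow> a ^ k = 1"
    using char_poly_splits[OF X(1) split_cyclic(2)[OF X(1)] \<rho>] .
  have "res (\<Sum>a\<leftarrow>as. root_of_unity_lift p res a) = (\<Sum>a\<leftarrow>as. res (root_of_unity_lift p res a))"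
    by (simp add: res.hom_sum_list o_def)
  also have "\<dots> = (\<Sum>a\<leftarrow>as. a)"
    using res_root_of_unity_lift[OF X(2,3)] as(3) X(4)
    by (intro arg_cong[of _ _ sum_list] map_cong) auto
  also have "\<dots> = mat_trace (\<rho> x)" using as(2)[rule_format, of 1] X(1) by simp
  finally show ?thesis
    using that brauer_character_of_roots[of x \<rho>, OF x matrix_repD(1)[OF \<rho> X(1)] as(1)] by blast
qed

lemma brauer_character_composition_series:
  fixes \<rho> :: "_ \<Rightarrow> 'k mat"
  assumes x: "x \<in> p_regular p G" and \<rho>: "matrix_rep G n \<rho>" and L: "is_composition_series n \<rho> L"
  shows "brauer_character p res G \<rho> x = (\<Sum>(d, \<tau>)\<leftarrow>L. brauer_character p res G \<tau> x)"
proof -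
  note X = p_regularD[OF x]
  have "\<exists>as. (\<Prod>(d, \<tau>)\<leftarrow>L. char_poly (\<tau> x)) = (\<Prod>a\<leftarrow>as. [:- a, 1:]) \<and>
      (\<Sum>(d, \<tau>)\<leftarrow>L. brauer_character p res G \<tau> x) = to_fract (\<Sum>a\<leftarrow>as. root_of_unity_lift p res a)"
    if "\<forall>(d, \<tau>)\<in>set L. irreducible_representation G d \<tau>" for L :: "(nat \<times> (_ \<Rightarrow> 'k mat)) list"
    using that
  proof (induction L)
    case (Cons l L)
    obtain d \<tau> where l: "l = (d, \<tau>)" by (cases l)
    from Cons obtain bs where bs: "(\<Prod>(d, \<tau>)\<leftarrow>L. char_poly (\<tau> x)) = (\<Prod>a\<leftarrow>bs. [:- a, 1:])"
      "(\<Sum>(d, \<tau>)\<leftarrow>L. brauer_character p res G \<tau> x) = to_fract (\<Sum>a\<leftarrow>bs. root_of_unity_lift p res a)"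
      by auto
    have \<tau>: "matrix_rep G d \<tau>" using Cons.prems l irreducibleD(1) by auto
    obtain as where as: "char_poly (\<tau> x) = (\<Prod>a\<leftarrow>as. [:- a, 1:])"
      using char_poly_splits[OF X(1) split_cyclic(2)[OF X(1)] \<tau>] .
    show ?case
      using bs as brauer_character_of_roots[of x \<tau>, OF x matrix_repD(1)[OF \<tau> X(1)] as]
      by (intro exI[of _ "as @ bs"]) (simp add: l)
  qed (auto intro: exI[of _ "[]"])
  then obtain as where as: "(\<Prod>(d, \<tau>)\<leftarrow>L. char_poly (\<tau> x)) = (\<Prod>a\<leftarrow>as. [:- a, 1:])"
      "(\<Sum>(d, \<tau>)\<leftarrow>L. brauer_character p res G \<tau> x) = to_fract (\<Sum>a\<leftarrow>as. root_of_unity_lift p res a)"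
    using L unfolding is_composition_series_def by blast
  have "char_poly (\<rho> x) = (\<Prod>a\<leftarrow>as. [:- a, 1:])"
    using L X(1) as(1) unfolding is_composition_series_def by simp
  from brauer_character_of_roots[of x \<rho>, OF x matrix_repD(1)[OF \<rho> X(1)] this] show ?thesis
    using as(2) by simp
qed

text \<open>A nonzero intertwiner is invertible by Schur's lemma, and similar matrices have the same eigenvalues
with the same multiplicities.\<close>

lemma intertwiner_zero_if_brauer_characters_differ:
  fixes \<rho> \<sigma> :: "_ \<Rightarrow> 'k mat"
  assumes \<rho>: "irreducible_representation G n \<rho>" and \<sigma>: "irreducible_representation G m \<sigma>"
    and ne: "brauer_character p res G \<rho> \<noteq> brauer_character p res G \<sigma>"
    and T: "T \<in> carrier_mat m n" "\<And>x. x \<in> carrier G \<Longrightarrow> T * \<rho> x = \<sigma> x * T"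
  shows "T = 0\<^sub>m m n"
proof (rule ccontr)
  assume "T \<noteq> 0\<^sub>m m n"
  with schur[OF \<rho> \<sigma> T] obtain S where nm: "n = m" and S: "S \<in> carrier_mat n n"
    "T * S = 1\<^sub>m n" "S * T = 1\<^sub>m n" by blast
  have T': "T \<in> carrier_mat n n" using T nm by simp
  note R = matrix_repD(1)[OF irreducibleD(1)[OF \<rho>]] and Q = matrix_repD(1)[OF irreducibleD(1)[OF \<sigma>]]
  have cp: "char_poly (\<rho> x) = char_poly (\<sigma> x)" if x: "x \<in> carrier G" for x
  proof -
    have "S * \<sigma> x * T = S * (T * \<rho> x)"
      using S T' Q[OF x] nm T(2)[OF x] by (simp add: assoc_mult_mat[of _ n n _ n _ n])
    also have "\<dots> = \<rho> x" using S T' R[OF x] by (simp flip: assoc_mult_mat[of _ n n _ n _ n])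
    finally show ?thesis
      using char_poly_similar_by[of "\<sigma> x" n T S] Q[OF x] S T' nm by simp
  qed
  have "brauer_character p res G \<rho> x = brauer_character p res G \<sigma> x" if x: "x \<in> p_regular p G" for x
  proof -
    note x' = p_regularD(1)[OF x]
    have "eigenvalue (\<rho> x) = eigenvalue (\<sigma> x)"
      using eigenvalue_root_char_poly[OF R[OF x']] eigenvalue_root_char_poly[OF Q[OF x']] cp[OF x']
      by (intro ext) simp
    thus ?thesis using cp[OF x'] by (simp add: brauer_character_def x)
  qed
  hence "brauer_character p res G \<rho> = brauer_character p res G \<sigma>"
    by (intro extensionalityI[of _ "p_regular p G"]) (auto simp: brauer_character_def)
  thus False using ne by simp
qed

definition ibr_rep :: "(_ \<Rightarrow> 'o fract) \<Rightarrow> nat \<times> (_ \<Rightarrow> 'k mat)" where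
  "ibr_rep \<phi> = (SOME (n, \<tau>). irreducible_representation G n \<tau> \<and> brauer_character p res G \<tau> = \<phi>)"

lemma ibr_rep:
  assumes "\<phi> \<in> IBr p res G"
  shows "irreducible_representation G (fst (ibr_rep \<phi>)) (snd (ibr_rep \<phi>))"
    "brauer_character p res G (snd (ibr_rep \<phi>)) = \<phi>"
proof -
  have "\<exists>n\<tau>. case n\<tau> of (n, \<tau>) \<Rightarrow>
      irreducible_representation G n \<tau> \<and> brauer_character p res G \<tau> = \<phi>"
    using assms by (auto simp: IBr_def)
  from someI_ex[OF this] show "irreducible_representation G (fst (ibr_rep \<phi>)) (snd (ibr_rep \<phi>))"
    "brauer_character p res G (snd (ibr_rep \<phi>)) = \<phi>"
    by (auto simp: ibr_rep_def case_prod_unfold)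
qed

abbreviation "modular_trace \<phi> x \<equiv> mat_trace (snd (ibr_rep \<phi>) x)"

lemma modular_traces_independent:
  assumes I: "I \<subseteq> IBr p res G" "finite I"
    and rel: "\<And>x. x \<in> carrier G \<Longrightarrow> (\<Sum>\<phi>\<in>I. c \<phi> * modular_trace \<phi> x) = 0" and "\<phi> \<in> I"
  shows "c \<phi> = 0"
proof (rule traces_linearly_independent[where n = "\<lambda>\<phi>. fst (ibr_rep \<phi>)"
      and \<tau> = "\<lambda>\<phi>. snd (ibr_rep \<phi>)" and c = c, OF fin split_G(2) I(2) _ _ rel \<open>\<phi> \<in> I\<close>])
  show irr: "irreducible_representation G (fst (ibr_rep \<psi>)) (snd (ibr_rep \<psi>))" if "\<psi> \<in> I" for \<psi>
    by (rule ibr_rep(1)) (use I(1) that in blast)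
  fix \<psi> \<psi>' T assume *: "\<psi> \<in> I" "\<psi>' \<in> I" "\<psi> \<noteq> \<psi>'"
    "T \<in> carrier_mat (fst (ibr_rep \<psi>')) (fst (ibr_rep \<psi>))"
    "\<And>x. x \<in> carrier G \<Longrightarrow> T * snd (ibr_rep \<psi>) x = snd (ibr_rep \<psi>') x * T"
  have "brauer_character p res G (snd (ibr_rep \<psi>)) \<noteq> brauer_character p res G (snd (ibr_rep \<psi>'))"
  proof -
    have "\<psi> \<in> IBr p res G" "\<psi>' \<in> IBr p res G" using *(1,2) I(1) by blast+
    from this[THEN ibr_rep(2)] show ?thesis using \<open>\<psi> \<noteq> \<psi>'\<close> by simp
  qed
  thus "T = 0\<^sub>m (fst (ibr_rep \<psi>')) (fst (ibr_rep \<psi>))"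
    by (rule intertwiner_zero_if_brauer_characters_differ[OF irr[OF *(1)] irr[OF *(2)] _ *(4,5)])
qed

text \<open>The trace functions of irreducible representations with distinct Brauer characters are independent
in the space of functions on \<open>G\<close>. Finiteness is essential: sums over an infinite set would be zero by
convention.\<close>

lemma finite_IBr: "finite (IBr p res G)"
proof (rule ccontr)
  assume "infinite (IBr p res G)"
  then obtain I where I: "I \<subseteq> IBr p res G" "finite I" "card I = Suc (card (carrier G))"
    using infinite_arbitrarily_large[of "IBr p res G" "Suc (card (carrier G))"] by blast
  have less: "card (carrier G) < card I" using I(3) by simp
  obtain c \<phi> where c: "\<phi> \<in> I" "c \<phi> \<noteq> 0"
    "\<forall>x\<in>carrier G. (\<Sum>\<phi>\<in>I. c \<phi> * modular_trace \<phi> x) = 0"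
    using dependent_if_more_functions_than_points[OF fin I(2) less, of "\<lambda>\<phi> x. modular_trace \<phi> x"] .
  have "c \<phi> = 0" by (rule modular_traces_independent[OF I(1,2) _ c(1)]) (use c(3) in blast)
  thus False using c(2) by simp
qed

text \<open>Let \<open>q\<close> be the \<open>p\<close>-part of the order of \<open>x\<close>. Then \<open>x [^] q\<close> is \<open>p\<close>-regular, and in characteristic \<open>p\<close> the
trace at \<open>x [^] q\<close> is the \<open>q\<close>-th power of the trace at \<open>x\<close>. Since the integers \<open>c \<phi>\<close> are fixed by Frobenius,
the relation at \<open>x [^] q\<close> is the \<open>q\<close>-th power of the relation at \<open>x\<close>.\<close>

lemma trace_relation_from_p_regular:
  fixes c :: "_ \<Rightarrow> int"
  assumes rel: "\<And>x. x \<in> p_regular p G \<Longrightarrow>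
      (\<Sum>\<phi>\<in>IBr p res G. of_int (c \<phi>) * modular_trace \<phi> x) = 0"
    and x: "x \<in> carrier G"
  shows "(\<Sum>\<phi>\<in>IBr p res G. of_int (c \<phi>) * modular_trace \<phi> x) = 0"
proof -
  have prime: "normalization_semidom_class.prime CHAR('k)" using char_k p_prime by simp
  have "ord x \<noteq> 0" using ord_ge_1[OF fin x] by simp
  moreover have "\<not> is_unit p" using p_prime not_prime_unit by blast
  ultimately obtain m where m: "ord x = p ^ multiplicity p (ord x) * m" "\<not> p dvd m"
    by (rule multiplicity_decompose')
  define e where "e = multiplicity p (ord x)"
  define q where "q = p ^ e"
  have ord_x: "ord x = q * m" unfolding q_def e_def by (rule m(1))
  have q: "q = CHAR('k) ^ e" by (simp add: q_def char_k)
  have "coprime p m" using p_prime m(2) by (rule prime_imp_coprime)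
  hence "coprime m p" by (simp add: coprime_commute)
  have "(x [^] q) [^] m = \<one>"
  proof -
    have "(x [^] q) [^] m = x [^] ord x"
      unfolding ord_x by (rule nat_pow_pow[OF x])
    thus ?thesis using x by simp
  qed
  hence "ord (x [^] q) dvd m" using x by (simp add: pow_eq_id)
  hence "coprime (ord (x [^] q)) p"
    by (rule coprime_divisors[OF _ dvd_refl \<open>coprime m p\<close>])
  hence "x [^] q \<in> p_regular p G" using x by (simp add: p_regular_def)
  note rel_q = rel[OF this]
  have "modular_trace \<phi> (x [^] q) = modular_trace \<phi> x ^ q" if \<phi>: "\<phi> \<in> IBr p res G" for \<phi>
  proof -
    obtain as where as: "\<forall>k::nat. mat_trace (snd (ibr_rep \<phi>) (x [^] k)) = (\<Sum>a\<leftarrow>as. a ^ k)"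
      using char_poly_splits[OF x split_cyclic(2)[OF x] irreducibleD(1)[OF ibr_rep(1)[OF \<phi>]]] .
    show ?thesis using as[rule_format, of 1] as[rule_format, of q] x frobenius_sum_list[OF prime q, of as] by simp
  qed
  hence "(\<Sum>\<phi>\<in>IBr p res G. of_int (c \<phi>) * modular_trace \<phi> x) ^ q = 0"
    using rel_q by (simp add: freshmans_dream_sum'[OF prime q] power_mult_distrib frobenius_of_int[OF prime q])
  thus ?thesis by simp
qed

lemma residue_of_brauer_combination:
  fixes c :: "_ \<Rightarrow> int"
  assumes x: "x \<in> p_regular p G"
    and eq: "(\<Sum>\<phi>\<in>IBr p res G. of_int (c \<phi>) * \<phi> x) = to_fract t"
  shows "(\<Sum>\<phi>\<in>IBr p res G. of_int (c \<phi>) * modular_trace \<phi> x) = res t"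
proof -
  have "\<exists>b. \<phi> x = to_fract b \<and> res b = modular_trace \<phi> x" if \<phi>: "\<phi> \<in> IBr p res G" for \<phi>
  proof -
    obtain b where "brauer_character p res G (snd (ibr_rep \<phi>)) x = to_fract b"
      "res b = modular_trace \<phi> x"
      using brauer_character_residue[OF x irreducibleD(1)[OF ibr_rep(1)[OF \<phi>]]] .
    thus ?thesis using ibr_rep(2)[OF \<phi>] by auto
  qed
  then obtain b where b: "\<And>\<phi>. \<phi> \<in> IBr p res G \<Longrightarrow> \<phi> x = to_fract (b \<phi>)"
    "\<And>\<phi>. \<phi> \<in> IBr p res G \<Longrightarrow> res (b \<phi>) = modular_trace \<phi> x" by metis
  have "to_fract (\<Sum>\<phi>\<in>IBr p res G. of_int (c \<phi>) * b \<phi>) = to_fract t"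
    using eq b(1) by (simp add: to_fract_hom.hom_of_int)
  hence "t = (\<Sum>\<phi>\<in>IBr p res G. of_int (c \<phi>) * b \<phi>)" by (simp only: to_fract_eq_iff)
  thus ?thesis using b(2) by (simp add: res.hom_sum res.hom_mult res.hom_of_int)
qed

text \<open>Reducing an integral relation modulo the maximal ideal gives a relation between irreducible traces,
so all its coefficients are divisible by \<open>p\<close>. Dividing by \<open>p\<close> and repeating, they are divisible by every
power of \<open>p\<close>.\<close>

theorem brauer_characters_independent:
  fixes c :: "_ \<Rightarrow> int"
  assumes rel: "\<And>x. x \<in> p_regular p G \<Longrightarrow> (\<Sum>\<phi>\<in>IBr p res G. of_int (c \<phi>) * \<phi> x) = 0"
    and \<phi>: "\<phi> \<in> IBr p res G"
  shows "c \<phi> = 0"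
proof -
  have p2: "p \<ge> 2" using p_prime by (simp add: prime_ge_2_nat)
  have step: "int p dvd c \<phi>" if rel: "\<And>x. x \<in> p_regular p G \<Longrightarrow> (\<Sum>\<phi>\<in>IBr p res G. of_int (c \<phi>) * \<phi> x) = 0"
    and "\<phi> \<in> IBr p res G" for c :: "_ \<Rightarrow> int" and \<phi>
  proof -
    have "(of_int (c \<phi>) :: 'k) = 0"
    proof (rule modular_traces_independent[OF subset_refl finite_IBr
          trace_relation_from_p_regular \<open>\<phi> \<in> IBr p res G\<close>])
      fix x assume x: "x \<in> p_regular p G"
      from rel[OF x] have "(\<Sum>\<phi>\<in>IBr p res G. of_int (c \<phi>) * \<phi> x) = to_fract 0" by simp
      from residue_of_brauer_combination[OF x this]
      show "(\<Sum>\<psi>\<in>IBr p res G. of_int (c \<psi>) * modular_trace \<psi> x) = 0" by simp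
    qed
    thus ?thesis by (simp add: of_int_eq_0_iff_char_dvd char_k)
  qed
  have "\<forall>\<phi>\<in>IBr p res G. int p ^ N dvd c \<phi>" for N
  proof (induction N)
    case (Suc N)
    define c' where "c' \<phi> = c \<phi> div int p ^ N" for \<phi>
    have c': "c \<phi> = int p ^ N * c' \<phi>" if "\<phi> \<in> IBr p res G" for \<phi>
      using Suc that by (simp add: c'_def)
    have "(\<Sum>\<phi>\<in>IBr p res G. of_int (c' \<phi>) * \<phi> x) = 0" if x: "x \<in> p_regular p G" for x
    proof -
      have "of_nat (p ^ N) * (\<Sum>\<phi>\<in>IBr p res G. of_int (c' \<phi>) * \<phi> x) =
          (\<Sum>\<phi>\<in>IBr p res G. of_int (c \<phi>) * \<phi> x)"
        unfolding sum_distrib_left by (intro sum.cong) (auto simp: c')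
      moreover have "(of_nat (p ^ N) :: 'o fract) \<noteq> 0"
        using p2 unfolding of_nat_eq_0_iff_char_dvd char_K by simp
      ultimately show ?thesis using rel[OF x] by (simp only: mult_eq_0_iff) blast
    qed
    hence "int p dvd c' \<phi>" if "\<phi> \<in> IBr p res G" for \<phi> using step that by blast
    hence "int p ^ N * int p dvd int p ^ N * c' \<phi>" if "\<phi> \<in> IBr p res G" for \<phi>
      by (rule mult_dvd_mono[OF dvd_refl]) (rule that)
    thus ?case by (simp add: c' mult.commute)
  qed simp
  hence dvd: "int p ^ N dvd c \<phi>" for N using \<phi> by blast
  show ?thesis
  proof (rule ccontr)
    assume "c \<phi> \<noteq> 0"
    hence "int p ^ nat \<bar>c \<phi>\<bar> \<le> \<bar>c \<phi>\<bar>" using dvd_imp_le_int[OF _ dvd[of "nat \<bar>c \<phi>\<bar>"]] by simp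
    moreover have "int (nat \<bar>c \<phi>\<bar>) < int (p ^ nat \<bar>c \<phi>\<bar>)"
      using p2 by (simp only: of_nat_less_iff) (rule power_gt_expt, simp)
    ultimately show False by simp
  qed
qed

end

lemma (in comm_ring_hom) map_poly_linear_factors:
  "map_poly hom (\<Prod>a\<leftarrow>as. [:- a, 1:]) = (\<Prod>a\<leftarrow>map hom as. [:- a, 1:])"
proof -
  interpret mp: map_poly_comm_ring_hom hom ..
  show ?thesis
  proof (induction as)
    case (Cons a as)
    have lin: "map_poly hom [:- a, 1:] = [:- hom a, 1:]" by (simp add: hom_uminus)
    have "map_poly hom (\<Prod>a\<leftarrow>a # as. [:- a, 1:]) =
        map_poly hom [:- a, 1:] * map_poly hom (\<Prod>a\<leftarrow>as. [:- a, 1:])"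
      unfolding list.map prod_list.Cons by (rule mp.hom_mult)
    thus ?case unfolding Cons.IH lin by simp
  qed simp
qed

context p_modular_system
begin

abbreviation "reduction R \<equiv> \<lambda>x. map_mat res (R x)"
abbreviation "generic R \<equiv> \<lambda>x. map_mat (to_fract :: 'o \<Rightarrow> 'o fract) (R x)"

text \<open>Either \<open>a\<close> or its inverse is integral, and each of the two is a power of the other.\<close>

lemma integral_root_of_unity:
  assumes a: "(a :: 'o fract) ^ m = 1" and m: "m > 0"
  obtains b where "a = to_fract b" "b ^ m = 1"
proof -
  have "a \<in> range to_fract"
    using fract_or_inverse_integral[of a]
  proof
    assume "inverse a \<in> range to_fract"
    then obtain b where b: "inverse a = to_fract b" by blast
    have nz: "a \<noteq> 0" using a m by (auto simp: power_0_left)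
    obtain k where k: "m = Suc k" using m by (cases m) auto
    have "a * a ^ k = 1" using a k by simp
    hence "inverse a = a ^ k" by (rule inverse_unique)
    hence "inverse a ^ k = inverse (inverse a)" using power_inverse[of a k] by (simp only:)
    hence "inverse a ^ k = a" by (simp only: inverse_inverse_eq)
    hence "a = to_fract (b ^ k)" using b by (simp add: to_fract_hom.hom_power)
    thus ?thesis by blast
  qed
  then obtain b where b: "a = to_fract b" by blast
  hence "to_fract (b ^ m) = to_fract 1" using a by (simp add: to_fract_hom.hom_power)
  hence "b ^ m = 1" by (simp only: to_fract_eq_iff)
  thus ?thesis using that b by blast
qed

text \<open>The eigenvalues of \<open>R x\<close> are roots of unity of order prime to \<open>p\<close>, hence integral, and they are the
unique such lifts of their residues, the eigenvalues of the reduction.\<close>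

lemma brauer_character_of_reduction:
  assumes R: "matrix_rep G n R" and x: "x \<in> p_regular p G"
  shows "brauer_character p res G (reduction R) x = to_fract (mat_trace (R x))"
proof -
  note X = p_regularD[OF x] and Rx = matrix_repD(1)[OF R p_regularD(1)[OF x]]
  have gen: "matrix_rep G n (generic R)"
    by (rule to_fract_hom.matrix_rep_map[OF R is_group])
  obtain as where as: "char_poly (generic R x) = (\<Prod>a\<leftarrow>as. [:- a, 1:])"
    "\<forall>k::nat. mat_trace (generic R (x [^] k)) = (\<Sum>a\<leftarrow>as. a ^ k)"
    "\<forall>a\<in>set as. \<forall>k::nat. x [^] k = \<one> \<longrightarrow> a ^ k = 1"
    using char_poly_splits[OF X(1) split_cyclic(1)[OF X(1)] gen] .
  have "\<exists>b. to_fract b = a \<and> b ^ ord x = 1" if a: "a \<in> set as" for a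
  proof -
    have "a ^ ord x = 1" using as(3) a X(4) by blast
    then obtain b where "a = to_fract b" "b ^ ord x = 1" using integral_root_of_unity X(2) by blast
    thus ?thesis by blast
  qed
  then obtain f where f: "\<And>a. a \<in> set as \<Longrightarrow> to_fract (f a) = a \<and> f a ^ ord x = 1" by metis
  define bs where "bs = map f as"
  have as_bs: "as = map to_fract bs" unfolding bs_def using f by (simp add: map_idI)
  have bs: "b ^ ord x = 1" if "b \<in> set bs" for b using that f by (auto simp: bs_def)
  have "map_poly to_fract (char_poly (R x)) = map_poly to_fract (\<Prod>b\<leftarrow>bs. [:- b, 1:])"
    using as(1) unfolding to_fract_hom.char_poly_hom[OF Rx] to_fract_hom.map_poly_linear_factors as_bs .
  from arg_cong[OF this, of "\<lambda>q. Polynomial.coeff q i" for i]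
  have "to_fract (Polynomial.coeff (char_poly (R x)) i) =
      to_fract (Polynomial.coeff (\<Prod>b\<leftarrow>bs. [:- b, 1:]) i)" for i
    by (simp only: coeff_map_poly to_fract_0)
  hence cp: "char_poly (R x) = (\<Prod>b\<leftarrow>bs. [:- b, 1:])"
    by (intro poly_eqI) (simp only: to_fract_eq_iff)
  have "char_poly (reduction R x) = (\<Prod>a\<leftarrow>map res bs. [:- a, 1:])"
    unfolding res.char_poly_hom[OF Rx] cp res.map_poly_linear_factors ..
  moreover have "reduction R x \<in> carrier_mat n n" using Rx by simp
  ultimately have "brauer_character p res G (reduction R) x =
      to_fract (\<Sum>a\<leftarrow>map res bs. root_of_unity_lift p res a)"
    using brauer_character_of_roots[of x "reduction R" n "map res bs", OF x] by simp
  moreover have "map (root_of_unity_lift p res) (map res bs) = bs"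
    using root_of_unity_lift_res[OF X(2,3) bs] by (simp add: map_idI)
  moreover have "to_fract (sum_list bs) = sum_list as"
    unfolding as_bs by (rule to_fract_hom.hom_sum_list)
  ultimately have "brauer_character p res G (reduction R) x = sum_list as" by (simp only:)
  also have "\<dots> = mat_trace (generic R x)" using as(2)[rule_format, of 1] X(1) by simp
  also have "\<dots> = to_fract (mat_trace (R x))" by (rule to_fract_hom.mat_trace_map[OF Rx])
  finally show ?thesis .
qed

lemma reduction_rep: "matrix_rep G n R \<Longrightarrow> matrix_rep G n (reduction R)"
  by (rule res.matrix_rep_map[OF _ is_group])

lemma decomposition_via_composition_series:
  assumes R: "matrix_rep G n R" and L: "is_composition_series n (reduction R) L"
    and x: "x \<in> p_regular p G"
  shows "to_fract (mat_trace (R x)) =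
    (\<Sum>\<phi>\<in>IBr p res G. of_nat (count_list (map (\<lambda>(d, \<tau>). brauer_character p res G \<tau>) L) \<phi>) * \<phi> x)"
proof -
  let ?B = "map (\<lambda>(d, \<tau>). brauer_character p res G \<tau>) L"
  have "irreducible_representation G d \<tau>" if "(d, \<tau>) \<in> set L" for d \<tau>
    using L that unfolding is_composition_series_def by blast
  hence "brauer_character p res G \<tau> \<in> IBr p res G" if "(d, \<tau>) \<in> set L" for d \<tau>
    using that unfolding IBr_def by blast
  hence "set ?B \<subseteq> IBr p res G" by auto
  have "to_fract (mat_trace (R x)) = (\<Sum>(d, \<tau>)\<leftarrow>L. brauer_character p res G \<tau> x)"
    using brauer_character_of_reduction[OF R x]
      brauer_character_composition_series[OF x reduction_rep[OF R] L] by simp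
  also have "\<dots> = (\<Sum>\<phi>\<leftarrow>?B. \<phi> x)" by (simp add: case_prod_unfold o_def)
  also have "\<dots> = (\<Sum>\<phi>\<in>IBr p res G. of_nat (count_list ?B \<phi>) * \<phi> x)"
    by (rule sum_list_as_counted_sum[OF finite_IBr \<open>set ?B \<subseteq> _\<close>])
  finally show ?thesis .
qed

lemma decomposition_numbers_unique:
  fixes d d' :: "_ \<Rightarrow> nat"
  assumes eq: "\<And>x. x \<in> p_regular p G \<Longrightarrow>
      (\<Sum>\<phi>\<in>IBr p res G. of_nat (d \<phi>) * \<phi> x) = (\<Sum>\<phi>\<in>IBr p res G. of_nat (d' \<phi>) * \<phi> x)"
    and \<phi>: "\<phi> \<in> IBr p res G"
  shows "d \<phi> = d' \<phi>"
proof -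
  have "int (d \<phi>) - int (d' \<phi>) = 0"
  proof (rule brauer_characters_independent[OF _ \<phi>, of "\<lambda>\<phi>. int (d \<phi>) - int (d' \<phi>)"])
    fix x assume "x \<in> p_regular p G"
    from eq[OF this] show "(\<Sum>\<phi>\<in>IBr p res G. of_int (int (d \<phi>) - int (d' \<phi>)) * \<phi> x) = 0"
      by (simp add: left_diff_distrib sum_subtractf)
  qed
  thus ?thesis by simp
qed

text \<open>The description in \<open>decomposition_number\<close> is meaningful because it is satisfied by at most one function;
here a solution \<open>d\<close> is given on \<open>IBr\<close> and extended by zero.\<close>

lemma decomposition_number_eq:
  assumes d: "\<And>x. x \<in> p_regular p G \<Longrightarrow> \<chi> x = (\<Sum>\<phi>\<in>IBr p res G. of_nat (d \<phi>) * \<phi> x)"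
    and \<phi>: "\<phi> \<in> IBr p res G"
  shows "decomposition_number p res G \<chi> \<phi> = d \<phi>"
proof -
  define d0 where "d0 \<phi> = (if \<phi> \<in> IBr p res G then d \<phi> else 0)" for \<phi>
  have "decomposition_number p res G \<chi> = d0"
    unfolding decomposition_number_def
  proof (rule the_equality)
    show "(\<forall>\<phi>. \<phi> \<notin> IBr p res G \<longrightarrow> d0 \<phi> = 0) \<and>
        (\<forall>x\<in>p_regular p G. \<chi> x = (\<Sum>\<phi>\<in>IBr p res G. of_nat (d0 \<phi>) * \<phi> x))"
      using d by (simp add: d0_def)
  next
    fix e assume e: "(\<forall>\<phi>. \<phi> \<notin> IBr p res G \<longrightarrow> e \<phi> = 0) \<and>
        (\<forall>x\<in>p_regular p G. \<chi> x = (\<Sum>\<phi>\<in>IBr p res G. of_nat (e \<phi>) * \<phi> x))"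
    have "e \<phi> = d \<phi>" if "\<phi> \<in> IBr p res G" for \<phi>
    proof (rule decomposition_numbers_unique[OF _ that])
      fix x assume "x \<in> p_regular p G"
      thus "(\<Sum>\<phi>\<in>IBr p res G. of_nat (e \<phi>) * \<phi> x) = (\<Sum>\<phi>\<in>IBr p res G. of_nat (d \<phi>) * \<phi> x)"
        using d e by simp
    qed
    thus "e = d0" using e by (auto simp: d0_def)
  qed
  thus ?thesis using \<phi> by (simp add: d0_def)
qed

end

section \<open>Integral forms of representations\<close>

context p_modular_system
begin

text \<open>Divisibility in a valuation ring is total, so a finite set of nonzero elements has one that divides all
others.\<close>

lemma minimal_valuation:
  fixes D :: "'o fract set"
  assumes "finite D" "D \<noteq> {}" "0 \<notin> D"
  obtains d where "d \<in> D" "\<forall>e\<in>D. e / d \<in> range to_fract"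
proof -
  have "\<exists>d\<in>D. \<forall>e\<in>D. e / d \<in> range to_fract"
    using assms
  proof (induction D rule: finite_ne_induct)
    case (singleton x)
    have "x / x = to_fract 1" using singleton by simp
    thus ?case by blast
  next
    case (insert x D)
    then obtain d where d: "d \<in> D" "\<forall>e\<in>D. e / d \<in> range to_fract" by auto
    have nz: "x \<noteq> 0" "d \<noteq> 0" using insert d by auto
    from fract_or_inverse_integral[of "d / x"] show ?case
    proof
      assume "d / x \<in> range to_fract"
      then obtain b where b: "d / x = to_fract b" by blast
      have "e / x \<in> range to_fract" if e: "e \<in> D" for e
      proof -
        from e d(2) obtain c where "e / d = to_fract c" by blast
        hence "e / x = to_fract (c * b)" using b nz by (simp add: field_simps)
        thus ?thesis by blast
      qed
      moreover have "x / x = to_fract 1" using nz by simp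
      hence "x / x \<in> range to_fract" by blast
      ultimately show ?thesis by blast
    next
      assume "inverse (d / x) \<in> range to_fract"
      hence "x / d \<in> range to_fract" by simp
      thus ?thesis using d by blast
    qed
  qed
  thus ?thesis using that by blast
qed

text \<open>Among all bases consisting of columns of the matrices \<open>\<rho> g\<close>, choose one whose determinant has minimal
valuation. By Cramer's rule the coordinates of any column of any \<open>\<rho> g\<close> are quotients of such
determinants, hence integral. The group permutes these columns, so in the chosen basis it acts by
integral matrices.\<close>

lemma integral_form:
  fixes \<rho> :: "_ \<Rightarrow> 'o fract mat"
  assumes \<rho>: "matrix_rep G n \<rho>"
  obtains R P Q where "matrix_rep G n R" "P \<in> carrier_mat n n" "Q \<in> carrier_mat n n"
    "P * Q = 1\<^sub>m n" "Q * P = 1\<^sub>m n" "\<forall>x\<in>carrier G. generic R x = Q * \<rho> x * P"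
proof -
  note D = matrix_repD[OF \<rho>]
  define F where "F = {..<n} \<rightarrow>\<^sub>E (carrier G \<times> {..<n})"
  define M where "M f = mat n n (\<lambda>(i, j). \<rho> (fst (f j)) $$ (i, snd (f j)))"
    for f :: "nat \<Rightarrow> _ \<times> nat"
  have M: "M f \<in> carrier_mat n n" for f by (simp add: M_def)
  have finF: "finite F" unfolding F_def using fin by (intro finite_PiE) auto
  define dets where "dets = {d \<in> (\<lambda>f. det (M f)) ` F. d \<noteq> 0}"
  (* The columns of the identity matrix show that some determinant is nonzero. *)
  have "M (\<lambda>j\<in>{..<n}. (\<one>, j)) = 1\<^sub>m n" using D(2) by (intro eq_matI) (auto simp: M_def)
  hence "det (M (\<lambda>j\<in>{..<n}. (\<one>, j))) = 1" by simp
  moreover have "(\<lambda>j\<in>{..<n}. (\<one>, j)) \<in> F" by (auto simp: F_def)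
  ultimately have "1 \<in> dets" unfolding dets_def
    by (metis (mono_tags, lifting) imageI mem_Collect_eq zero_neq_one)
  moreover have "finite dets" "0 \<notin> dets" using finF by (auto simp: dets_def)
  ultimately obtain d where "d \<in> dets" and min: "\<forall>e\<in>dets. e / d \<in> range to_fract"
    using minimal_valuation[of dets] by blast
  then obtain f where f: "f \<in> F" "d = det (M f)" and dnz: "d \<noteq> 0" by (auto simp: dets_def)
  define P where "P = M f"
  have P: "P \<in> carrier_mat n n" "det P \<noteq> 0" using M f dnz by (auto simp: P_def)
  obtain Q where Q: "Q \<in> carrier_mat n n" "P * Q = 1\<^sub>m n" "Q * P = 1\<^sub>m n"
    using nonzero_det_inverse[OF P] .
  have fj: "fst (f j) \<in> carrier G" "snd (f j) < n" if "j < n" for j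
    using f(1) that by (auto simp: F_def PiE_def Pi_def mem_Times_iff)
  have integral_col: "(Q *\<^sub>v col (\<rho> g) b) $ k \<in> range to_fract"
    if g: "g \<in> carrier G" and b: "b < n" and k: "k < n" for g b k
  proof -
    define v where "v = col (\<rho> g) b"
    have v: "v \<in> carrier_vec n" using D(1)[OF g] by (auto simp: v_def)
    have Qv: "Q *\<^sub>v v \<in> carrier_vec n" using Q v by auto
    have "P *\<^sub>v (Q *\<^sub>v v) = v" using P Q v by (simp flip: assoc_mult_mat_vec)
    with cramer_lemma_mat[OF P(1) Qv k]
    have cramer: "det (replace_col P v k) = (Q *\<^sub>v v) $ k * d" using f by (simp add: P_def)
    have "replace_col P v k = M (f(k := (g, b)))"
      using D(1)[OF g] b by (intro eq_matI) (auto simp: replace_col_def P_def M_def v_def)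
    moreover have "f(k := (g, b)) \<in> F"
      using f(1) g b k by (auto simp: F_def PiE_def Pi_def extensional_def)
    ultimately have "det (replace_col P v k) = 0 \<or> det (replace_col P v k) \<in> dets"
      by (auto simp: dets_def)
    thus ?thesis
    proof
      assume "det (replace_col P v k) = 0"
      hence "(Q *\<^sub>v v) $ k = to_fract 0" using cramer dnz by simp
      thus ?thesis unfolding v_def by blast
    next
      assume "det (replace_col P v k) \<in> dets"
      hence "det (replace_col P v k) / d \<in> range to_fract" using min by blast
      thus ?thesis using cramer dnz by (simp add: v_def)
    qed
  qed
  define \<tau> where "\<tau> x = Q * \<rho> x * P" for x
  have \<tau>: "matrix_rep G n \<tau>"
    unfolding \<tau>_def by (rule matrix_rep_conjugate[OF \<rho> P(1) Q])
  note T = matrix_repD[OF \<tau>]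
  have integral: "\<tau> x $$ (k, j) \<in> range to_fract" if x: "x \<in> carrier G" and k: "k < n" and j: "j < n" for x k j
  proof -
    note h = fj[OF j]
    have "col (\<rho> x * P) j = \<rho> x *\<^sub>v col P j" using col_mult2[OF D(1)[OF x] P(1) j] .
    also have "col P j = col (\<rho> (fst (f j))) (snd (f j))"
      using D(1)[OF h(1)] j h(2) by (intro eq_vecI) (auto simp: P_def M_def)
    also have "\<rho> x *\<^sub>v \<dots> = col (\<rho> (x \<otimes> fst (f j))) (snd (f j))"
      unfolding D(3)[OF x h(1)] using col_mult2[OF D(1)[OF x] D(1)[OF h(1)] h(2)] by simp
    finally have col: "col (\<rho> x * P) j = col (\<rho> (x \<otimes> fst (f j))) (snd (f j))" .
    have "\<tau> x = Q * (\<rho> x * P)"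
      unfolding \<tau>_def using Q P D(1)[OF x] by (simp add: assoc_mult_mat[of _ n n _ n _ n])
    hence "\<tau> x $$ (k, j) = (Q *\<^sub>v col (\<rho> x * P) j) $ k"
      using Q P D(1)[OF x] k j by simp
    thus ?thesis unfolding col using integral_col[OF _ h(2) k] x h(1) by simp
  qed
  define R where "R x = mat n n (\<lambda>ij. inv_into UNIV to_fract (\<tau> x $$ ij))" for x
  have gen: "generic R x = \<tau> x" if x: "x \<in> carrier G" for x
    using T(1)[OF x] integral[OF x] by (intro eq_matI) (auto simp: R_def f_inv_into_f)
  have Rc: "R x \<in> carrier_mat n n" for x by (simp add: R_def)
  have "matrix_rep G n R"
    unfolding matrix_rep_def
  proof (intro conjI ballI)
    have "map_mat to_fract (R \<one>) = map_mat to_fract (1\<^sub>m n)"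
      using gen[OF one_closed] T(2) by (simp add: to_fract_hom.mat_hom_one)
    thus "R \<one> = 1\<^sub>m n" by (rule to_fract_hom.mat_hom_inj)
    fix x y assume x: "x \<in> carrier G" and y: "y \<in> carrier G"
    have "map_mat to_fract (R (x \<otimes> y)) = map_mat to_fract (R x * R y)"
      using gen x y T(3)[OF x y] by (simp add: to_fract_hom.mat_hom_mult[OF Rc Rc])
    thus "R (x \<otimes> y) = R x * R y" by (rule to_fract_hom.mat_hom_inj)
  qed (rule Rc)
  thus ?thesis using that[of R P Q] P(1) Q gen by (simp add: \<tau>_def)
qed

text \<open>Irreducibility over \<open>K\<close> enters through the last conclusion: by the splitting hypothesis only scalars
commute with the representation, a property that survives the change of basis.\<close>

lemma integral_form_of_irreducible_character:
  assumes "\<chi> \<in> Irr G"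
  obtains n R where "n > 0" "matrix_rep G n R"
    "\<forall>x\<in>carrier G. \<chi> x = to_fract (mat_trace (R x))"
    "\<forall>T\<in>carrier_mat n n. (\<forall>x\<in>carrier G. T * generic R x = generic R x * T) \<longrightarrow> (\<exists>c. T = c \<cdot>\<^sub>m 1\<^sub>m n)"
proof -
  obtain n \<rho> where irr: "irreducible_representation G n \<rho>" and \<chi>: "\<chi> = character G \<rho>"
    using assms by (auto simp: Irr_def)
  note rep = irreducibleD(1)[OF irr] and D = matrix_repD(1)[OF irreducibleD(1)[OF irr]]
  obtain R P Q where R: "matrix_rep G n R" and PQ: "P \<in> carrier_mat n n" "Q \<in> carrier_mat n n"
    "P * Q = 1\<^sub>m n" "Q * P = 1\<^sub>m n" and gen: "\<forall>x\<in>carrier G. generic R x = Q * \<rho> x * P"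
    using integral_form[OF rep] .
  have "\<chi> x = to_fract (mat_trace (R x))" if x: "x \<in> carrier G" for x
  proof -
    have "\<chi> x = mat_trace (\<rho> x)" using x by (simp add: \<chi> character_def sum_list_diag_mat)
    also have "\<dots> = mat_trace (generic R x)"
      using gen x mat_trace_similar[OF D[OF x] PQ(1,2,3)] by simp
    also have "\<dots> = to_fract (mat_trace (R x))"
      by (rule to_fract_hom.mat_trace_map[OF matrix_repD(1)[OF R x]])
    finally show ?thesis .
  qed
  moreover have "\<exists>c. T = c \<cdot>\<^sub>m 1\<^sub>m n"
    if T: "T \<in> carrier_mat n n" and comm: "\<forall>x\<in>carrier G. T * generic R x = generic R x * T" for T
  proof -
    have "(P * T * Q) * \<rho> x = \<rho> x * (P * T * Q)" if x: "x \<in> carrier G" for x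
    proof -
      note Dx = D[OF x]
      note assoc = assoc_mult_mat[of _ n n _ n _ n]
      have QPc: "Q * (P * Y) = Y" "P * (Q * Y) = Y" if "Y \<in> carrier_mat n n" for Y
        using that PQ by (simp_all flip: assoc)
      have eq: "T * (Q * (\<rho> x * P)) = Q * (\<rho> x * (P * T))"
      proof -
        have "T * (Q * \<rho> x * P) = Q * \<rho> x * P * T" using comm gen x by simp
        thus ?thesis using T PQ Dx by (simp add: assoc)
      qed
      have "(P * T * Q) * \<rho> x = P * (T * (Q * (\<rho> x * P))) * Q"
        using T PQ Dx by (simp add: assoc)
      also have "\<dots> = \<rho> x * (P * T * Q)"
        unfolding eq using T PQ Dx by (simp add: assoc QPc)
      finally show ?thesis .
    qed
    then obtain c where c: "P * T * Q = c \<cdot>\<^sub>m 1\<^sub>m n"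
      using splitting_field_scalar[OF split_G(1) irr, of "P * T * Q"] T PQ by auto
    have "T = Q * (P * T * Q) * P"
    proof -
      note assoc = assoc_mult_mat[of _ n n _ n _ n]
      have QPc: "Q * (P * Y) = Y" if "Y \<in> carrier_mat n n" for Y
        using that PQ by (simp flip: assoc)
      show ?thesis using T PQ by (simp add: assoc QPc)
    qed
    also have "\<dots> = c \<cdot>\<^sub>m 1\<^sub>m n"
      unfolding c using PQ by (simp add: mult_smult_distrib[of _ n n _ n] mult_smult_assoc_mat[of _ n n _ n])
    finally show ?thesis by blast
  qed
  ultimately show ?thesis using that[of n R] irreducibleD(2)[OF irr] R by blast
qed

end

section \<open>The character algebra as an order of matrices\<close>

lemma linear_functional_sum:
  fixes F :: "'r::comm_ring_1 mat \<Rightarrow> 'r"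
  assumes \<Lambda>: "\<Lambda> \<subseteq> carrier_mat n n" "0\<^sub>m n n \<in> \<Lambda>"
    and add: "\<And>X Y. X \<in> \<Lambda> \<Longrightarrow> Y \<in> \<Lambda> \<Longrightarrow> X + Y \<in> \<Lambda> \<and> F (X + Y) = F X + F Y"
    and smult: "\<And>c X. X \<in> \<Lambda> \<Longrightarrow> c \<cdot>\<^sub>m X \<in> \<Lambda> \<and> F (c \<cdot>\<^sub>m X) = c * F X"
    and "finite S" "\<And>x. x \<in> S \<Longrightarrow> B x \<in> \<Lambda>"
  shows "mat n n (\<lambda>ij. \<Sum>x\<in>S. a x * B x $$ ij) \<in> \<Lambda> \<and>
    F (mat n n (\<lambda>ij. \<Sum>x\<in>S. a x * B x $$ ij)) = (\<Sum>x\<in>S. a x * F (B x))"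
  using assms(5,6)
proof (induction S rule: finite_induct)
  case empty
  have "mat n n (\<lambda>ij. 0) = (0\<^sub>m n n :: 'r mat)" by auto
  moreover have "F (0\<^sub>m n n) = 0" using smult[OF \<Lambda>(2), of 0] by simp
  ultimately show ?case using \<Lambda>(2) by simp
next
  case (insert x S)
  let ?M = "mat n n (\<lambda>ij. \<Sum>x\<in>S. a x * B x $$ ij)"
  have Bx: "B x \<in> \<Lambda>" "B x \<in> carrier_mat n n" using insert.prems \<Lambda> by auto
  have "mat n n (\<lambda>ij. \<Sum>x\<in>insert x S. a x * B x $$ ij) = a x \<cdot>\<^sub>m B x + ?M"
    using insert Bx(2) by (intro eq_matI) auto
  moreover have "?M \<in> \<Lambda>" "F ?M = (\<Sum>x\<in>S. a x * F (B x))" using insert by auto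
  ultimately show ?case using add[of "a x \<cdot>\<^sub>m B x" ?M] smult[OF Bx(1), of "a x"] insert by simp
qed

lemma (in comm_ring_hom) lin_ext_map:
  assumes "matrix_rep G n R"
  shows "map_mat hom (lin_ext G n R a) = lin_ext G n (\<lambda>x. map_mat hom (R x)) (\<lambda>x. hom (a x))"
proof (rule eq_matI)
  fix i j assume "i < dim_row (lin_ext G n (\<lambda>x. map_mat hom (R x)) (\<lambda>x. hom (a x)))"
    "j < dim_col (lin_ext G n (\<lambda>x. map_mat hom (R x)) (\<lambda>x. hom (a x)))"
  hence ij: "i < n" "j < n" by auto
  have "map_mat hom (R x) $$ (i, j) = hom (R x $$ (i, j))" if "x \<in> carrier G" for x
    using matrix_repD(1)[OF assms that] ij by simp
  thus "map_mat hom (lin_ext G n R a) $$ (i, j) =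
      lin_ext G n (\<lambda>x. map_mat hom (R x)) (\<lambda>x. hom (a x)) $$ (i, j)"
    using ij by (simp add: lin_ext_def hom_sum hom_mult)
qed auto

locale integral_character_rep = p_modular_system G p res
  for G (structure) and p :: nat and res :: "'o::idom \<Rightarrow> 'k::field" +
  fixes \<chi> :: "_ \<Rightarrow> 'o fract" and n :: nat and R :: "_ \<Rightarrow> 'o mat"
  assumes n: "n > 0" and R: "matrix_rep G n R"
    and \<chi>: "\<And>x. x \<in> carrier G \<Longrightarrow> \<chi> x = to_fract (mat_trace (R x))"
    and scalar: "\<And>T. T \<in> carrier_mat n n \<Longrightarrow>
      (\<And>x. x \<in> carrier G \<Longrightarrow> T * generic R x = generic R x * T) \<Longrightarrow> \<exists>c. T = c \<cdot>\<^sub>m 1\<^sub>m n"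
begin

definition \<rho> :: "_ \<Rightarrow> 'o fract mat" where "\<rho> x = map_mat to_fract (R x)"

lemma \<rho>: "matrix_rep G n \<rho>"
  unfolding \<rho>_def by (rule to_fract_hom.matrix_rep_map[OF R is_group])

lemmas RD = matrix_repD[OF R] and \<rho>D = matrix_repD[OF \<rho>]

lemma of_nat_eq_0 [simp]: "(of_nat m :: 'o fract) = 0 \<longleftrightarrow> m = 0"
  by (simp add: of_nat_eq_0_iff_char_dvd char_K)

lemma card_pos: "card (carrier G) > 0"
  using fin one_closed by (auto simp: card_gt_0_iff)

text \<open>The factor \<open>\<chi>(1) / |G|\<close> of the primitive idempotent \<open>e(\<chi>)\<close>.\<close>

definition c0 :: "'o fract" where "c0 = of_nat n / of_nat (card (carrier G))"

text \<open>The average \<open>\<Sum>x. \<rho>(x\<^sup>-\<^sup>1) E \<rho>(x)\<close> of the matrix unit \<open>E\<close> at \<open>(j, k)\<close> commutes with all \<open>\<rho> y\<close>, so it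
is a scalar, and the scalar is determined by its trace \<open>|G| tr E\<close>.\<close>

lemma schur_orthogonality:
  assumes "i < n" "j < n" "k < n" "l < n"
  shows "c0 * (\<Sum>x\<in>carrier G. \<rho> (inv x) $$ (i, j) * \<rho> x $$ (k, l)) = (if j = k \<and> i = l then 1 else 0)"
proof -
  define E :: "'o fract mat" where "E = mat n n (\<lambda>(a, b). if a = j \<and> b = k then 1 else 0)"
  define f where "f x = \<rho> (inv x) * (E * \<rho> x)" for x
  define S where "S = mat n n (\<lambda>ab. \<Sum>x\<in>carrier G. f x $$ ab)"
  have E: "E \<in> carrier_mat n n" and S: "S \<in> carrier_mat n n" by (auto simp: E_def S_def)
  have f: "f x \<in> carrier_mat n n" if "x \<in> carrier G" for x
    using \<rho>D(1)[OF that] \<rho>D(1)[OF inv_closed[OF that]] E by (auto simp: f_def)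
  have f_index: "f x $$ (a, b) = \<rho> (inv x) $$ (a, j) * \<rho> x $$ (k, b)"
    if x: "x \<in> carrier G" and ab: "a < n" "b < n" for x a b
  proof -
    have "f x $$ (a, b) = (\<Sum>e<n. \<rho> (inv x) $$ (a, e) * (\<Sum>d<n. E $$ (e, d) * \<rho> x $$ (d, b)))"
      using \<rho>D(1)[OF x] \<rho>D(1)[OF inv_closed[OF x]] E ab
      by (simp add: f_def scalar_prod_def atLeast0LessThan)
    also have "\<dots> = (\<Sum>e<n. if e = j then \<rho> (inv x) $$ (a, e) * \<rho> x $$ (k, b) else 0)"
    proof (intro sum.cong refl)
      fix e assume e: "e \<in> {..<n}"
      have "(\<Sum>d<n. E $$ (e, d) * \<rho> x $$ (d, b)) =
          (\<Sum>d<n. if d = k then (if e = j then \<rho> x $$ (d, b) else 0) else 0)"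
        using e by (intro sum.cong refl) (auto simp: E_def)
      thus "\<rho> (inv x) $$ (a, e) * (\<Sum>d<n. E $$ (e, d) * \<rho> x $$ (d, b)) =
          (if e = j then \<rho> (inv x) $$ (a, e) * \<rho> x $$ (k, b) else 0)"
        using assms by simp
    qed
    finally show ?thesis using assms by simp
  qed
  have "S * \<rho> y = \<rho> y * S" if y: "y \<in> carrier G" for y
  proof (rule eq_matI)
    fix a b assume "a < dim_row (\<rho> y * S)" "b < dim_col (\<rho> y * S)"
    hence ab: "a < n" "b < n" using S \<rho>D(1)[OF y] by auto
    have "(S * \<rho> y) $$ (a, b) = (\<Sum>c<n. (\<Sum>x\<in>carrier G. f x $$ (a, c)) * \<rho> y $$ (c, b))"
      using ab S \<rho>D(1)[OF y] by (simp add: S_def scalar_prod_def atLeast0LessThan)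
    also have "\<dots> = (\<Sum>x\<in>carrier G. \<Sum>c<n. f x $$ (a, c) * \<rho> y $$ (c, b))"
      by (simp add: sum_distrib_right sum.swap[of _ "{..<n}"])
    also have "\<dots> = (\<Sum>x\<in>carrier G. (f x * \<rho> y) $$ (a, b))"
    proof (intro sum.cong refl)
      fix x assume x: "x \<in> carrier G"
      show "(\<Sum>c<n. f x $$ (a, c) * \<rho> y $$ (c, b)) = (f x * \<rho> y) $$ (a, b)"
        using ab f[OF x] \<rho>D(1)[OF y] by (simp add: scalar_prod_def atLeast0LessThan)
    qed
    also have "\<dots> = (\<Sum>x\<in>carrier G. (\<rho> y * f x) $$ (a, b))"
    proof (rule sum.reindex_bij_witness[of _ "\<lambda>x. x \<otimes> inv y" "\<lambda>x. x \<otimes> y"])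
      fix x assume x: "x \<in> carrier G"
      note xy = m_closed[OF x y]
      have "\<rho> y * f (x \<otimes> y) = (\<rho> y * \<rho> (inv (x \<otimes> y))) * (E * \<rho> (x \<otimes> y))"
        using \<rho>D(1)[OF y] \<rho>D(1)[OF xy] \<rho>D(1)[OF inv_closed[OF xy]] E
        by (simp add: f_def assoc_mult_mat[of _ n n _ n _ n])
      also have "\<rho> y * \<rho> (inv (x \<otimes> y)) = \<rho> (y \<otimes> inv (x \<otimes> y))"
        using \<rho>D(3)[OF y inv_closed[OF xy]] by simp
      also have "y \<otimes> inv (x \<otimes> y) = inv x"
        using x y by (simp add: inv_mult_group m_assoc[symmetric])
      also have "\<rho> (inv x) * (E * \<rho> (x \<otimes> y)) = f x * \<rho> y"
        using \<rho>D(1)[OF x] \<rho>D(1)[OF y] \<rho>D(1)[OF inv_closed[OF x]] E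
        unfolding \<rho>D(3)[OF x y] f_def by (simp add: assoc_mult_mat[of _ n n _ n _ n])
      finally show "(\<rho> y * f (x \<otimes> y)) $$ (a, b) = (f x * \<rho> y) $$ (a, b)" by simp
    qed (use y in \<open>auto simp: m_assoc\<close>)
    also have "\<dots> = (\<Sum>x\<in>carrier G. \<Sum>c<n. \<rho> y $$ (a, c) * f x $$ (c, b))"
    proof (intro sum.cong refl)
      fix x assume x: "x \<in> carrier G"
      show "(\<rho> y * f x) $$ (a, b) = (\<Sum>c<n. \<rho> y $$ (a, c) * f x $$ (c, b))"
        using ab f[OF x] \<rho>D(1)[OF y] by (simp add: scalar_prod_def atLeast0LessThan)
    qed
    also have "\<dots> = (\<Sum>c<n. \<rho> y $$ (a, c) * (\<Sum>x\<in>carrier G. f x $$ (c, b)))"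
      by (simp add: sum_distrib_left sum.swap[of _ "{..<n}"])
    also have "\<dots> = (\<rho> y * S) $$ (a, b)"
      using ab S \<rho>D(1)[OF y] by (simp add: S_def scalar_prod_def atLeast0LessThan)
    finally show "(S * \<rho> y) $$ (a, b) = (\<rho> y * S) $$ (a, b)" .
  qed (use S \<rho>D(1)[OF y] in auto)
  then obtain c where c: "S = c \<cdot>\<^sub>m 1\<^sub>m n" using scalar[OF S] unfolding \<rho>_def by blast
  have "of_nat n * c = mat_trace S" by (simp add: c mat_trace_def)
  also have "\<dots> = (\<Sum>x\<in>carrier G. \<Sum>a<n. f x $$ (a, a))"
    by (simp add: mat_trace_def S_def sum.swap[of _ "{..<n}"])
  also have "\<dots> = (\<Sum>x\<in>carrier G. \<Sum>a<n. \<rho> x $$ (k, a) * \<rho> (inv x) $$ (a, j))"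
    by (intro sum.cong refl) (simp add: f_index mult.commute)
  also have "\<dots> = (\<Sum>x\<in>carrier G. if j = k then 1 else 0)"
  proof (intro sum.cong refl)
    fix x assume x: "x \<in> carrier G"
    have "(\<Sum>a<n. \<rho> x $$ (k, a) * \<rho> (inv x) $$ (a, j)) = (\<rho> x * \<rho> (inv x)) $$ (k, j)"
      using \<rho>D(1)[OF x] \<rho>D(1)[OF inv_closed[OF x]] assms
      by (simp add: scalar_prod_def atLeast0LessThan)
    thus "(\<Sum>a<n. \<rho> x $$ (k, a) * \<rho> (inv x) $$ (a, j)) = (if j = k then 1 else 0)"
      using matrix_rep_inv(2)[OF \<rho> x] assms by auto
  qed
  finally have "of_nat n * c = (if j = k then of_nat (card (carrier G)) else 0)" by simp
  hence c_val: "c0 * c = (if j = k then 1 else 0)"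
    using n card_pos by (auto simp: c0_def field_simps split: if_splits)
  have "(\<Sum>x\<in>carrier G. \<rho> (inv x) $$ (i, j) * \<rho> x $$ (k, l)) = S $$ (i, l)"
    using assms by (simp add: S_def f_index)
  also have "\<dots> = (if i = l then c else 0)" using assms by (simp add: c)
  finally show ?thesis using c_val by auto
qed

text \<open>The Fourier inversion formula: the section of \<open>lin_ext G n \<rho>\<close> with values in \<open>K G e(\<chi>)\<close>.\<close>

definition \<theta> :: "'o fract mat \<Rightarrow> _ \<Rightarrow> 'o fract" where
  "\<theta> X = (\<lambda>z. if z \<in> carrier G then c0 * mat_trace (X * \<rho> (inv z)) else 0)"

lemma lin_ext_\<theta>:
  assumes X: "X \<in> carrier_mat n n"
  shows "lin_ext G n \<rho> (\<theta> X) = X"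
proof (rule eq_matI)
  fix k l assume "k < dim_row X" "l < dim_col X"
  hence kl: "k < n" "l < n" using X by auto
  have tr: "mat_trace (X * \<rho> (inv x)) = (\<Sum>j<n. \<Sum>i<n. X $$ (j, i) * \<rho> (inv x) $$ (i, j))"
    if "x \<in> carrier G" for x
    using \<rho>D(1)[OF inv_closed[OF that]] X by (rule mat_trace_mult[rotated])
  have "lin_ext G n \<rho> (\<theta> X) $$ (k, l) =
      (\<Sum>x\<in>carrier G. c0 * mat_trace (X * \<rho> (inv x)) * \<rho> x $$ (k, l))"
    using kl by (simp add: lin_ext_def \<theta>_def)
  also have "\<dots> = (\<Sum>x\<in>carrier G. \<Sum>j<n. \<Sum>i<n.
      X $$ (j, i) * (c0 * (\<rho> (inv x) $$ (i, j) * \<rho> x $$ (k, l))))"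
    by (intro sum.cong refl) (simp add: tr sum_distrib_left sum_distrib_right mult_ac)
  also have "\<dots> = (\<Sum>j<n. \<Sum>i<n.
      X $$ (j, i) * (c0 * (\<Sum>x\<in>carrier G. \<rho> (inv x) $$ (i, j) * \<rho> x $$ (k, l))))"
    unfolding sum_distrib_left by (subst sum.swap, intro sum.cong refl, subst sum.swap, rule refl)
  also have "\<dots> = (\<Sum>j<n. \<Sum>i<n. if i = l then (if j = k then X $$ (j, i) else 0) else 0)"
    using kl by (intro sum.cong refl) (simp add: schur_orthogonality)
  also have "\<dots> = (\<Sum>j<n. if j = k then X $$ (j, l) else 0)" using kl by simp
  finally show "lin_ext G n \<rho> (\<theta> X) $$ (k, l) = X $$ (k, l)" using kl by simp
qed (use X in auto)

lemma \<theta>_mult: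
  assumes X: "X \<in> carrier_mat n n" and Y: "Y \<in> carrier_mat n n"
  shows "\<theta> X \<otimes>\<^bsub>group_algebra G\<^esub> \<theta> Y = \<theta> (X * Y)"
proof (rule ext)
  fix z
  show "(\<theta> X \<otimes>\<^bsub>group_algebra G\<^esub> \<theta> Y) z = \<theta> (X * Y) z"
  proof (cases "z \<in> carrier G")
    case z: True
    note zi = \<rho>D(1)[OF inv_closed[OF z]]
    have "(\<theta> X \<otimes>\<^bsub>group_algebra G\<^esub> \<theta> Y) z =
        (\<Sum>x\<in>carrier G. \<theta> X x * (c0 * mat_trace (Y * \<rho> (inv z) * \<rho> x)))"
    proof -
      have "\<theta> Y (inv x \<otimes> z) = c0 * mat_trace (Y * \<rho> (inv z) * \<rho> x)" if x: "x \<in> carrier G" for x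
      proof -
        have "inv (inv x \<otimes> z) = inv z \<otimes> x" using x z by (simp add: inv_mult_group)
        moreover have "Y * \<rho> (inv z \<otimes> x) = Y * \<rho> (inv z) * \<rho> x"
          using assoc_mult_mat[OF Y zi \<rho>D(1)[OF x]] \<rho>D(3)[OF inv_closed[OF z] x] by simp
        ultimately show ?thesis using x z by (simp add: \<theta>_def)
      qed
      thus ?thesis using z by (simp add: group_algebra_def)
    qed
    also have "\<dots> = c0 * mat_trace (Y * \<rho> (inv z) * lin_ext G n \<rho> (\<theta> X))"
      using Y zi by (subst mat_trace_mult_lin_ext[OF \<rho>]) (auto simp: sum_distrib_left mult_ac)
    also have "mat_trace (Y * \<rho> (inv z) * lin_ext G n \<rho> (\<theta> X)) = mat_trace (X * (Y * \<rho> (inv z)))"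
      unfolding lin_ext_\<theta>[OF X] using X Y zi by (intro mat_trace_mult_commute[of _ n n]) auto
    also have "X * (Y * \<rho> (inv z)) = X * Y * \<rho> (inv z)" using X Y zi by (simp add: assoc_mult_mat[of _ n n _ n _ n])
    finally show ?thesis using z by (simp add: \<theta>_def)
  qed (simp add: group_algebra_def \<theta>_def)
qed

lemma \<chi>_trace: "x \<in> carrier G \<Longrightarrow> \<chi> x = mat_trace (\<rho> x)"
  using \<chi> to_fract_hom.mat_trace_map[OF RD(1)] by (simp add: \<rho>_def)

lemma central_idempotent_eq: "central_idempotent G \<chi> = \<theta> (1\<^sub>m n)"
proof -
  have "\<chi> \<one> = of_nat n" using \<chi>_trace[OF one_closed] \<rho>D(2) by (simp add: mat_trace_def)
  thus ?thesis
    using left_mult_one_mat[OF \<rho>D(1)[OF inv_closed]] \<chi>_trace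
    by (intro ext) (auto simp: central_idempotent_def \<theta>_def c0_def)
qed

text \<open>Multiplication by \<open>e(\<chi>)\<close> is the projection of the group algebra onto the matrix block of \<open>\<chi>\<close>.\<close>

lemma mult_central_idempotent:
  "a \<otimes>\<^bsub>group_algebra G\<^esub> central_idempotent G \<chi> = \<theta> (lin_ext G n \<rho> a)"
proof (rule ext)
  fix z
  show "(a \<otimes>\<^bsub>group_algebra G\<^esub> central_idempotent G \<chi>) z = \<theta> (lin_ext G n \<rho> a) z"
  proof (cases "z \<in> carrier G")
    case z: True
    note zi = \<rho>D(1)[OF inv_closed[OF z]]
    have "\<theta> (1\<^sub>m n) (inv x \<otimes> z) = c0 * mat_trace (\<rho> (inv z) * \<rho> x)" if x: "x \<in> carrier G" for x
    proof -
      have "inv (inv x \<otimes> z) = inv z \<otimes> x" using x z by (simp add: inv_mult_group)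
      moreover have "1\<^sub>m n * \<rho> (inv z \<otimes> x) = \<rho> (inv z) * \<rho> x"
        using \<rho>D(3)[OF inv_closed[OF z] x] left_mult_one_mat[OF mult_carrier_mat[OF zi \<rho>D(1)[OF x]]]
        by simp
      ultimately show ?thesis using x z by (simp add: \<theta>_def)
    qed
    hence "(a \<otimes>\<^bsub>group_algebra G\<^esub> central_idempotent G \<chi>) z =
        (\<Sum>x\<in>carrier G. a x * (c0 * mat_trace (\<rho> (inv z) * \<rho> x)))"
      using z unfolding central_idempotent_eq by (simp add: group_algebra_def)
    also have "\<dots> = c0 * mat_trace (\<rho> (inv z) * lin_ext G n \<rho> a)"
      by (subst mat_trace_mult_lin_ext[OF \<rho> zi]) (simp add: sum_distrib_left mult_ac)
    also have "mat_trace (\<rho> (inv z) * lin_ext G n \<rho> a) = mat_trace (lin_ext G n \<rho> a * \<rho> (inv z))"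
      by (rule mat_trace_mult_commute[OF zi]) simp
    finally show ?thesis using z by (simp add: \<theta>_def)
  qed (simp add: group_algebra_def \<theta>_def)
qed

end

section \<open>Symmetry forces the order to be maximal\<close>

context integral_character_rep
begin

abbreviation "M \<equiv> carrier_mat n n"

abbreviation A :: "('o, _ \<Rightarrow> 'o fract) module" where "A \<equiv> character_algebra G \<chi>"

definition emb :: "'o mat \<Rightarrow> _ \<Rightarrow> 'o fract" where
  "emb X = \<theta> (map_mat to_fract X)"

text \<open>The order spanned by the group; by \<open>carrier_A\<close> it is a copy of \<open>\<O> G e(\<chi>)\<close> under \<open>emb\<close>.\<close>

definition \<Lambda> :: "'o mat set" where "\<Lambda> = range (lin_ext G n R)"

lemma \<Lambda>_subset: "\<Lambda> \<subseteq> M" by (auto simp: \<Lambda>_def)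

lemma \<Lambda>_zero: "0\<^sub>m n n \<in> \<Lambda>"
  unfolding \<Lambda>_def lin_ext_linear(1)[of G n R, symmetric] by simp

lemma \<Lambda>_add: "X \<in> \<Lambda> \<Longrightarrow> Y \<in> \<Lambda> \<Longrightarrow> X + Y \<in> \<Lambda>"
  by (auto simp: \<Lambda>_def simp flip: lin_ext_linear(2))

lemma \<Lambda>_smult: "X \<in> \<Lambda> \<Longrightarrow> c \<cdot>\<^sub>m X \<in> \<Lambda>"
  by (auto simp: \<Lambda>_def simp flip: lin_ext_linear(3))

lemma R_in_\<Lambda>: "x \<in> carrier G \<Longrightarrow> R x \<in> \<Lambda>"
  unfolding \<Lambda>_def using lin_ext_delta[OF fin R, of x] by (intro range_eqI) (rule sym)

lemma carrier_A: "carrier A = emb ` \<Lambda>"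
proof -
  have lin: "lin_ext G n \<rho> (\<lambda>x. to_fract (r x)) = map_mat to_fract (lin_ext G n R r)" for r
    using to_fract_hom.lin_ext_map[OF R, of r] by (simp add: \<rho>_def[abs_def])
  have cong: "lin_ext G n \<rho> a = lin_ext G n \<rho> b" if "\<And>x. x \<in> carrier G \<Longrightarrow> a x = b x" for a b
    using that by (simp add: lin_ext_def)
  have "carrier A = (\<lambda>a. \<theta> (lin_ext G n \<rho> a)) ` integral_group_algebra G"
    by (simp add: character_algebra_def mult_central_idempotent)
  also have "\<dots> = emb ` \<Lambda>"
  proof (intro equalityI subsetI)
    fix u assume "u \<in> (\<lambda>a. \<theta> (lin_ext G n \<rho> a)) ` integral_group_algebra G"
    then obtain a where a: "range a \<subseteq> range to_fract" "u = \<theta> (lin_ext G n \<rho> a)"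
      by (auto simp: integral_group_algebra_def)
    have "to_fract (inv_into UNIV to_fract (a x)) = a x" for x
      using a(1) by (intro f_inv_into_f) auto
    hence "lin_ext G n \<rho> a = map_mat to_fract (lin_ext G n R (\<lambda>x. inv_into UNIV to_fract (a x)))"
      unfolding lin[symmetric] by (intro cong) simp
    thus "u \<in> emb ` \<Lambda>" by (auto simp: a emb_def \<Lambda>_def)
  next
    fix u assume "u \<in> emb ` \<Lambda>"
    then obtain r where u: "u = \<theta> (lin_ext G n \<rho> (\<lambda>x. to_fract (r x)))"
      by (auto simp: emb_def \<Lambda>_def lin)
    let ?a = "\<lambda>x. if x \<in> carrier G then to_fract (r x) else to_fract 0"
    have "u = \<theta> (lin_ext G n \<rho> ?a)"
      unfolding u by (intro arg_cong[of _ _ \<theta>] cong) simp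
    moreover have "?a \<in> integral_group_algebra G"
      unfolding integral_group_algebra_def group_algebra_def by auto
    ultimately show "u \<in> (\<lambda>a. \<theta> (lin_ext G n \<rho> a)) ` integral_group_algebra G" by blast
  qed
  finally show ?thesis .
qed

lemma emb_add:
  assumes "X \<in> M" "Y \<in> M"
  shows "emb X \<oplus>\<^bsub>A\<^esub> emb Y = emb (X + Y)"
proof (rule ext)
  fix z
  show "(emb X \<oplus>\<^bsub>A\<^esub> emb Y) z = emb (X + Y) z"
  proof (cases "z \<in> carrier G")
    case True
    note zi = \<rho>D(1)[OF inv_closed[OF True]]
    have "map_mat to_fract (X + Y) = map_mat to_fract X + (map_mat to_fract Y :: 'o fract mat)"
      using assms by (intro eq_matI) auto
    hence "map_mat to_fract (X + Y) * \<rho> (inv z) =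
        map_mat to_fract X * \<rho> (inv z) + map_mat to_fract Y * \<rho> (inv z)"
      using assms zi by (auto intro: add_mult_distrib_mat)
    hence "mat_trace (map_mat to_fract (X + Y) * \<rho> (inv z)) =
        mat_trace (map_mat to_fract X * \<rho> (inv z)) + mat_trace (map_mat to_fract Y * \<rho> (inv z))"
      using assms zi by (simp add: mat_trace_add[of _ n])
    thus ?thesis
      using True by (simp add: character_algebra_def group_algebra_def emb_def \<theta>_def distrib_left)
  qed (simp add: character_algebra_def group_algebra_def emb_def \<theta>_def)
qed

lemma emb_smult:
  assumes "X \<in> M"
  shows "c \<odot>\<^bsub>A\<^esub> emb X = emb (c \<cdot>\<^sub>m X)"
proof (rule ext)
  fix z
  show "(c \<odot>\<^bsub>A\<^esub> emb X) z = emb (c \<cdot>\<^sub>m X) z"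
  proof (cases "z \<in> carrier G")
    case True
    note zi = \<rho>D(1)[OF inv_closed[OF True]]
    have "map_mat to_fract (c \<cdot>\<^sub>m X) = to_fract c \<cdot>\<^sub>m map_mat to_fract X"
      by (intro eq_matI) auto
    hence "mat_trace (map_mat to_fract (c \<cdot>\<^sub>m X) * \<rho> (inv z)) =
        to_fract c * mat_trace (map_mat to_fract X * \<rho> (inv z))"
      using assms zi by (simp add: mult_smult_assoc_mat[of _ n n _ n] mat_trace_smult[of _ n])
    thus ?thesis
      using True by (simp add: character_algebra_def group_algebra_def emb_def \<theta>_def)
  qed (simp add: character_algebra_def group_algebra_def emb_def \<theta>_def)
qed

lemma emb_mult:
  assumes "X \<in> M" "Y \<in> M"
  shows "emb X \<otimes>\<^bsub>A\<^esub> emb Y = emb (X * Y)"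
  using assms
  by (simp add: character_algebra_def emb_def \<theta>_mult to_fract_hom.mat_hom_mult[OF assms])

lemma emb_one: "\<one>\<^bsub>A\<^esub> = emb (1\<^sub>m n)"
  by (simp add: character_algebra_def central_idempotent_eq emb_def to_fract_hom.mat_hom_one)

lemma emb_zero: "\<zero>\<^bsub>A\<^esub> = emb (0\<^sub>m n n)"
proof -
  have "mat_trace (0\<^sub>m n n * \<rho> (inv z)) = 0" if "z \<in> carrier G" for z
    using \<rho>D(1)[OF inv_closed[OF that]] by (simp add: mat_trace_def)
  moreover have "map_mat to_fract (0\<^sub>m n n) = (0\<^sub>m n n :: 'o fract mat)" by (intro eq_matI) auto
  ultimately show ?thesis
    by (intro ext) (simp add: character_algebra_def group_algebra_def emb_def \<theta>_def)
qed

lemma emb_inj: "inj_on emb M"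
proof (rule inj_onI)
  fix X Y assume X: "X \<in> M" and Y: "Y \<in> M" and eq: "emb X = emb Y"
  have "map_mat to_fract X = lin_ext G n \<rho> (emb X)" "map_mat to_fract Y = lin_ext G n \<rho> (emb Y)"
    using X Y lin_ext_\<theta> by (simp_all add: emb_def)
  hence "map_mat to_fract X = (map_mat to_fract Y :: 'o fract mat)" using eq by simp
  thus "X = Y" by (rule to_fract_hom.mat_hom_inj)
qed

lemma emb_in_carrier: "X \<in> \<Lambda> \<Longrightarrow> emb X \<in> carrier A"
  by (simp add: carrier_A)

lemma emb_in_carrierD: "X \<in> M \<Longrightarrow> emb X \<in> carrier A \<Longrightarrow> X \<in> \<Lambda>"
  unfolding carrier_A using emb_inj \<Lambda>_subset by (auto dest: inj_onD)

definition unemb :: "(_ \<Rightarrow> 'o fract) \<Rightarrow> 'o mat" where "unemb = the_inv_into M emb"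

lemma unemb_emb: "X \<in> M \<Longrightarrow> unemb (emb X) = X"
  unfolding unemb_def by (rule the_inv_into_f_f[OF emb_inj])

lemma dual_iff:
  "f \<in> dual A \<longleftrightarrow> f \<in> extensional (carrier A) \<and>
     (\<forall>X\<in>\<Lambda>. \<forall>Y\<in>\<Lambda>. f (emb (X + Y)) = f (emb X) + f (emb Y)) \<and>
     (\<forall>r. \<forall>X\<in>\<Lambda>. f (emb (r \<cdot>\<^sub>m X)) = r * f (emb X))"
proof -
  have add: "(\<forall>X\<in>\<Lambda>. \<forall>Y\<in>\<Lambda>. f (emb X \<oplus>\<^bsub>A\<^esub> emb Y) = f (emb X) + f (emb Y)) \<longleftrightarrow>
      (\<forall>X\<in>\<Lambda>. \<forall>Y\<in>\<Lambda>. f (emb (X + Y)) = f (emb X) + f (emb Y))"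
  proof (intro ball_cong refl)
    fix X Y assume "X \<in> \<Lambda>" "Y \<in> \<Lambda>"
    hence "X \<in> M" "Y \<in> M" using \<Lambda>_subset by auto
    thus "(f (emb X \<oplus>\<^bsub>A\<^esub> emb Y) = f (emb X) + f (emb Y)) = (f (emb (X + Y)) = f (emb X) + f (emb Y))"
      by (simp only: emb_add)
  qed
  have smult: "(\<forall>r. \<forall>X\<in>\<Lambda>. f (r \<odot>\<^bsub>A\<^esub> emb X) = r * f (emb X)) \<longleftrightarrow>
      (\<forall>r. \<forall>X\<in>\<Lambda>. f (emb (r \<cdot>\<^sub>m X)) = r * f (emb X))"
  proof (intro all_cong1 ball_cong refl)
    fix r X assume "X \<in> \<Lambda>"
    hence "X \<in> M" using \<Lambda>_subset by auto
    thus "(f (r \<odot>\<^bsub>A\<^esub> emb X) = r * f (emb X)) = (f (emb (r \<cdot>\<^sub>m X)) = r * f (emb X))"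
      by (simp only: emb_smult)
  qed
  have "f \<in> dual A \<longleftrightarrow> f \<in> extensional (carrier A) \<and>
      (\<forall>a\<in>carrier A. \<forall>b\<in>carrier A. f (a \<oplus>\<^bsub>A\<^esub> b) = f a + f b) \<and>
      (\<forall>r. \<forall>a\<in>carrier A. f (r \<odot>\<^bsub>A\<^esub> a) = r * f a)"
    unfolding dual_def LinearCombinations.module_hom_def regular_module_def by (simp add: Pi_iff) blast
  thus ?thesis unfolding carrier_A ball_simps add smult .
qed

lemma integral_coefficients:
  assumes "X \<in> M" "x \<in> carrier G"
  shows "to_fract (of_nat n * mat_trace (X * R (inv x))) =
    of_nat (card (carrier G)) * \<theta> (map_mat to_fract X) x"
proof -
  have "mat_trace (map_mat to_fract X * \<rho> (inv x)) = to_fract (mat_trace (X * R (inv x)))"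
    using assms RD(1)[OF inv_closed[OF assms(2)]]
    by (simp add: \<rho>_def to_fract_hom.mat_trace_map[of _ n] flip: to_fract_hom.mat_hom_mult[of _ n n _ n])
  thus ?thesis using assms card_pos by (simp add: \<theta>_def c0_def to_fract_hom.hom_of_nat)
qed

text \<open>The Fourier coefficients of an integral matrix become integral after multiplication by \<open>|G|\<close>.\<close>

lemma card_multiple_as_combination:
  assumes X: "X \<in> M"
  shows "of_nat (card (carrier G)) \<cdot>\<^sub>m X = lin_ext G n R (\<lambda>x. of_nat n * mat_trace (X * R (inv x)))"
proof -
  let ?X = "map_mat to_fract X :: 'o fract mat"
  have XK: "?X \<in> carrier_mat n n" using X by simp
  define a where "a x = of_nat n * mat_trace (X * R (inv x))" for x
  have a: "to_fract (a x) = of_nat (card (carrier G)) * \<theta> ?X x" if "x \<in> carrier G" for x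
    unfolding a_def by (rule integral_coefficients[OF X that])
  have "map_mat to_fract (lin_ext G n R a) = lin_ext G n \<rho> (\<lambda>x. to_fract (a x))"
    using to_fract_hom.lin_ext_map[OF R, of a] by (simp add: \<rho>_def[abs_def])
  also have "\<dots> = of_nat (card (carrier G)) \<cdot>\<^sub>m lin_ext G n \<rho> (\<theta> ?X)"
    using a by (intro eq_matI) (auto simp: lin_ext_def sum_distrib_left mult.assoc)
  also have "\<dots> = map_mat to_fract (of_nat (card (carrier G)) \<cdot>\<^sub>m X)"
    unfolding lin_ext_\<theta>[OF XK] by (intro eq_matI) (auto simp: to_fract_hom.hom_of_nat)
  finally have "lin_ext G n R a = of_nat (card (carrier G)) \<cdot>\<^sub>m X"
    by (rule to_fract_hom.mat_hom_inj)
  thus ?thesis by (simp add: a_def[abs_def])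
qed

text \<open>The hypothesis on \<open>g\<close> says that \<open>\<chi> g\<close> is a unit; it pins down the symmetrizing form \<open>F = c * tr\<close> by
forcing \<open>c\<close> to be integral. Surjectivity of \<open>\<Phi>\<close>, applied to the forms \<open>X \<mapsto> tr (X Z)\<close>, then places every
integral matrix \<open>Z\<close> in \<open>\<Lambda>\<close>.\<close>

theorem full_order_if_symmetric:
  assumes sym: "symmetric_algebra A" and g: "g \<in> carrier G" and unit: "res (mat_trace (R g)) \<noteq> 0"
  shows "\<Lambda> = M"
proof -
  interpret A: ring A using sym by (simp add: symmetric_algebra_def unital_algebra_def)
  obtain \<Phi> where bij: "bij_betw \<Phi> (carrier A) (dual A)"
    and act: "\<And>a b x. a \<in> carrier A \<Longrightarrow> b \<in> carrier A \<Longrightarrow> x \<in> carrier A \<Longrightarrow>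
        \<Phi> (a \<otimes>\<^bsub>A\<^esub> x \<otimes>\<^bsub>A\<^esub> b) = dual_action A a (\<Phi> x) b"
    using sym unfolding symmetric_algebra_def by blast
  define f where "f = \<Phi> \<one>\<^bsub>A\<^esub>"
  define F where "F X = f (emb X)" for X
  have f_dual: "f \<in> dual A" using bij unfolding f_def bij_betw_def by blast
  have F_add: "F (X + Y) = F X + F Y" if "X \<in> \<Lambda>" "Y \<in> \<Lambda>" for X Y
    using f_dual that unfolding dual_iff F_def by blast
  have F_smult: "F (c \<cdot>\<^sub>m X) = c * F X" if "X \<in> \<Lambda>" for c X
    using f_dual that unfolding dual_iff F_def by blast
  have \<Lambda>_mult: "X * Y \<in> \<Lambda>" if "X \<in> \<Lambda>" "Y \<in> \<Lambda>" for X Y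
  proof (rule emb_in_carrierD)
    have "emb X \<otimes>\<^bsub>A\<^esub> emb Y \<in> carrier A" using that emb_in_carrier by (intro A.m_closed)
    thus "emb (X * Y) \<in> carrier A" using that \<Lambda>_subset by (subst (asm) emb_mult) auto
    show "X * Y \<in> M" using that \<Lambda>_subset by (intro mult_carrier_mat[of _ n n]) auto
  qed
  have \<Phi>_left: "\<Phi> (emb Y) (emb X) = F (X * Y)" and \<Phi>_right: "\<Phi> (emb Y) (emb X) = F (Y * X)"
    if X: "X \<in> \<Lambda>" and Y: "Y \<in> \<Lambda>" for X Y
  proof -
    note XA = emb_in_carrier[OF X] and YA = emb_in_carrier[OF Y]
    have XM: "X \<in> M" and YM: "Y \<in> M" using X Y \<Lambda>_subset by auto
    have "\<Phi> (emb Y) = dual_action A (emb Y) f \<one>\<^bsub>A\<^esub>"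
      using act[OF YA A.one_closed A.one_closed] YA by (simp add: f_def)
    thus "\<Phi> (emb Y) (emb X) = F (X * Y)"
      using XA YA emb_mult[OF XM YM] by (simp add: dual_action_def F_def)
    have "\<Phi> (emb Y) = dual_action A \<one>\<^bsub>A\<^esub> f (emb Y)"
      using act[OF A.one_closed YA A.one_closed] YA by (simp add: f_def)
    thus "\<Phi> (emb Y) (emb X) = F (Y * X)"
      using XA YA A.m_closed[OF YA XA] emb_mult[OF YM XM] by (simp add: dual_action_def F_def)
  qed
  have F_commute: "F (X * Y) = F (Y * X)" if "X \<in> \<Lambda>" "Y \<in> \<Lambda>" for X Y
    using \<Phi>_left[OF that] \<Phi>_right[OF that] by simp
  have F_lin: "F (lin_ext G n R a) = (\<Sum>x\<in>carrier G. a x * F (R x))" for a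
  proof -
    have "lin_ext G n R a = mat n n (\<lambda>ij. \<Sum>x\<in>carrier G. a x * R x $$ ij)"
      by (simp add: lin_ext_def case_prod_unfold)
    thus ?thesis
      using linear_functional_sum[of \<Lambda> n F "carrier G" R a] \<Lambda>_subset \<Lambda>_zero \<Lambda>_add \<Lambda>_smult F_add F_smult
        fin R_in_\<Lambda> by auto
  qed
  define h where "h x = c0 * to_fract (F (R (inv x)))" for x
  define C where "C = lin_ext G n \<rho> h"
  (* C represents F on the span over K, as F X = tr (X C); it is central because the function h
     is constant on conjugacy classes. *)
  have "C * \<rho> y = \<rho> y * C" if y: "y \<in> carrier G" for y
  proof -
    have "h (z \<otimes> inv y) = h (inv y \<otimes> z)" if z: "z \<in> carrier G" for z
      using y z F_commute[OF R_in_\<Lambda>[OF y] R_in_\<Lambda>[OF inv_closed[OF z]]]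
      by (simp add: h_def inv_mult_group RD(3))
    thus ?thesis
      unfolding C_def rep_mult_lin_ext[OF \<rho> y] lin_ext_mult_rep[OF \<rho> y] by (simp add: lin_ext_def)
  qed
  then obtain c where c: "C = c \<cdot>\<^sub>m 1\<^sub>m n"
    using scalar[of C] unfolding \<rho>_def C_def by auto
  have F_trace: "to_fract (F X) = c * to_fract (mat_trace X)" if X: "X \<in> \<Lambda>" for X
  proof -
    have XM: "X \<in> M" using X \<Lambda>_subset by auto
    let ?X = "map_mat to_fract X :: 'o fract mat"
    have XK: "?X \<in> carrier_mat n n" using XM by simp
    define a where "a x = of_nat n * mat_trace (X * R (inv x))" for x
    have a: "to_fract (a x) = of_nat (card (carrier G)) * \<theta> ?X x" if "x \<in> carrier G" for x
      unfolding a_def by (rule integral_coefficients[OF XM that])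
    have "lin_ext G n R a = of_nat (card (carrier G)) \<cdot>\<^sub>m X"
      unfolding card_multiple_as_combination[OF XM] by (simp add: a_def[abs_def])
    hence "of_nat (card (carrier G)) * F X = (\<Sum>x\<in>carrier G. a x * F (R x))"
      using F_lin[of a] F_smult[OF X] by simp
    hence "of_nat (card (carrier G)) * to_fract (F X) =
        to_fract (\<Sum>x\<in>carrier G. a x * F (R x))"
      by (metis to_fract_mult to_fract_hom.hom_of_nat)
    also have "\<dots> = (\<Sum>x\<in>carrier G. of_nat (card (carrier G)) * (\<theta> ?X x * to_fract (F (R x))))"
      unfolding to_fract_sum to_fract_mult by (intro sum.cong refl) (simp add: a mult.assoc)
    also have "\<dots> = of_nat (card (carrier G)) * (\<Sum>x\<in>carrier G. \<theta> ?X x * to_fract (F (R x)))"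
      by (rule sum_distrib_left[symmetric])
    finally have "to_fract (F X) = (\<Sum>x\<in>carrier G. \<theta> ?X x * to_fract (F (R x)))"
      using card_pos by simp
    also have "\<dots> = (\<Sum>x\<in>carrier G. h x * mat_trace (?X * \<rho> x))"
      by (rule sum.reindex_bij_witness[of _ "\<lambda>x. inv x" "\<lambda>x. inv x"])
        (auto simp: h_def \<theta>_def)
    also have "\<dots> = mat_trace (?X * C)"
      unfolding C_def by (rule mat_trace_mult_lin_ext[OF \<rho> XK, symmetric])
    also have "?X * C = c \<cdot>\<^sub>m ?X"
      unfolding c mult_smult_distrib[OF XK one_carrier_mat] right_mult_one_mat[OF XK] ..
    also have "mat_trace (c \<cdot>\<^sub>m ?X) = c * mat_trace ?X" by (rule mat_trace_smult[OF XK])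
    also have "mat_trace ?X = to_fract (mat_trace X)" by (rule to_fract_hom.mat_trace_map[OF XM])
    finally show ?thesis .
  qed
  obtain c1 where c1: "c = to_fract c1"
  proof -
    from unit obtain s where s: "1 = mat_trace (R g) * s" by (auto simp: unit_iff[symmetric] dvd_def)
    have "c = c * to_fract (mat_trace (R g) * s)" by (simp only: s[symmetric] to_fract_1 mult_1_right)
    also have "\<dots> = to_fract (F (R g) * s)"
      using F_trace[OF R_in_\<Lambda>[OF g]] by (simp add: mult.assoc)
    finally show ?thesis using that by blast
  qed
  have F_eq: "F X = c1 * mat_trace X" if "X \<in> \<Lambda>" for X
  proof -
    have "to_fract (F X) = to_fract (c1 * mat_trace X)" using F_trace[OF that] by (simp add: c1)
    thus ?thesis by (simp only: to_fract_eq_iff)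
  qed
  have "Z \<in> \<Lambda>" if Z: "Z \<in> M" for Z
  proof -
    define k where "k = (\<lambda>a\<in>carrier A. mat_trace (unemb a * Z))"
    have k: "k (emb X) = mat_trace (X * Z)" if "X \<in> \<Lambda>" for X
      using that \<Lambda>_subset by (auto simp: k_def emb_in_carrier unemb_emb)
    have "k \<in> dual A"
      unfolding dual_iff
    proof (intro conjI ballI allI)
      show "k \<in> extensional (carrier A)" by (simp add: k_def)
      fix X assume X: "X \<in> \<Lambda>"
      hence XM: "X \<in> M" using \<Lambda>_subset by auto
      show "k (emb (r \<cdot>\<^sub>m X)) = r * k (emb X)" for r
        using k[OF X] k[OF \<Lambda>_smult[OF X]] XM Z
        by (simp add: mult_smult_assoc_mat[of _ n n _ n] mat_trace_smult[of _ n])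
      fix Y assume Y: "Y \<in> \<Lambda>"
      hence YM: "Y \<in> M" using \<Lambda>_subset by auto
      show "k (emb (X + Y)) = k (emb X) + k (emb Y)"
        using k[OF X] k[OF Y] k[OF \<Lambda>_add[OF X Y]] XM YM Z
        by (simp add: add_mult_distrib_mat[of _ n n] mat_trace_add[of _ n])
    qed
    hence "k \<in> \<Phi> ` carrier A" using bij by (simp add: bij_betw_def)
    then obtain Y where Y: "Y \<in> \<Lambda>" "\<Phi> (emb Y) = k" unfolding carrier_A by blast
    have YM: "Y \<in> M" using Y \<Lambda>_subset by auto
    have eq: "mat_trace (X * Z) = mat_trace (X * (c1 \<cdot>\<^sub>m Y))" if X: "X \<in> \<Lambda>" for X
    proof -
      have XM: "X \<in> M" using X \<Lambda>_subset by auto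
      have "mat_trace (X * Z) = F (X * Y)" using k[OF X] \<Phi>_left[OF X Y(1)] Y(2) by simp
      also have "\<dots> = c1 * mat_trace (X * Y)" by (rule F_eq[OF \<Lambda>_mult[OF X Y(1)]])
      also have "\<dots> = mat_trace (X * (c1 \<cdot>\<^sub>m Y))"
        using XM YM by (simp add: mult_smult_distrib[of _ n n _ n] mat_trace_smult[of _ n])
      finally show ?thesis .
    qed
    have "map_mat to_fract Z = (map_mat to_fract (c1 \<cdot>\<^sub>m Y) :: 'o fract mat)"
    proof (rule mat_eq_if_traces_eq)
      fix X :: "'o fract mat" assume X: "X \<in> carrier_mat n n"
      have gen: "mat_trace (map_mat to_fract W * X) =
          (\<Sum>x\<in>carrier G. \<theta> X x * to_fract (mat_trace (R x * W)))" if W: "W \<in> M" for W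
      proof -
        have WK: "map_mat to_fract W \<in> carrier_mat n n" using W by simp
        have "mat_trace (map_mat to_fract W * lin_ext G n \<rho> (\<theta> X)) =
            (\<Sum>x\<in>carrier G. \<theta> X x * mat_trace (map_mat to_fract W * \<rho> x))"
          by (rule mat_trace_mult_lin_ext[OF \<rho> WK])
        also have "\<dots> = (\<Sum>x\<in>carrier G. \<theta> X x * to_fract (mat_trace (R x * W)))"
        proof (intro sum.cong refl)
          fix x assume x: "x \<in> carrier G"
          have "mat_trace (map_mat to_fract W * \<rho> x) = to_fract (mat_trace (W * R x))"
            using W RD(1)[OF x]
            by (simp add: \<rho>_def to_fract_hom.mat_trace_map[of _ n] flip: to_fract_hom.mat_hom_mult[of _ n n _ n])
          also have "mat_trace (W * R x) = mat_trace (R x * W)"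
            by (rule mat_trace_mult_commute[OF W RD(1)[OF x]])
          finally show "\<theta> X x * mat_trace (map_mat to_fract W * \<rho> x) =
            \<theta> X x * to_fract (mat_trace (R x * W))" by simp
        qed
        finally show ?thesis unfolding lin_ext_\<theta>[OF X] .
      qed
      have cY: "c1 \<cdot>\<^sub>m Y \<in> M" using YM by simp
      show "mat_trace (map_mat to_fract Z * X) = mat_trace (map_mat to_fract (c1 \<cdot>\<^sub>m Y) * X)"
        unfolding gen[OF Z] gen[OF cY] using eq[OF R_in_\<Lambda>] by simp
    qed (use Z YM in auto)
    hence "Z = c1 \<cdot>\<^sub>m Y" by (rule to_fract_hom.mat_hom_inj)
    thus ?thesis using \<Lambda>_smult[OF Y(1)] by simp
  qed
  thus ?thesis using \<Lambda>_subset by blast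
qed

end

section \<open>The maximal order is symmetric\<close>

context integral_character_rep
begin

lemma ring_A_if_full_order:
  assumes full: "\<Lambda> = M"
  shows "ring A"
proof -
  interpret mat: ring "ring_mat TYPE('o) n ()" by (rule ring_mat)
  have "emb \<in> Ring.ring_hom (ring_mat TYPE('o) n ()) A"
  proof (rule ring_hom_memI)
    fix X Y assume "X \<in> carrier (ring_mat TYPE('o) n ())" "Y \<in> carrier (ring_mat TYPE('o) n ())"
    hence X: "X \<in> M" and Y: "Y \<in> M" by (simp_all add: ring_mat_simps)
    show "emb X \<in> carrier A" using X full by (simp add: emb_in_carrier)
    show "emb (X \<otimes>\<^bsub>ring_mat TYPE('o) n ()\<^esub> Y) = emb X \<otimes>\<^bsub>A\<^esub> emb Y"
      using emb_mult[OF X Y] by (simp add: ring_mat_simps)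
    show "emb (X \<oplus>\<^bsub>ring_mat TYPE('o) n ()\<^esub> Y) = emb X \<oplus>\<^bsub>A\<^esub> emb Y"
      using emb_add[OF X Y] by (simp add: ring_mat_simps)
  next
    show "emb \<one>\<^bsub>ring_mat TYPE('o) n ()\<^esub> = \<one>\<^bsub>A\<^esub>" by (simp add: ring_mat_simps emb_one)
  qed
  from mat.ring_hom_imp_img_ring[OF this]
  have "ring (A\<lparr>carrier := emb ` M, zero := emb (0\<^sub>m n n)\<rparr>)" by (simp add: ring_mat_simps)
  also have "A\<lparr>carrier := emb ` M, zero := emb (0\<^sub>m n n)\<rparr> = A\<lparr>carrier := carrier A, zero := \<zero>\<^bsub>A\<^esub>\<rparr>"
    by (simp only: carrier_A full emb_zero)
  also have "\<dots> = A" by simp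
  finally show ?thesis .
qed

lemma unital_algebra_A_if_full_order:
  assumes full: "\<Lambda> = M"
  shows "unital_algebra A"
proof -
  interpret A: ring A by (rule ring_A_if_full_order[OF full])
  have "cring (class_ring :: 'o ring)" by unfold_locales
  have elim: "\<exists>X\<in>M. a = emb X" if "a \<in> carrier A" for a
    using that by (auto simp: carrier_A full)
  have "Module.module (class_ring :: 'o ring) A"
  proof (rule Module.moduleI)
    show "cring (class_ring :: 'o ring)" by fact
    show "abelian_group A" by (rule A.is_abelian_group)
    fix r s a b assume "a \<in> carrier A"
    then obtain X where X: "X \<in> M" "a = emb X" using elim by blast
    show "r \<odot>\<^bsub>A\<^esub> a \<in> carrier A"
      using X full by (simp add: emb_smult emb_in_carrier)
    have "(r + s) \<cdot>\<^sub>m X = r \<cdot>\<^sub>m X + s \<cdot>\<^sub>m X" by (rule add_smult_distrib_right_mat[OF X(1)])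
    thus "(r \<oplus>\<^bsub>class_ring\<^esub> s) \<odot>\<^bsub>A\<^esub> a = r \<odot>\<^bsub>A\<^esub> a \<oplus>\<^bsub>A\<^esub> s \<odot>\<^bsub>A\<^esub> a"
      using X by (simp add: emb_smult emb_add)
    have "(r * s) \<cdot>\<^sub>m X = r \<cdot>\<^sub>m (s \<cdot>\<^sub>m X)" by (intro eq_matI) (auto simp: mult.assoc)
    thus "(r \<otimes>\<^bsub>class_ring\<^esub> s) \<odot>\<^bsub>A\<^esub> a = r \<odot>\<^bsub>A\<^esub> (s \<odot>\<^bsub>A\<^esub> a)"
      using X by (simp add: emb_smult)
    have "1 \<cdot>\<^sub>m X = X" by (intro eq_matI) auto
    thus "\<one>\<^bsub>class_ring\<^esub> \<odot>\<^bsub>A\<^esub> a = a" using X by (simp add: emb_smult)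
    assume "b \<in> carrier A"
    then obtain Y where Y: "Y \<in> M" "b = emb Y" using elim by blast
    show "r \<odot>\<^bsub>A\<^esub> (a \<oplus>\<^bsub>A\<^esub> b) = r \<odot>\<^bsub>A\<^esub> a \<oplus>\<^bsub>A\<^esub> r \<odot>\<^bsub>A\<^esub> b"
      using X Y add_smult_distrib_left_mat[OF X(1) Y(1)] by (simp add: emb_smult emb_add)
  qed
  moreover have "(r \<odot>\<^bsub>A\<^esub> a) \<otimes>\<^bsub>A\<^esub> b = r \<odot>\<^bsub>A\<^esub> (a \<otimes>\<^bsub>A\<^esub> b)"
    "a \<otimes>\<^bsub>A\<^esub> (r \<odot>\<^bsub>A\<^esub> b) = r \<odot>\<^bsub>A\<^esub> (a \<otimes>\<^bsub>A\<^esub> b)"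
    if ab: "a \<in> carrier A" "b \<in> carrier A" for r a b
  proof -
    obtain X Y where X: "X \<in> M" "a = emb X" and Y: "Y \<in> M" "b = emb Y"
      using elim[OF ab(1)] elim[OF ab(2)] by blast
    have XY: "X * Y \<in> M" using X Y by (intro mult_carrier_mat) auto
    show "(r \<odot>\<^bsub>A\<^esub> a) \<otimes>\<^bsub>A\<^esub> b = r \<odot>\<^bsub>A\<^esub> (a \<otimes>\<^bsub>A\<^esub> b)"
      "a \<otimes>\<^bsub>A\<^esub> (r \<odot>\<^bsub>A\<^esub> b) = r \<odot>\<^bsub>A\<^esub> (a \<otimes>\<^bsub>A\<^esub> b)"
      using X Y XY mult_smult_assoc_mat[OF X(1) Y(1)] mult_smult_distrib[OF X(1) Y(1)]
      by (simp_all add: emb_smult emb_mult)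
  qed
  ultimately show ?thesis unfolding unital_algebra_def using A.ring_axioms by blast
qed

lemma finitely_generated_projective_A_if_full_order:
  assumes full: "\<Lambda> = M"
  shows "finitely_generated_projective A"
proof -
  define \<iota> where "\<iota> a = vec (n * n) (\<lambda>k. unemb a $$ (k div n, k mod n))" for a
  define \<sigma> where "\<sigma> v = emb (mat n n (\<lambda>(i, j). v $ (i * n + j)))" for v :: "'o vec"
  have \<iota>_emb: "\<iota> (emb X) = vec (n * n) (\<lambda>k. X $$ (k div n, k mod n))" if "X \<in> M" for X
    using that by (simp add: \<iota>_def unemb_emb)
  have "\<iota> \<in> LinearCombinations.module_hom class_ring A (module_vec TYPE('o) (n * n))"
    unfolding LinearCombinations.module_hom_def module_vec_simps
  proof (intro CollectI conjI allI impI funcsetI)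
    show "\<iota> a \<in> carrier_vec (n * n)" for a by (simp add: \<iota>_def)
    fix a b assume "a \<in> carrier A \<and> b \<in> carrier A"
    then obtain X Y where X: "X \<in> M" "a = emb X" and Y: "Y \<in> M" "b = emb Y"
      by (auto simp: carrier_A full)
    have "X + Y \<in> M" using X Y by simp
    thus "\<iota> (a \<oplus>\<^bsub>A\<^esub> b) = \<iota> a + \<iota> b"
      using X Y square_index by (intro eq_vecI) (auto simp: emb_add \<iota>_emb)
  next
    fix r a assume "r \<in> carrier (class_ring :: 'o ring) \<and> a \<in> carrier A"
    then obtain X where X: "X \<in> M" "a = emb X" by (auto simp: carrier_A full)
    have "r \<cdot>\<^sub>m X \<in> M" using X by simp
    thus "\<iota> (r \<odot>\<^bsub>A\<^esub> a) = r \<cdot>\<^sub>v \<iota> a"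
      using X square_index by (intro eq_vecI) (auto simp: emb_smult \<iota>_emb)
  qed
  moreover have "\<sigma> \<in> LinearCombinations.module_hom class_ring (module_vec TYPE('o) (n * n)) A"
    unfolding LinearCombinations.module_hom_def module_vec_simps
  proof (intro CollectI conjI allI impI funcsetI)
    show "\<sigma> v \<in> carrier A" for v using full by (simp add: \<sigma>_def emb_in_carrier)
    fix v w :: "'o vec" assume vw: "v \<in> carrier_vec (n * n) \<and> w \<in> carrier_vec (n * n)"
    hence "mat n n (\<lambda>(i, j). (v + w) $ (i * n + j)) =
        mat n n (\<lambda>(i, j). v $ (i * n + j)) + mat n n (\<lambda>(i, j). w $ (i * n + j))"
      using square_index(3) by (intro eq_matI) auto
    thus "\<sigma> (v + w) = \<sigma> v \<oplus>\<^bsub>A\<^esub> \<sigma> w" by (simp add: \<sigma>_def emb_add)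
  next
    fix r and v :: "'o vec" assume "r \<in> carrier (class_ring :: 'o ring) \<and> v \<in> carrier_vec (n * n)"
    hence "mat n n (\<lambda>(i, j). (r \<cdot>\<^sub>v v) $ (i * n + j)) = r \<cdot>\<^sub>m mat n n (\<lambda>(i, j). v $ (i * n + j))"
      using square_index(3) by (intro eq_matI) auto
    thus "\<sigma> (r \<cdot>\<^sub>v v) = r \<odot>\<^bsub>A\<^esub> \<sigma> v" by (simp add: \<sigma>_def emb_smult)
  qed
  moreover have "\<sigma> (\<iota> a) = a" if "a \<in> carrier A" for a
  proof -
    obtain X where X: "X \<in> M" "a = emb X" using \<open>a \<in> carrier A\<close> by (auto simp: carrier_A full)
    have "mat n n (\<lambda>(i, j). \<iota> a $ (i * n + j)) = X"
      using X square_index(3) by (intro eq_matI) (auto simp: \<iota>_emb)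
    thus ?thesis by (simp add: \<sigma>_def X)
  qed
  ultimately show ?thesis unfolding finitely_generated_projective_def by blast
qed

text \<open>The trace form identifies the matrix ring with its dual: it is symmetric, and the form with values
\<open>f(E\<^sub>i\<^sub>j)\<close> on the matrix units is represented by the matrix with entry \<open>f(E\<^sub>i\<^sub>j)\<close> at \<open>(j, i)\<close>.\<close>

theorem symmetric_if_full_order:
  assumes full: "\<Lambda> = M"
  shows "symmetric_algebra A"
proof -
  have elim: "\<exists>X\<in>M. a = emb X" if "a \<in> carrier A" for a
    using that by (auto simp: carrier_A full)
  have embA: "emb X \<in> carrier A" if "X \<in> M" for X
    using that full by (simp add: emb_in_carrier)
  define \<Phi> where "\<Phi> a = (\<lambda>z\<in>carrier A. mat_trace (unemb a * unemb z))" for a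
  have \<Phi>_emb: "\<Phi> (emb X) (emb Z) = mat_trace (X * Z)" if "X \<in> M" "Z \<in> M" for X Z
    using that by (simp add: \<Phi>_def embA unemb_emb)
  have \<Phi>_ext: "\<Phi> a \<in> extensional (carrier A)" for a by (simp add: \<Phi>_def)
  have ext: "f = g" if "f \<in> extensional (carrier A)" "g \<in> extensional (carrier A)"
    "\<And>Z. Z \<in> M \<Longrightarrow> f (emb Z) = g (emb Z)" for f g :: "_ \<Rightarrow> 'o"
    using that(1,2)
  proof (rule extensionalityI)
    fix a assume "a \<in> carrier A"
    thus "f a = g a" using elim that(3) by blast
  qed
  have \<Phi>_dual: "\<Phi> (emb X) \<in> dual A" if X: "X \<in> M" for X
    unfolding dual_iff full
  proof (intro conjI ballI allI \<Phi>_ext)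
    fix Y Z :: "'o mat" assume Y: "Y \<in> M" and Z: "Z \<in> M"
    have "X * Y \<in> M" "X * Z \<in> M" using X Y Z by (auto intro: mult_carrier_mat)
    thus "\<Phi> (emb X) (emb (Y + Z)) = \<Phi> (emb X) (emb Y) + \<Phi> (emb X) (emb Z)"
      using X Y Z mult_add_distrib_mat[OF X Y Z] by (simp add: \<Phi>_emb mat_trace_add[of _ n])
  next
    fix r and Y :: "'o mat" assume Y: "Y \<in> M"
    have "X * Y \<in> M" using X Y by (auto intro: mult_carrier_mat)
    thus "\<Phi> (emb X) (emb (r \<cdot>\<^sub>m Y)) = r * \<Phi> (emb X) (emb Y)"
      using X Y mult_smult_distrib[OF X Y] by (simp add: \<Phi>_emb mat_trace_smult[of _ n])
  qed
  have "bij_betw \<Phi> (carrier A) (dual A)"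
  proof (rule bij_betw_imageI)
    show "inj_on \<Phi> (carrier A)"
    proof (rule inj_onI)
      fix a b assume "a \<in> carrier A" "b \<in> carrier A" and eq: "\<Phi> a = \<Phi> b"
      then obtain X Y where X: "X \<in> M" "a = emb X" and Y: "Y \<in> M" "b = emb Y" using elim by blast
      have "X = Y"
      proof (rule mat_eq_if_traces_eq[OF X(1) Y(1)])
        fix Z :: "'o mat" assume Z: "Z \<in> M"
        show "mat_trace (X * Z) = mat_trace (Y * Z)"
          using \<Phi>_emb[OF X(1) Z] \<Phi>_emb[OF Y(1) Z] eq X Y by simp
      qed
      thus "a = b" using X Y by simp
    qed
    have "f \<in> \<Phi> ` carrier A" if f: "f \<in> dual A" for f
    proof -
      define E :: "nat \<times> nat \<Rightarrow> 'o mat" where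
        "E = (\<lambda>(i, j). mat n n (\<lambda>(k, l). if k = i \<and> l = j then 1 else 0))"
      define X where "X = mat n n (\<lambda>(j, i). f (emb (E (i, j))))"
      have X: "X \<in> M" by (simp add: X_def)
      have f': "f \<in> extensional (carrier A)"
        and add: "\<And>Y Z. Y \<in> M \<Longrightarrow> Z \<in> M \<Longrightarrow> f (emb (Y + Z)) = f (emb Y) + f (emb Z)"
        and smult: "\<And>r Y. Y \<in> M \<Longrightarrow> f (emb (r \<cdot>\<^sub>m Y)) = r * f (emb Y)"
        using f unfolding dual_iff full by blast+
      have "f (emb Z) = \<Phi> (emb X) (emb Z)" if Z: "Z \<in> M" for Z
      proof -
        let ?S = "{..<n} \<times> {..<n}"
        have decomp: "Z = mat n n (\<lambda>ij. \<Sum>kl\<in>?S. Z $$ kl * E kl $$ ij)"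
        proof (rule eq_matI)
          fix i j assume "i < dim_row (mat n n (\<lambda>ij. \<Sum>kl\<in>?S. Z $$ kl * E kl $$ ij))"
            "j < dim_col (mat n n (\<lambda>ij. \<Sum>kl\<in>?S. Z $$ kl * E kl $$ ij))"
          hence ij: "i < n" "j < n" by auto
          have "(\<Sum>kl\<in>?S. Z $$ kl * E kl $$ (i, j)) = (\<Sum>kl\<in>?S. if kl = (i, j) then Z $$ kl else 0)"
            using ij by (intro sum.cong refl) (auto simp: E_def split: if_splits)
          thus "Z $$ (i, j) = mat n n (\<lambda>ij. \<Sum>kl\<in>?S. Z $$ kl * E kl $$ ij) $$ (i, j)"
            using ij by simp
        qed (use Z in auto)
        have "f (emb (mat n n (\<lambda>ij. \<Sum>kl\<in>?S. Z $$ kl * E kl $$ ij))) = (\<Sum>kl\<in>?S. Z $$ kl * f (emb (E kl)))"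
        proof (rule linear_functional_sum[of M n "\<lambda>Y. f (emb Y)" ?S E, THEN conjunct2])
          show "E kl \<in> M" if "kl \<in> ?S" for kl by (cases kl) (simp add: E_def)
        qed (use add smult in auto)
        hence "f (emb Z) = (\<Sum>kl\<in>?S. Z $$ kl * f (emb (E kl)))" using decomp by metis
        also have "\<dots> = (\<Sum>k<n. \<Sum>l<n. Z $$ (k, l) * X $$ (l, k))"
          unfolding sum.cartesian_product by (intro sum.cong) (auto simp: X_def)
        also have "\<dots> = mat_trace (Z * X)" by (rule mat_trace_mult[OF Z X, symmetric])
        also have "\<dots> = \<Phi> (emb X) (emb Z)"
          using \<Phi>_emb[OF X Z] mat_trace_mult_commute[OF Z X] by simp
        finally show ?thesis .
      qed
      hence "f = \<Phi> (emb X)" by (rule ext[OF f' \<Phi>_ext])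
      thus ?thesis using embA[OF X] by blast
    qed
    moreover have "\<Phi> a \<in> dual A" if a: "a \<in> carrier A" for a using elim[OF a] \<Phi>_dual by blast
    ultimately show "\<Phi> ` carrier A = dual A" by blast
  qed
  moreover have "\<Phi> (a \<oplus>\<^bsub>A\<^esub> b) = (\<lambda>z\<in>carrier A. \<Phi> a z + \<Phi> b z)"
    if ab: "a \<in> carrier A" "b \<in> carrier A" for a b
  proof -
    obtain X Y where X: "X \<in> M" "a = emb X" and Y: "Y \<in> M" "b = emb Y"
      using elim[OF ab(1)] elim[OF ab(2)] by blast
    show ?thesis
    proof (rule ext[OF \<Phi>_ext restrict_extensional])
      fix Z :: "'o mat" assume Z: "Z \<in> M"
      have "X * Z \<in> M" "Y * Z \<in> M" "X + Y \<in> M" using X Y Z by (auto intro: mult_carrier_mat)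
      thus "\<Phi> (a \<oplus>\<^bsub>A\<^esub> b) (emb Z) = (\<lambda>z\<in>carrier A. \<Phi> a z + \<Phi> b z) (emb Z)"
        using X Y Z add_mult_distrib_mat[OF X(1) Y(1) Z]
        by (simp add: emb_add \<Phi>_emb embA mat_trace_add[of _ n])
    qed
  qed
  moreover have "\<Phi> (a \<otimes>\<^bsub>A\<^esub> x \<otimes>\<^bsub>A\<^esub> b) = dual_action A a (\<Phi> x) b"
    if abx: "a \<in> carrier A" "b \<in> carrier A" "x \<in> carrier A" for a b x
  proof -
    obtain X Y W where X: "X \<in> M" "a = emb X" and Y: "Y \<in> M" "b = emb Y" and W: "W \<in> M" "x = emb W"
      using elim[OF abx(1)] elim[OF abx(2)] elim[OF abx(3)] by blast
    note mult = mult_carrier_mat[of _ n n _ n]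
    show ?thesis
    proof (rule ext[OF \<Phi>_ext])
      show "dual_action A a (\<Phi> x) b \<in> extensional (carrier A)" by (simp add: dual_action_def)
      fix Z :: "'o mat" assume Z: "Z \<in> M"
      have "\<Phi> (a \<otimes>\<^bsub>A\<^esub> x \<otimes>\<^bsub>A\<^esub> b) (emb Z) = mat_trace (X * W * Y * Z)"
        using X Y W Z by (simp add: emb_mult \<Phi>_emb mult del: assoc_mult_mat)
      also have "X * W * Y * Z = X * (W * (Y * Z))"
        using X Y W Z by (simp add: assoc_mult_mat[of _ n n _ n _ n] mult)
      also have "mat_trace \<dots> = mat_trace (W * (Y * Z) * X)"
        using X Y W Z by (intro mat_trace_mult_commute[of _ n n]) (auto intro!: mult)
      also have "W * (Y * Z) * X = W * (Y * Z * X)"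
        using X Y W Z by (simp add: assoc_mult_mat[of _ n n _ n _ n] mult)
      also have "mat_trace \<dots> = dual_action A a (\<Phi> x) b (emb Z)"
        using X Y W Z by (simp add: dual_action_def emb_mult \<Phi>_emb embA mult del: assoc_mult_mat)
      finally show "\<Phi> (a \<otimes>\<^bsub>A\<^esub> x \<otimes>\<^bsub>A\<^esub> b) (emb Z) = dual_action A a (\<Phi> x) b (emb Z)" .
    qed
  qed
  ultimately show ?thesis
    unfolding symmetric_algebra_def
    using unital_algebra_A_if_full_order[OF full] finitely_generated_projective_A_if_full_order[OF full]
    by blast
qed

lemma card_multiple_in_\<Lambda>: "X \<in> M \<Longrightarrow> of_nat (card (carrier G)) \<cdot>\<^sub>m X \<in> \<Lambda>"
  unfolding \<Lambda>_def card_multiple_as_combination by simp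

text \<open>A version of Nakayama's lemma. By hypothesis every integral matrix is in \<open>\<Lambda>\<close> up to a multiple of
\<open>\<pi>\<close>, hence, iterating, up to a multiple of any power of \<open>\<pi>\<close>. Some power of \<open>\<pi>\<close> is a multiple of \<open>|G|\<close>,
and multiples of \<open>|G|\<close> are in \<open>\<Lambda>\<close>.\<close>

lemma full_order_if_reduction_spans:
  assumes span: "\<And>Y. Y \<in> carrier_mat n n \<Longrightarrow> \<exists>a. lin_ext G n (reduction R) a = Y"
  shows "\<Lambda> = M"
proof -
  obtain \<pi> :: 'o where \<pi>: "prime_elem \<pi>" "\<And>x. res x = 0 \<longleftrightarrow> \<pi> dvd x"
    "\<And>x. (\<And>n. \<pi> ^ n dvd x) \<Longrightarrow> x = 0" by (rule uniformizer) blast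
  have step: "\<exists>Y\<in>\<Lambda>. \<exists>X'\<in>M. X = Y + \<pi> \<cdot>\<^sub>m X'" if X: "X \<in> M" for X
  proof -
    obtain a where a: "lin_ext G n (reduction R) a = map_mat res X"
      using span[of "map_mat res X"] X by auto
    define r where "r x = (SOME y. res y = a x)" for x
    have r: "res (r x) = a x" for x unfolding r_def by (rule someI_ex[OF res_surj])
    define Y where "Y = lin_ext G n R r"
    have YM: "Y \<in> M" by (simp add: Y_def)
    have map_eq: "map_mat res Y = map_mat res X"
      unfolding Y_def res.lin_ext_map[OF R] using a r by simp
    have eq: "res (Y $$ (i, j)) = res (X $$ (i, j))" if "i < n" "j < n" for i j
      using arg_cong[OF map_eq, of "\<lambda>W. W $$ (i, j)"] that X YM by simp
    define X' where "X' = mat n n (\<lambda>ij. SOME t. X $$ ij - Y $$ ij = \<pi> * t)"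
    have X': "X $$ (i, j) - Y $$ (i, j) = \<pi> * X' $$ (i, j)" if ij: "i < n" "j < n" for i j
    proof -
      have "\<pi> dvd X $$ (i, j) - Y $$ (i, j)"
        using eq[OF ij] by (simp add: \<pi>(2)[symmetric] res.hom_minus)
      hence "\<exists>t. X $$ (i, j) - Y $$ (i, j) = \<pi> * t" by (simp add: dvd_def)
      from someI_ex[OF this] show ?thesis using ij by (simp add: X'_def)
    qed
    have "X = Y + \<pi> \<cdot>\<^sub>m X'"
    proof (rule eq_matI)
      fix i j assume "i < dim_row (Y + \<pi> \<cdot>\<^sub>m X')" "j < dim_col (Y + \<pi> \<cdot>\<^sub>m X')"
      hence ij: "i < n" "j < n" by (auto simp: X'_def)
      have "X $$ (i, j) = Y $$ (i, j) + \<pi> * X' $$ (i, j)"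
        using X'[OF ij] by (simp add: algebra_simps)
      thus "X $$ (i, j) = (Y + \<pi> \<cdot>\<^sub>m X') $$ (i, j)" using ij by (simp add: X'_def)
    qed (use X in \<open>auto simp: X'_def\<close>)
    moreover have "Y \<in> \<Lambda>" "X' \<in> M" by (auto simp: Y_def \<Lambda>_def X'_def)
    ultimately show ?thesis by blast
  qed
  have iter: "\<exists>Y\<in>\<Lambda>. \<exists>X'\<in>M. X = Y + \<pi> ^ N \<cdot>\<^sub>m X'" if X: "X \<in> M" for X N
  proof (induction N)
    case 0
    have "X = 0\<^sub>m n n + \<pi> ^ 0 \<cdot>\<^sub>m X" using X by (intro eq_matI) auto
    thus ?case using \<Lambda>_zero X by blast
  next
    case (Suc N)
    then obtain Y X' where Y: "Y \<in> \<Lambda>" and X': "X' \<in> M" and eq: "X = Y + \<pi> ^ N \<cdot>\<^sub>m X'" by blast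
    obtain Y' X'' where Y': "Y' \<in> \<Lambda>" and X'': "X'' \<in> M" and eq': "X' = Y' + \<pi> \<cdot>\<^sub>m X''"
      using step[OF X'] by blast
    have "Y \<in> M" "Y' \<in> M" using Y Y' \<Lambda>_subset by auto
    hence "X = (Y + \<pi> ^ N \<cdot>\<^sub>m Y') + \<pi> ^ Suc N \<cdot>\<^sub>m X''"
      unfolding eq eq' using X'' by (intro eq_matI) (auto simp: algebra_simps)
    thus ?case using \<Lambda>_add[OF Y \<Lambda>_smult[OF Y']] X'' by blast
  qed
  have "(of_nat (card (carrier G)) :: 'o) \<noteq> 0" using card_pos by (simp add: of_nat_ring_eq_0_iff)
  then obtain N where "\<not> \<pi> ^ N dvd of_nat (card (carrier G))" using \<pi>(3) by blast
  hence "of_nat (card (carrier G)) dvd \<pi> ^ N" using dvd_total by blast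
  then obtain t where t: "\<pi> ^ N = of_nat (card (carrier G)) * t" by (auto simp: dvd_def)
  have "X \<in> \<Lambda>" if X: "X \<in> M" for X
  proof -
    obtain Y X' where Y: "Y \<in> \<Lambda>" and X': "X' \<in> M" and eq: "X = Y + \<pi> ^ N \<cdot>\<^sub>m X'"
      using iter[OF X, of N] by blast
    have "\<pi> ^ N \<cdot>\<^sub>m X' = of_nat (card (carrier G)) \<cdot>\<^sub>m (t \<cdot>\<^sub>m X')"
      unfolding t by (intro eq_matI) (auto simp: mult.assoc)
    also have "\<dots> \<in> \<Lambda>" using X' by (intro card_multiple_in_\<Lambda>) simp
    finally show ?thesis unfolding eq by (rule \<Lambda>_add[OF Y])
  qed
  thus ?thesis using \<Lambda>_subset by blast
qed

text \<open>If the group spans all matrices, then every vector is reached from any nonzero one.\<close>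

lemma reduction_irreducible_if_full_order:
  assumes full: "\<Lambda> = M"
  shows "irreducible_representation G n (reduction R)"
  unfolding irreducible_representation_def matrix_representation_iff
proof (intro conjI allI impI)
  show rep: "matrix_rep G n (reduction R)" by (rule reduction_rep[OF R])
  show "0 < n" by (rule n)
  fix W assume W: "VectorSpace.subspace class_ring W (module_vec TYPE('k) n) \<and>
      (\<forall>x\<in>carrier G. \<forall>w\<in>W. reduction R x *\<^sub>v w \<in> W)"
  note sub = subspace_module_vecD[OF W[THEN conjunct1]]
  show "W = {0\<^sub>v n} \<or> W = carrier_vec n"
  proof (cases "W = {0\<^sub>v n}")
    case False
    then obtain w where w: "w \<in> W" "w \<noteq> 0\<^sub>v n" using sub(2) by blast
    have wn: "w \<in> carrier_vec n" using w sub by auto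
    then obtain k where k: "k < n" "w $ k \<noteq> 0" using w(2) by (metis carrier_vecD eq_vecI index_zero_vec)
    have "u \<in> W" if u: "u \<in> carrier_vec n" for u
    proof -
      (* A matrix over the residue field that maps w to u. *)
      define Y where "Y = mat n n (\<lambda>(i, j). if j = k then u $ i / w $ k else 0)"
      obtain X where X: "X \<in> M" "map_mat res X = Y"
      proof -
        define f where "f ij = (SOME y. res y = Y $$ ij)" for ij
        have "res (f ij) = Y $$ ij" for ij unfolding f_def by (rule someI_ex[OF res_surj])
        hence "map_mat res (mat n n f) = Y" by (intro eq_matI) (auto simp: Y_def)
        thus ?thesis using that[of "mat n n f"] by simp
      qed
      hence "X \<in> range (lin_ext G n R)" using full by (simp add: \<Lambda>_def)
      then obtain a where a: "lin_ext G n R a = X" by auto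
      have lin: "lin_ext G n (reduction R) (\<lambda>x. res (a x)) = Y"
        using res.lin_ext_map[OF R, of a] a X(2) by simp
      have "Y *\<^sub>v w = u"
      proof (rule eq_vecI)
        fix i assume "i < dim_vec u"
        hence i: "i < n" using u by simp
        have "(Y *\<^sub>v w) $ i = (\<Sum>j<n. (if j = k then u $ i / w $ k else 0) * w $ j)"
          using i wn by (simp add: Y_def scalar_prod_def atLeast0LessThan)
        also have "\<dots> = (\<Sum>j<n. if j = k then u $ i / w $ k * w $ j else 0)"
          by (intro sum.cong) auto
        finally have "(Y *\<^sub>v w) $ i = (\<Sum>j<n. if j = k then u $ i / w $ k * w $ j else 0)" .
        thus "(Y *\<^sub>v w) $ i = u $ i" using k by simp
      qed (use u in \<open>auto simp: Y_def\<close>)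
      moreover have "Y *\<^sub>v w = vec n (\<lambda>i. \<Sum>x\<in>carrier G. res (a x) * (reduction R x *\<^sub>v w) $ i)"
        unfolding lin[symmetric] using lin_ext_mult_vec_index[OF rep wn]
        by (intro eq_vecI) (simp_all del: index_mult_mat_vec)
      moreover have "\<dots> \<in> W"
        using W by (intro subspace_lincomb_closed[OF W[THEN conjunct1] fin]) (use w in blast)
      ultimately show ?thesis by simp
    qed
    thus ?thesis using sub(1) by blast
  qed simp
qed

end

section \<open>The criterion\<close>

text \<open>Both conditions are equivalent to \<open>\<Lambda>\<close> being the full matrix ring over \<open>\<O>\<close>, for an integral form \<open>R\<close> of
\<open>\<chi>\<close>. The list \<open>B\<close> holds the Brauer characters of the composition factors of the reduction of \<open>R\<close>, so
that the decomposition numbers count its entries.\<close>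

theorem (in p_modular_system) symmetric_iff_lifts:
  assumes \<chi>: "\<chi> \<in> Irr G" and \<phi>: "\<phi> \<in> IBr p res G"
    and d_coprime: "coprime (decomposition_number p res G \<chi> \<phi>) p"
  shows "symmetric_algebra (character_algebra G \<chi>) \<longleftrightarrow> lifts p G \<chi> \<phi>"
proof -
  obtain n R where n: "n > 0" and R: "matrix_rep G n R"
    and \<chi>R: "\<forall>x\<in>carrier G. \<chi> x = to_fract (mat_trace (R x))"
    and scalar: "\<forall>T\<in>carrier_mat n n. (\<forall>x\<in>carrier G. T * generic R x = generic R x * T) \<longrightarrow> (\<exists>c. T = c \<cdot>\<^sub>m 1\<^sub>m n)"
    using integral_form_of_irreducible_character[OF \<chi>] .
  interpret integral_character_rep G p res \<chi> n R
    by unfold_locales (use n R \<chi>R scalar in auto)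
  obtain L where L: "is_composition_series n (reduction R) L"
    using composition_series_exists[OF reduction_rep[OF R]] .
  define B where "B = map (\<lambda>(d, \<tau>). brauer_character p res G \<tau>) L"
  have decomp: "\<chi> x = (\<Sum>\<psi>\<in>IBr p res G. of_nat (count_list B \<psi>) * \<psi> x)" if x: "x \<in> p_regular p G" for x
    using decomposition_via_composition_series[OF R L x] \<chi>R p_regularD(1)[OF x] by (simp add: B_def)
  have not_dvd: "\<not> p dvd decomposition_number p res G \<chi> \<phi>"
  proof
    assume "p dvd decomposition_number p res G \<chi> \<phi>"
    hence "is_unit p" using d_coprime by (meson coprime_common_divisor dvd_refl)
    thus False using p_prime not_prime_unit by blast
  qed
  show ?thesis
  proof
    assume sym: "symmetric_algebra (character_algebra G \<chi>)"
    have "\<exists>g\<in>carrier G. res (mat_trace (R g)) \<noteq> 0"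
    proof (rule ccontr)
      assume "\<not> ?thesis"
      hence zero: "res (mat_trace (R x)) = 0" if "x \<in> carrier G" for x using that by blast
      have "(of_int (int (count_list B \<phi>)) :: 'k) = 0"
      proof (rule modular_traces_independent[OF subset_refl finite_IBr trace_relation_from_p_regular \<phi>])
        fix x assume x: "x \<in> p_regular p G"
        have "(\<Sum>\<psi>\<in>IBr p res G. of_int (int (count_list B \<psi>)) * \<psi> x) = to_fract (mat_trace (R x))"
          using decomp[OF x] \<chi>R p_regularD(1)[OF x] by simp
        from residue_of_brauer_combination[OF x this]
        show "(\<Sum>\<psi>\<in>IBr p res G. of_int (int (count_list B \<psi>)) * modular_trace \<psi> x) = 0"
          using zero[OF p_regularD(1)[OF x]] by simp
      qed
      hence "p dvd count_list B \<phi>" by (simp add: of_nat_eq_0_iff_char_dvd char_k)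
      thus False using not_dvd decomposition_number_eq[OF decomp \<phi>] by simp
    qed
    then obtain g where "g \<in> carrier G" "res (mat_trace (R g)) \<noteq> 0" by blast
    hence "\<Lambda> = M" by (rule full_order_if_symmetric[OF sym])
    hence irr: "irreducible_representation G n (reduction R)" by (rule reduction_irreducible_if_full_order)
    define \<psi> where "\<psi> = brauer_character p res G (reduction R)"
    have \<psi>: "\<psi> \<in> IBr p res G" using irr by (auto simp: \<psi>_def IBr_def)
    have \<chi>\<psi>: "\<chi> x = \<psi> x" if x: "x \<in> p_regular p G" for x
      using brauer_character_of_reduction[OF R x] \<chi>R p_regularD(1)[OF x] by (simp add: \<psi>_def)
    have "decomposition_number p res G \<chi> \<phi> = (if \<phi> = \<psi> then 1 else 0)"
    proof (rule decomposition_number_eq[OF _ \<phi>])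
      fix x assume "x \<in> p_regular p G"
      have "(\<Sum>\<eta>\<in>IBr p res G. of_nat (if \<eta> = \<psi> then 1 else 0) * \<eta> x) =
          (\<Sum>\<eta>\<in>IBr p res G. if \<eta> = \<psi> then \<eta> x else 0)" by (intro sum.cong) auto
      thus "\<chi> x = (\<Sum>\<eta>\<in>IBr p res G. of_nat (if \<eta> = \<psi> then 1 else 0) * \<eta> x)"
        using \<chi>\<psi>[OF \<open>x \<in> p_regular p G\<close>] finite_IBr \<psi> by simp
    qed
    hence "\<phi> = \<psi>" using not_dvd by (auto split: if_splits)
    thus "lifts p G \<chi> \<phi>" using \<chi>\<psi> by (simp add: lifts_def)
  next
    assume lift: "lifts p G \<chi> \<phi>"
    have count: "count_list B \<psi> = (if \<psi> = \<phi> then 1 else 0)" if "\<psi> \<in> IBr p res G" for \<psi>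
    proof (rule decomposition_numbers_unique[OF _ that])
      fix x assume x: "x \<in> p_regular p G"
      have "(\<Sum>\<eta>\<in>IBr p res G. of_nat (if \<eta> = \<phi> then 1 else 0) * \<eta> x) =
          (\<Sum>\<eta>\<in>IBr p res G. if \<eta> = \<phi> then \<eta> x else 0)" by (intro sum.cong) auto
      thus "(\<Sum>\<eta>\<in>IBr p res G. of_nat (count_list B \<eta>) * \<eta> x) =
          (\<Sum>\<eta>\<in>IBr p res G. of_nat (if \<eta> = \<phi> then 1 else 0) * \<eta> x)"
        using decomp[OF x] lift x finite_IBr \<phi> by (simp add: lifts_def)
    qed
    have "set B \<subseteq> IBr p res G"
    proof -
      have "brauer_character p res G \<tau> \<in> IBr p res G" if "(d, \<tau>) \<in> set L" for d \<tau>
      proof -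
        have "irreducible_representation G d \<tau>"
          using L that unfolding is_composition_series_def by blast
        thus ?thesis unfolding IBr_def by blast
      qed
      thus ?thesis by (auto simp: B_def)
    qed
    hence "length B = (\<Sum>\<psi>\<in>IBr p res G. count_list B \<psi>)"
      using sum_count_set[of B "IBr p res G"] finite_IBr by simp
    also have "\<dots> = (\<Sum>\<psi>\<in>IBr p res G. if \<psi> = \<phi> then 1 else 0)"
      by (intro sum.cong refl count)
    also have "\<dots> = 1" using finite_IBr \<phi> by simp
    finally have "length L = 1" by (simp add: B_def)
    hence irr: "irreducible_representation G n (reduction R)"
      using L unfolding is_composition_series_def by blast
    have "\<Lambda> = M"
    proof (rule full_order_if_reduction_spans)
      fix Y :: "'k mat" assume "Y \<in> carrier_mat n n"
      then obtain a where "lin_ext G n (reduction R) a = Y"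
        by (rule burnside_span[OF fin split_G(2) irr])
      thus "\<exists>a. lin_ext G n (reduction R) a = Y" by blast
    qed
    thus "symmetric_algebra (character_algebra G \<chi>)" by (rule symmetric_if_full_order)
  qed
qed

theorem corollary1p2:
  fixes p :: nat
    and res :: "'o::idom \<Rightarrow> 'k::field"
    and G :: "('g, 'm) monoid_scheme"
    and \<chi> \<phi> :: "'g \<Rightarrow> 'o fract"
  assumes "normalization_semidom_class.prime p"
    and "complete_discrete_valuation_ring TYPE('o)"
    and "residue_map res"
    and "CHAR('k) = p"
    and "CHAR('o fract) = 0"
    and "group G"
    and "finite (carrier G)"
    and "\<And>H. subgroup H G \<Longrightarrow> splitting_field TYPE('o fract) (G\<lparr>carrier := H\<rparr>)"
    and "\<And>H. subgroup H G \<Longrightarrow> splitting_field TYPE('k) (G\<lparr>carrier := H\<rparr>)"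
    and "\<chi> \<in> Irr G"
    and "\<phi> \<in> IBr p res G"
    and "coprime (decomposition_number p res G \<chi> \<phi>) p"
  shows "symmetric_algebra (character_algebra G \<chi>) \<longleftrightarrow> lifts p G \<chi> \<phi>"
proof -
  interpret group G by fact
  interpret p_modular_system G p res
    by unfold_locales (fact assms)+
  show ?thesis by (rule symmetric_iff_lifts) fact+
qed

end
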